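(* For every $\beta\in(0,1]$ there exist constants $C,c_e,c_l>0$ (depending only on $\beta$) such that the following holds for all $n_1,n_2$ with $\min\{n_1,n_2\}\ge\beta n$, where $n=\max\{n_1,n_2\}$. Let $X^*\in\mathcal M(n_1,n_2,r,\mu,\kappa)$. Assume $\Omega\subseteq[n_1]\times[n_2]$ is sampled uniformly at random among subsets of a given cardinality $|\Omega|$, and that $p=|\Omega|/(n_1n_2)$ satisfies $$np\ge C\mu r\max\{\log n,\ \mu r\kappa^2\}.$$ Then with probability at least $1-3/n^3$, for every initialization $$\begin{pmatrix} U_0 \\ V_0 \end{pmatrix}\in\mathcal B_{\rm err}\!\left(\tfrac{1}{c_e\sqrt\kappa}\right)\cap\mathcal B_{\rm bln}\!\left(\tfrac1{c_l}\right)\cap\mathcal B_\mu,$$ the estimates $X_t=U_tV_t^\top$ of constrained GNMR (defined in the context) satisfy, for all $t\ge0$, $$\|X_{t+1}-X^*\|_F\le\tfrac12\|X_t-X^*\|_F.$$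
   Context: Norms: $\|\cdot\|_F$ Frobenius, $\|A\|_{2,\infty}$ the largest Euclidean norm of a row of $A$, $\|A\|_{F(\Omega)}^2=\sum_{(i,j)\in\Omega}A_{ij}^2$. $\mathcal P_\Omega(X)\in\mathbb R^{|\Omega|}$ is the vector of entries $X_{ij}$, $(i,j)\in\Omega$. $\sigma_i^*=\sigma_i(X^* )$ is the $i$-th largest singular value of $X^*$. A rank-$r$ matrix $X\in\mathbb R^{n_1\times n_2}$ with SVD $X=U\Sigma V^\top$ ($U\in\mathbb R^{n_1\times r}$, $V\in\mathbb R^{n_2\times r}$) is $\mu$-incoherent if $\|U\|_{2,\infty}\le\sqrt{\mu r/n_1}$ and $\|V\|_{2,\infty}\le\sqrt{\mu r/n_2}$. $\mathcal M(n_1,n_2,r,\mu,\kappa)$ is the set of $\mu$-incoherent $n_1\times n_2$ matrices of rank $r$ with condition number $\sigma_1/\sigma_r=\kappa$. The following are sets of stacked factor matrices $\begin{pmatrix} U \\ V \end{pmatrix}\in\mathbb R^{(n_1+n_2)\times r}$ with $U\in\mathbb R^{n_1\times r}$, $V\in\mathbb R^{n_2\times r}$: $\mathcal B_{\rm err}(\epsilon)$: $\|UV^\top-X^*\|_F\le\epsilon\sigma_r^*$; $\mathcal B_{\rm bln}(\delta)$: $\|U^\top U-V^\top V\|_F\le\delta\sigma_r^*$; $\mathcal B_\mu$: $\|U\|_{2,\infty}\le\sqrt{3\mu r\sigma_1^*/n_1}$ and $\|V\|_{2,\infty}\le\sqrt{3\mu r\sigma_1^*/n_2}$. Constrained GNMR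 (setting variant) with $b=\mathcal P_\Omega(X^* )$: given $(U_t,V_t)$ and $X_t=U_tV_t^\top$, $(U_{t+1},V_{t+1})$ is any minimizer of $\|\mathcal P_\Omega(U_tV^\top+UV_t^\top-U_tV_t^\top)-b\|^2$ over $\begin{pmatrix} U \\ V \end{pmatrix}\in\mathcal B_\mu\cap\mathcal C^{(t)}$, where $\mathcal C^{(t)}$ is the set of $\begin{pmatrix} U \\ V \end{pmatrix}$ with $\|U-U_t\|_F^2+\|V-V_t\|_F^2\le\frac{8}{p\sigma_r^*}\|X_t-X^*\|_{F(\Omega)}^2$. *)

theory Defs
  imports
    "HOL-Probability.Probability_Mass_Function"
    "Jordan_Normal_Form.DL_Rank"
    "Jordan_Normal_Form.Char_Poly"
begin

text \<open>Dimensions vary below the constants of the theorem, so matrices are those of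
  \<^theory>\<open>Jordan_Normal_Form.Matrix\<close>; rows and columns are indexed from 0.\<close>

definition norm_F_on :: "(nat \<times> nat) set \<Rightarrow> real mat \<Rightarrow> real" where
  "norm_F_on \<Omega> A = L2_set (\<lambda>ij. A $$ ij) \<Omega>"

definition norm_F :: "real mat \<Rightarrow> real" where
  "norm_F A = norm_F_on ({..<dim_row A} \<times> {..<dim_col A}) A"

text \<open>Only used for matrices with at least one row.\<close>

definition norm_2_inf :: "real mat \<Rightarrow> real" where
  "norm_2_inf A = (MAX i\<in>{..<dim_row A}. L2_set (\<lambda>j. A $$ (i, j)) {..<dim_col A})"

text \<open>The coordinate space of dimension \<open>card \<Omega>\<close> is represented as the functions on \<open>\<Omega>\<close>
  (undefined elsewhere); the Euclidean norm of such a \<open>v\<close> is \<open>L2_set v \<Omega>\<close>.\<close>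

definition sample_entries :: "(nat \<times> nat) set \<Rightarrow> real mat \<Rightarrow> nat \<times> nat \<Rightarrow> real" where
  "sample_entries \<Omega> X = restrict (\<lambda>ij. X $$ ij) \<Omega>"

text \<open>The \<open>i\<close>-th largest singular value, \<open>i = 1, 2, \<dots>\<close>: the square root of the \<open>i\<close>-th largest
  eigenvalue of \<open>A\<^sup>T A\<close>, counted with multiplicity.\<close>

definition singular_value :: "nat \<Rightarrow> real mat \<Rightarrow> real" where
  "singular_value i A =
     sqrt (rev (sorted_list_of_multiset (proots (char_poly (transpose_mat A * A)))) ! (i - 1))"

text \<open>Compact singular value decomposition \<open>X = U S V\<^sup>T\<close> with \<open>r\<close> positive singular values.\<close>

definition is_svd ::
  "nat \<Rightarrow> nat \<Rightarrow> nat \<Rightarrow> real mat \<Rightarrow> real mat \<Rightarrow> real mat \<Rightarrow> real mat \<Rightarrow> bool" where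
  "is_svd n1 n2 r X U S V \<longleftrightarrow>
     U \<in> carrier_mat n1 r \<and> S \<in> carrier_mat r r \<and> V \<in> carrier_mat n2 r \<and>
     transpose_mat U * U = 1\<^sub>m r \<and> transpose_mat V * V = 1\<^sub>m r \<and>
     diagonal_mat S \<and> (\<forall>i<r. 0 < S $$ (i, i)) \<and>
     (\<forall>i j. i \<le> j \<and> j < r \<longrightarrow> S $$ (j, j) \<le> S $$ (i, i)) \<and>
     X = U * S * transpose_mat V"

text \<open>The row norms of \<open>U\<close> and \<open>V\<close> are the same for every compact SVD of \<open>X\<close>, so it is enough
  to ask for one decomposition.\<close>

definition incoherent :: "nat \<Rightarrow> nat \<Rightarrow> nat \<Rightarrow> real \<Rightarrow> real mat \<Rightarrow> bool" where
  "incoherent n1 n2 r \<mu> X \<longleftrightarrow>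
     (\<exists>U S V. is_svd n1 n2 r X U S V \<and>
        norm_2_inf U \<le> sqrt (\<mu> * real r / real n1) \<and>
        norm_2_inf V \<le> sqrt (\<mu> * real r / real n2))"

text \<open>The rank is positive, since the condition number \<open>\<sigma>\<^sub>1 / \<sigma>\<^sub>r\<close> refers to \<open>\<sigma>\<^sub>r\<close>.\<close>

definition incoherent_mats :: "nat \<Rightarrow> nat \<Rightarrow> nat \<Rightarrow> real \<Rightarrow> real \<Rightarrow> real mat set" where
  "incoherent_mats n1 n2 r \<mu> \<kappa> =
     {X \<in> carrier_mat n1 n2. 1 \<le> r \<and> vec_space.rank n1 X = r \<and> incoherent n1 n2 r \<mu> X \<and>
        singular_value 1 X / singular_value r X = \<kappa>}"

text \<open>A stacked factor matrix with blocks \<open>U\<close> and \<open>V\<close> is represented by the pair \<open>(U, V)\<close>.\<close>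

definition factor_mats :: "nat \<Rightarrow> nat \<Rightarrow> nat \<Rightarrow> (real mat \<times> real mat) set" where
  "factor_mats n1 n2 r = carrier_mat n1 r \<times> carrier_mat n2 r"

definition B_err ::
  "nat \<Rightarrow> nat \<Rightarrow> nat \<Rightarrow> real mat \<Rightarrow> real \<Rightarrow> (real mat \<times> real mat) set" where
  "B_err n1 n2 r Xs \<epsilon> =
     {(U, V) \<in> factor_mats n1 n2 r.
        norm_F (U * transpose_mat V - Xs) \<le> \<epsilon> * singular_value r Xs}"

definition B_bln ::
  "nat \<Rightarrow> nat \<Rightarrow> nat \<Rightarrow> real mat \<Rightarrow> real \<Rightarrow> (real mat \<times> real mat) set" where
  "B_bln n1 n2 r Xs \<delta> =
     {(U, V) \<in> factor_mats n1 n2 r.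
        norm_F (transpose_mat U * U - transpose_mat V * V) \<le> \<delta> * singular_value r Xs}"

definition B_mu ::
  "nat \<Rightarrow> nat \<Rightarrow> nat \<Rightarrow> real mat \<Rightarrow> real \<Rightarrow> (real mat \<times> real mat) set" where
  "B_mu n1 n2 r Xs \<mu> =
     {(U, V) \<in> factor_mats n1 n2 r.
        norm_2_inf U \<le> sqrt (3 * \<mu> * real r * singular_value 1 Xs / real n1) \<and>
        norm_2_inf V \<le> sqrt (3 * \<mu> * real r * singular_value 1 Xs / real n2)}"

definition sampling_rate :: "nat \<Rightarrow> nat \<Rightarrow> (nat \<times> nat) set \<Rightarrow> real" where
  "sampling_rate n1 n2 \<Omega> = real (card \<Omega>) / (real n1 * real n2)"

definition C_step ::
  "nat \<Rightarrow> nat \<Rightarrow> nat \<Rightarrow> real mat \<Rightarrow> (nat \<times> nat) set \<Rightarrow> real mat \<Rightarrow> real mat \<Rightarrow>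
     (real mat \<times> real mat) set" where
  "C_step n1 n2 r Xs \<Omega> Ut Vt =
     {(U, V) \<in> factor_mats n1 n2 r.
        (norm_F (U - Ut))\<^sup>2 + (norm_F (V - Vt))\<^sup>2
          \<le> 8 / (sampling_rate n1 n2 \<Omega> * singular_value r Xs)
              * (norm_F_on \<Omega> (Ut * transpose_mat Vt - Xs))\<^sup>2}"

definition GNMR_objective ::
  "(nat \<times> nat) set \<Rightarrow> (nat \<times> nat \<Rightarrow> real) \<Rightarrow> real mat \<Rightarrow> real mat \<Rightarrow>
     real mat \<times> real mat \<Rightarrow> real" where
  "GNMR_objective \<Omega> b Ut Vt = (\<lambda>(U, V).
     (L2_set (\<lambda>ij. sample_entries \<Omega>
         (Ut * transpose_mat V + U * transpose_mat Vt - Ut * transpose_mat Vt) ij - b ij) \<Omega>)\<^sup>2)"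

text \<open>\<open>U\<close>, \<open>V\<close> are the iterates of a run of constrained GNMR, the minimizer being arbitrary at
  each step. The starting point \<open>(U 0, V 0)\<close> is not restricted here.\<close>

definition constrained_GNMR ::
  "nat \<Rightarrow> nat \<Rightarrow> nat \<Rightarrow> real \<Rightarrow> real mat \<Rightarrow> (nat \<times> nat) set \<Rightarrow>
     (nat \<Rightarrow> real mat) \<Rightarrow> (nat \<Rightarrow> real mat) \<Rightarrow> bool" where
  "constrained_GNMR n1 n2 r \<mu> Xs \<Omega> U V \<longleftrightarrow>
     (\<forall>t. is_arg_min (GNMR_objective \<Omega> (sample_entries \<Omega> Xs) (U t) (V t))
            (\<lambda>UV. UV \<in> B_mu n1 n2 r Xs \<mu> \<inter> C_step n1 n2 r Xs \<Omega> (U t) (V t))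
            (U (Suc t), V (Suc t)))"

definition uniform_sample :: "nat \<Rightarrow> nat \<Rightarrow> nat \<Rightarrow> (nat \<times> nat) set pmf" where
  "uniform_sample n1 n2 m =
     pmf_of_set {\<Omega>. \<Omega> \<subseteq> {..<n1} \<times> {..<n2} \<and> card \<Omega> = m}"

end

theory Submission
  imports Defs "HOL-Analysis.Harmonic_Numbers"
begin

text \<open>
  On the tangent space at \<open>X\<^sup>*\<close> of the matrices of rank \<open>r\<close>, the quadratic form \<open>\<parallel>Z\<parallel>\<^sup>2\<close> restricted to the
  entries in \<open>\<Omega>\<close> is that of a sum of rank-one operators. When an index is removed from the sum, the
  trace of the \<open>q\<close>-th power drops by an amount that elementary moment inequalities for positive
  semidefinite forms control; averaging over all subsets of a given size turns this into a recursion
  in the size, which starts at the full index set. Its solution replaces the matrix Chernoff bound: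
  applied to \<open>\<Omega>\<close> it bounds the largest eigenvalue, applied to the complement of \<open>\<Omega>\<close> the smallest.
  The second-order terms \<open>\<Delta>U \<Delta>V\<^sup>T\<close> need only an upper bound. It is affine in each squared row norm of
  \<open>\<Delta>U\<close> and \<open>\<Delta>V\<close>, so it reduces to the number of samples in a rectangle, for which a union bound
  suffices.

  Write \<open>X\<^sup>* = P S W\<^sup>T\<close>. A nearly balanced pair \<open>(U, V)\<close> close to the target is compared not with a
  Procrustes alignment but with the factorization of \<open>X\<^sup>*\<close> whose first factor is \<open>P P\<^sup>T U\<close>. The
  distance to it is explicit in the error \<open>U V\<^sup>T - X\<^sup>*\<close> and small enough for it to be feasible in
  the next step, so the objective of the minimizer is of second order in the error. By the isometry
  the new error is then at most half of the old one, and the imbalance \<open>U\<^sup>T U - V\<^sup>T V\<close> grows along the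
  run by no more than a geometric series.\<close>

section \<open>Moments of sums of rank-one operators\<close>

text \<open>One step meets a circularity: the isometry applies at the new pair only once that pair
  is known to be near the target and nearly balanced. A crude estimate from the constraint of the
  step breaks it. It pairs operator norms of order \<open>sqrt \<sigma>1\<close> with step lengths
  of order \<open>err / sqrt \<sigma>\<close> and so loses \<open>sqrt \<kappa>\<close>; this is why
  the initial error must be smaller than \<open>\<sigma>\<close> by a multiple of
  \<open>sqrt \<kappa>\<close>. The halving comes afterwards, and the isometry constants
  \<open>8 * p\<close> and \<open>p / 2\<close> may be crude because the objective at the minimizer
  is a small multiple of the error. The two terms of the sampling rate have separate origins: the
  logarithm pays for the isometry, while \<open>(\<mu> * r * \<kappa>)\<^sup>2\<close> keeps the
  linear term of the rectangle bound, of order \<open>sqrt (n * p)\<close>, small against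
  \<open>\<sigma>\<close> after multiplication by the largest squared row norm. The three units of
  \<open>1 / n ^ 3\<close> belong to the upper isometry, the lower isometry and the
  rectangles.\<close>

definition ip :: "'i set \<Rightarrow> ('i \<Rightarrow> real) \<Rightarrow> ('i \<Rightarrow> real) \<Rightarrow> real" where
  "ip I u v = (\<Sum>i\<in>I. u i * v i)"

lemma ip_commute: "ip I u v = ip I v u"
  by (simp add: ip_def mult.commute)

lemma ip_self_nonneg: "0 \<le> ip I u u"
  by (simp add: ip_def sum_nonneg)

lemma ip_Cauchy_Schwarz: "(ip I u v)\<^sup>2 \<le> ip I u u * ip I v v"
  unfolding ip_def using Cauchy_Schwarz_ineq_sum[of u v I] by (simp add: power2_eq_square)

text \<open>The inequality holds because the ratios \<open>g (k + 1) / g k\<close> increase.\<close>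

lemma log_convex_moments:
  fixes g :: "nat \<Rightarrow> real"
  assumes nonneg: "\<And>k. 0 \<le> g k" and lc: "\<And>k. (g (Suc k))\<^sup>2 \<le> g k * g (Suc (Suc k))"
  shows "g a * g b \<le> g 0 * g (a + b)"
proof -
  have ratio: "g (Suc a) * g (a + d) \<le> g a * g (Suc (a + d))" for a d
  proof (induction d)
    case 0 show ?case by (simp add: mult.commute)
  next
    case (Suc d)
    let ?b = "a + d"
    show ?case
    proof (cases "g ?b = 0")
      case True
      then have "(g (Suc ?b))\<^sup>2 \<le> 0" using lc[of ?b] by simp
      then have "g (Suc ?b) = 0" by simp
      then show ?thesis using nonneg by simp
    next
      case False
      then have pos: "0 < g ?b" using nonneg[of ?b] by simp
      have "g (Suc a) * g (Suc ?b) * g ?b = (g (Suc a) * g ?b) * g (Suc ?b)" by simp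
      also have "\<dots> \<le> (g a * g (Suc ?b)) * g (Suc ?b)"
        using Suc nonneg by (intro mult_right_mono) auto
      also have "\<dots> = g a * (g (Suc ?b))\<^sup>2" by (simp add: power2_eq_square)
      also have "\<dots> \<le> g a * (g ?b * g (Suc (Suc ?b)))"
        using lc nonneg by (intro mult_left_mono) auto
      finally have "g (Suc a) * g (Suc ?b) * g ?b \<le> (g a * g (Suc (Suc ?b))) * g ?b"
        by (simp add: ac_simps)
      then show ?thesis using pos by (simp add: mult_le_cancel_right)
    qed
  qed
  have ordered: "g a * g b \<le> g 0 * g (a + b)" if "a \<le> b" for a b
    using that
  proof (induction a arbitrary: b)
    case (Suc a)
    have "g (Suc a) * g b \<le> g a * g (Suc b)" using ratio[of a "b - a"] Suc.prems by simp
    also have "\<dots> \<le> g 0 * g (a + Suc b)" using Suc.IH[of "Suc b"] Suc.prems by simp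
    finally show ?case by simp
  qed simp
  show ?thesis
    using ordered[of a b] ordered[of b a] by (cases "a \<le> b") (auto simp: ac_simps)
qed

text \<open>Vectors are functions on \<open>I\<close> with the inner product \<open>ip I\<close>.
  \<open>M S\<close> is the operator sum of \<open>x i (x i)^T\<close> over \<open>S\<close>,
  \<open>moment S v k\<close> pairs \<open>v\<close> with the k-th power of \<open>M S\<close>
  applied to \<open>v\<close>, and \<open>tr S q\<close> is the trace of the q-th power in the
  coordinate basis \<open>\<delta>\<close>. Everything is phrased by inner products, so no spectral
  decomposition occurs.\<close>

locale vector_family =
  fixes I :: "'i set" and x :: "'i \<Rightarrow> 'i \<Rightarrow> real"
  assumes finite_I: "finite I"
begin

definition M :: "'i set \<Rightarrow> ('i \<Rightarrow> real) \<Rightarrow> 'i \<Rightarrow> real" where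
  "M S v = (\<lambda>j. \<Sum>i\<in>S. ip I (x i) v * x i j)"

definition \<delta> :: "'i \<Rightarrow> 'i \<Rightarrow> real" where
  "\<delta> e = (\<lambda>i. if i = e then 1 else 0)"

definition moment :: "'i set \<Rightarrow> ('i \<Rightarrow> real) \<Rightarrow> nat \<Rightarrow> real" where
  "moment S v k = ip I v ((M S ^^ k) v)"

definition tr :: "'i set \<Rightarrow> nat \<Rightarrow> real" where
  "tr S q = (\<Sum>e\<in>I. moment S (\<delta> e) q)"

lemma ip_M: "ip I u (M S v) = (\<Sum>i\<in>S. ip I u (x i) * ip I (x i) v)"
proof -
  have "ip I u (M S v) = (\<Sum>j\<in>I. \<Sum>i\<in>S. u j * (ip I (x i) v * x i j))"
    by (simp add: ip_def[of I u] M_def sum_distrib_left)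
  also have "\<dots> = (\<Sum>i\<in>S. \<Sum>j\<in>I. u j * (ip I (x i) v * x i j))"
    by (rule sum.swap)
  also have "\<dots> = (\<Sum>i\<in>S. ip I u (x i) * ip I (x i) v)"
    by (simp add: ip_def[of I u] sum_distrib_left sum_distrib_right ac_simps)
  finally show ?thesis .
qed

lemma ip_M_sym: "ip I u (M S v) = ip I (M S u) v"
  by (simp add: ip_commute[of I "M S u" v] ip_M) (simp add: ip_commute mult.commute)

lemma ip_M_pow_sym: "ip I u ((M S ^^ k) v) = ip I ((M S ^^ k) u) v"
proof (induction k arbitrary: u)
  case (Suc k)
  have "ip I u ((M S ^^ Suc k) v) = ip I (M S u) ((M S ^^ k) v)"
    by (simp add: ip_M_sym)
  also have "\<dots> = ip I ((M S ^^ k) (M S u)) v" by (rule Suc)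
  finally show ?case by (simp add: funpow_swap1)
qed simp

lemma ip_M_pow_swap: "ip I u ((M S ^^ k) v) = ip I v ((M S ^^ k) u)"
  by (metis ip_M_pow_sym ip_commute)

lemma ip_M_pow_pow: "ip I ((M S ^^ a) v) ((M S ^^ b) v) = moment S v (a + b)"
  by (simp add: moment_def funpow_add ip_M_pow_sym[symmetric])

lemma ip_M_self_nonneg: "0 \<le> ip I v (M S v)"
  by (simp add: ip_M sum_nonneg ip_commute[of I _ v])

text \<open>An even power gives a squared norm; an odd power leaves a single \<open>M S\<close>
  between two equal vectors.\<close>

lemma moment_nonneg: "0 \<le> moment S v k"
proof (cases "even k")
  case True
  then obtain a where "k = a + a" by (metis evenE mult_2)
  then show ?thesis using ip_M_pow_pow[of a S v a] ip_self_nonneg by metis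
next
  case False
  then obtain a where k: "k = a + Suc a" by (auto elim!: oddE simp: mult_2)
  have "moment S v k = ip I ((M S ^^ a) v) (M S ((M S ^^ a) v))"
    using ip_M_pow_pow[of a S v "Suc a"] k by simp
  then show ?thesis using ip_M_self_nonneg by simp
qed

lemma ip_M_Cauchy_Schwarz: "(ip I u (M S v))\<^sup>2 \<le> ip I u (M S u) * ip I v (M S v)"
  using Cauchy_Schwarz_ineq_sum[of "\<lambda>i. ip I u (x i)" "\<lambda>i. ip I (x i) v" S]
  by (simp add: ip_M power2_eq_square) (simp add: ip_commute)

text \<open>Cauchy-Schwarz around the middle power: in \<open>ip I\<close> when \<open>k\<close> is
  even, in the semidefinite form of \<open>M S\<close> when \<open>k\<close> is odd.\<close>

lemma moment_log_convex: "(moment S v (Suc k))\<^sup>2 \<le> moment S v k * moment S v (Suc (Suc k))"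
proof (cases "even k")
  case True
  then obtain a where k: "k = a + a" by (metis evenE mult_2)
  have "(ip I ((M S ^^ a) v) ((M S ^^ Suc a) v))\<^sup>2
      \<le> ip I ((M S ^^ a) v) ((M S ^^ a) v) * ip I ((M S ^^ Suc a) v) ((M S ^^ Suc a) v)"
    by (rule ip_Cauchy_Schwarz)
  then show ?thesis by (simp add: ip_M_pow_pow k del: funpow.simps)
next
  case False
  then obtain a where k: "k = a + Suc a" by (auto elim!: oddE simp: mult_2)
  have eq: "ip I ((M S ^^ a) v) (M S ((M S ^^ b) v)) = moment S v (a + Suc b)" for a b
    using ip_M_pow_pow[of a S v "Suc b"] by simp
  show ?thesis
    using ip_M_Cauchy_Schwarz[of "(M S ^^ a) v" S "(M S ^^ Suc a) v"]
    unfolding eq by (simp add: k)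
qed

lemma moment_mult_le: "moment S v a * moment S v b \<le> moment S v 0 * moment S v (a + b)"
  by (rule log_convex_moments[of "moment S v"]) (rule moment_nonneg moment_log_convex)+

text \<open>Jensen's inequality for the spectral measure of \<open>v\<close>, obtained here from
  log-convexity alone. It carries a bound on a high moment over to the quadratic form.\<close>

lemma moment_one_power_le: "moment S v 1 ^ Suc b \<le> moment S v 0 ^ b * moment S v (Suc b)"
proof (induction b)
  case (Suc b)
  have "moment S v 1 ^ Suc (Suc b) \<le> moment S v 1 * (moment S v 0 ^ b * moment S v (Suc b))"
    using Suc moment_nonneg by (simp add: mult_left_mono)
  also have "\<dots> = moment S v 0 ^ b * (moment S v 1 * moment S v (Suc b))" by simp
  also have "\<dots> \<le> moment S v 0 ^ b * (moment S v 0 * moment S v (1 + Suc b))"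
    using moment_mult_le[of S v 1 "Suc b"] moment_nonneg by (intro mult_left_mono) auto
  finally show ?case by (simp add: ac_simps)
qed simp

lemma ip_delta: "e \<in> I \<Longrightarrow> ip I (\<delta> e) v = v e"
  by (simp add: ip_def \<delta>_def if_distrib[of "\<lambda>c. c * _"] finite_I cong: if_cong)

lemma Parseval: "(\<Sum>e\<in>I. ip I u (\<delta> e) * ip I (\<delta> e) v) = ip I u v"
proof -
  have "ip I u (\<delta> e) * ip I (\<delta> e) v = u e * v e" if "e \<in> I" for e
    using ip_delta[OF that, of u] ip_delta[OF that, of v] by (simp add: ip_commute)
  then show ?thesis by (simp add: ip_def[of I u v])
qed

lemma tr_nonneg: "0 \<le> tr S q"
  by (simp add: tr_def moment_nonneg sum_nonneg)

text \<open>Evenness makes the moment a squared norm \<open>|M^a v|^2\<close>, which Parseval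
  expands over the coordinates; Cauchy-Schwarz then bounds each coordinate.\<close>

lemma moment_le_tr:
  assumes "even q"
  shows "moment S v q \<le> tr S q * ip I v v"
proof -
  obtain a where q: "q = a + a" using assms by (metis evenE mult_2)
  let ?w = "(M S ^^ a) v"
  have "moment S v q = (\<Sum>e\<in>I. ip I ?w (\<delta> e) * ip I (\<delta> e) ?w)"
    by (simp add: Parseval ip_M_pow_pow q)
  also have "\<dots> = (\<Sum>e\<in>I. (ip I ((M S ^^ a) (\<delta> e)) v)\<^sup>2)"
    by (simp add: ip_M_pow_swap[of "\<delta> _"] ip_commute power2_eq_square)
  also have "\<dots> \<le> (\<Sum>e\<in>I. moment S (\<delta> e) q * ip I v v)"
    by (intro sum_mono order_trans[OF ip_Cauchy_Schwarz]) (simp add: ip_M_pow_pow q)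
  finally show ?thesis by (simp add: tr_def sum_distrib_right)
qed

text \<open>Substitute for the fact that the largest eigenvalue is at most the q-th root of the
  trace of the q-th power.\<close>

lemma moment_one_le_of_tr_le:
  assumes "even q" "0 < q" "0 \<le> L" "tr S q \<le> L ^ q"
  shows "ip I v (M S v) \<le> L * ip I v v"
proof -
  obtain b where q: "q = Suc b" using assms(2) by (cases q) auto
  have "moment S v 1 ^ Suc b \<le> moment S v 0 ^ b * moment S v (Suc b)"
    by (rule moment_one_power_le)
  also have "\<dots> \<le> moment S v 0 ^ b * (L ^ q * moment S v 0)"
  proof (intro mult_left_mono)
    have "moment S v q \<le> tr S q * ip I v v" by (rule moment_le_tr) fact
    also have "\<dots> \<le> L ^ q * ip I v v" by (intro mult_right_mono assms ip_self_nonneg)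
    finally show "moment S v (Suc b) \<le> L ^ q * moment S v 0" by (simp add: q moment_def)
  qed (simp add: moment_nonneg)
  also have "\<dots> = (L * moment S v 0) ^ Suc b" by (simp add: q power_mult_distrib)
  finally have "moment S v 1 \<le> L * moment S v 0"
    by (rule power_le_imp_le_base) (simp add: assms(3) moment_nonneg)
  then show ?thesis by (simp add: moment_def)
qed

lemma ip_M_remove:
  assumes "finite S" "a \<in> S"
  shows "ip I u (M S v) = ip I u (M (S - {a}) v) + ip I u (x a) * ip I (x a) v"
  by (simp add: ip_M sum.remove[OF assms, of "\<lambda>i. ip I u (x i) * ip I (x i) v"])

text \<open>Exchanging one factor \<open>M S\<close> for \<open>M (S - {a})\<close> costs a product
  of two moments, because the difference is the rank-one operator of \<open>x a\<close>.
  Log-convexity bounds this product by \<open>\<nu>\<close> times the moment of order one less, so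
  \<open>j\<close> exchanges cost at most \<open>j * \<nu>\<close> times that moment.\<close>

lemma mixed_moment_bounds:
  assumes S: "finite S" "a \<in> S" and \<nu>: "ip I (x a) (x a) \<le> \<nu>"
  defines "c \<equiv> \<lambda>j b. ip I ((M (S - {a}) ^^ j) (x a)) ((M S ^^ b) (x a))"
  shows "c j b \<le> moment S (x a) (j + b)"
    and "moment S (x a) (j + b) - real j * \<nu> * moment S (x a) (j + b - 1) \<le> c j b"
proof -
  let ?g = "moment S (x a)"
  have rec: "c (Suc j) b = c j (Suc b) - c j 0 * ?g b" for j b
  proof -
    have "c (Suc j) b = ip I ((M (S - {a}) ^^ j) (x a)) (M (S - {a}) ((M S ^^ b) (x a)))"
      by (simp add: c_def ip_M_sym)
    also have "\<dots> = ip I ((M (S - {a}) ^^ j) (x a)) (M S ((M S ^^ b) (x a)))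
        - ip I ((M (S - {a}) ^^ j) (x a)) (x a) * ip I (x a) ((M S ^^ b) (x a))"
      using ip_M_remove[OF S, of "(M (S - {a}) ^^ j) (x a)" "(M S ^^ b) (x a)"] by linarith
    finally show ?thesis by (simp add: c_def moment_def)
  qed
  have c0: "0 \<le> c j 0" for j
    using moment_nonneg[of "S - {a}" "x a" j] by (simp add: c_def moment_def ip_commute)
  show upper: "c j b \<le> ?g (j + b)" for j b
  proof (induction j arbitrary: b)
    case 0 show ?case by (simp add: c_def moment_def)
  next
    case (Suc j)
    have "0 \<le> c j 0 * ?g b" by (simp add: c0 moment_nonneg)
    then show ?case using Suc[of "Suc b"] by (simp add: rec)
  qed
  show "?g (j + b) - real j * \<nu> * ?g (j + b - 1) \<le> c j b"
  proof (induction j arbitrary: b)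
    \<comment> \<open>The truncated subtraction in \<open>j + b - 1\<close> is harmless here, since
      it comes with the factor 0.\<close>
    case 0 show ?case by (simp add: c_def moment_def)
  next
    case (Suc j)
    have "c j 0 * ?g b \<le> ?g j * ?g b"
      using upper[of j 0] by (simp add: mult_right_mono moment_nonneg)
    also have "\<dots> \<le> ?g 0 * ?g (j + b)" by (rule moment_mult_le)
    also have "\<dots> \<le> \<nu> * ?g (j + b)"
      using \<nu> by (intro mult_right_mono) (auto simp: moment_def[of _ _ 0] moment_nonneg)
    finally show ?case using Suc[of "Suc b"] by (simp add: rec algebra_simps)
  qed
qed

text \<open>Telescoping of \<open>A^(q+1) - B^(q+1)\<close> into the terms
  \<open>B^j (A - B) A^(q-j)\<close>. Since \<open>A - B\<close> has rank one, Parseval collapses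
  each trace to an inner product of two powers applied to \<open>x a\<close>.\<close>

lemma tr_remove_eq:
  assumes S: "finite S" "a \<in> S"
  shows "tr S (Suc q) - tr (S - {a}) (Suc q)
       = (\<Sum>j<Suc q. ip I ((M (S - {a}) ^^ j) (x a)) ((M S ^^ (q - j)) (x a)))"
proof -
  let ?t = "\<lambda>j. \<Sum>e\<in>I. ip I ((M (S - {a}) ^^ j) (\<delta> e)) ((M S ^^ (Suc q - j)) (\<delta> e))"
  have step: "?t j - ?t (Suc j)
      = ip I ((M (S - {a}) ^^ j) (x a)) ((M S ^^ (q - j)) (x a))" if "j < Suc q" for j
  proof -
    have "Suc q - j = Suc (q - j)" using that by simp
    then have "?t j - ?t (Suc j) = (\<Sum>e\<in>I.
        ip I ((M (S - {a}) ^^ j) (\<delta> e)) (M S ((M S ^^ (q - j)) (\<delta> e)))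
        - ip I ((M (S - {a}) ^^ j) (\<delta> e)) (M (S - {a}) ((M S ^^ (q - j)) (\<delta> e))))"
      by (simp add: sum_subtractf ip_M_sym[of _ "S - {a}"])
    also have "\<dots> = (\<Sum>e\<in>I. ip I ((M (S - {a}) ^^ j) (\<delta> e)) (x a)
        * ip I (x a) ((M S ^^ (q - j)) (\<delta> e)))"
      by (simp add: ip_M_remove[OF S])
    also have "\<dots> = (\<Sum>e\<in>I. ip I ((M (S - {a}) ^^ j) (x a)) (\<delta> e)
        * ip I (\<delta> e) ((M S ^^ (q - j)) (x a)))"
    proof (rule sum.cong)
      fix e
      show "ip I ((M (S - {a}) ^^ j) (\<delta> e)) (x a) * ip I (x a) ((M S ^^ (q - j)) (\<delta> e))
          = ip I ((M (S - {a}) ^^ j) (x a)) (\<delta> e) * ip I (\<delta> e) ((M S ^^ (q - j)) (x a))"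
        by (metis ip_M_pow_swap ip_commute)
    qed simp
    finally show ?thesis by (simp add: Parseval)
  qed
  have "(\<Sum>j<Suc q. ip I ((M (S - {a}) ^^ j) (x a)) ((M S ^^ (q - j)) (x a)))
      = (\<Sum>j<Suc q. ?t j - ?t (Suc j))"
    by (rule sum.cong) (simp_all only: step lessThan_iff)
  also have "\<dots> = ?t 0 - ?t (Suc q)" by (rule sum_lessThan_telescope')
  also have "?t 0 = tr S (Suc q)" by (simp add: tr_def moment_def)
  also have "?t (Suc q) = tr (S - {a}) (Suc q)"
    by (simp only: tr_def moment_def ip_M_pow_sym diff_self_eq_0 funpow_0)
  finally show ?thesis by simp
qed

text \<open>Each of the \<open>q + 1\<close> telescoping terms is at least the full moment minus its
  exchange cost; the numbers of exchanges \<open>0, ..., q\<close> add up to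
  \<open>q (q + 1) / 2\<close>.\<close>

lemma tr_remove_le:
  assumes S: "finite S" "a \<in> S" and \<nu>: "ip I (x a) (x a) \<le> \<nu>"
  shows "tr (S - {a}) (Suc q) \<le> tr S (Suc q) - real (Suc q) * moment S (x a) q
           + real q * real (Suc q) / 2 * \<nu> * moment S (x a) (q - 1)"
proof -
  let ?g = "moment S (x a)"
  have sum_id: "(\<Sum>j<Suc q. real j) = real q * real (Suc q) / 2"
    by (induction q) (simp_all add: field_simps)
  have "(\<Sum>j<Suc q. ?g q - real j * \<nu> * ?g (q - 1))
      \<le> (\<Sum>j<Suc q. ip I ((M (S - {a}) ^^ j) (x a)) ((M S ^^ (q - j)) (x a)))"
  proof (rule sum_mono)
    fix j assume "j \<in> {..<Suc q}"
    then show "?g q - real j * \<nu> * ?g (q - 1)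
        \<le> ip I ((M (S - {a}) ^^ j) (x a)) ((M S ^^ (q - j)) (x a))"
      using mixed_moment_bounds(2)[OF S \<nu>, of j "q - j"] by simp
  qed
  moreover have "(\<Sum>j<Suc q. ?g q - real j * \<nu> * ?g (q - 1))
      = real (Suc q) * ?g q - real q * real (Suc q) / 2 * \<nu> * ?g (q - 1)"
    by (simp only: sum_subtractf sum_constant card_lessThan sum_distrib_right flip: sum_id)
  ultimately show ?thesis using tr_remove_eq[OF S, of q] by linarith
qed

text \<open>Closes the recursion: when the removal bound is summed over \<open>a\<close>, the
  moments at the removed vectors recombine to traces of \<open>S\<close> itself.\<close>

lemma sum_moment_eq_tr: "(\<Sum>a\<in>S. moment S (x a) k) = tr S (Suc k)"
proof -
  have "tr S (Suc k) = (\<Sum>e\<in>I. ip I ((M S ^^ k) (\<delta> e)) (M S (\<delta> e)))"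
    using ip_M_pow_pow[of k S _ 1] by (simp add: tr_def)
  also have "\<dots> = (\<Sum>a\<in>S. \<Sum>e\<in>I. ip I (x a) (\<delta> e) * ip I (\<delta> e) ((M S ^^ k) (x a)))"
    unfolding ip_M
    by (subst sum.swap) (simp add: ip_M_pow_swap[of "x _"] ip_commute mult.commute)
  also have "\<dots> = (\<Sum>a\<in>S. moment S (x a) k)"
    by (simp add: Parseval moment_def)
  finally show ?thesis by simp
qed

lemma sum_tr_remove_le:
  assumes S: "finite S" and \<nu>: "\<And>a. a \<in> S \<Longrightarrow> ip I (x a) (x a) \<le> \<nu>"
  shows "(\<Sum>a\<in>S. tr (S - {a}) (Suc q))
       \<le> (real (card S) - real (Suc q)) * tr S (Suc q) + real q * real (Suc q) / 2 * \<nu> * tr S q"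
proof -
  have "(\<Sum>a\<in>S. tr (S - {a}) (Suc q)) \<le> (\<Sum>a\<in>S. tr S (Suc q) - real (Suc q) * moment S (x a) q
           + real q * real (Suc q) / 2 * \<nu> * moment S (x a) (q - 1))"
    by (intro sum_mono tr_remove_le S \<nu>)
  also have "\<dots> = real (card S) * tr S (Suc q) - real (Suc q) * (\<Sum>a\<in>S. moment S (x a) q)
           + real q * real (Suc q) / 2 * \<nu> * (\<Sum>a\<in>S. moment S (x a) (q - 1))"
    by (simp only: sum.distrib sum_subtractf sum_constant sum_distrib_left)
  also have "\<dots> = (real (card S) - real (Suc q)) * tr S (Suc q)
           + real q * real (Suc q) / 2 * \<nu> * tr S q"
    by (cases q) (simp_all add: sum_moment_eq_tr left_diff_distrib)
  finally show ?thesis .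
qed

end

section \<open>Sampling without replacement\<close>

text \<open>Double counting of pairs of a set and an element removed from it: every
  \<open>s\<close>-set arises from \<open>card I - s\<close> larger sets.\<close>

lemma sum_subsets_remove:
  fixes F :: "'i set \<Rightarrow> real"
  assumes I: "finite I"
  shows "(\<Sum>S | S \<subseteq> I \<and> card S = Suc s. \<Sum>a\<in>S. F (S - {a}))
       = (real (card I) - real s) * (\<Sum>S | S \<subseteq> I \<and> card S = s. F S)"
proof -
  let ?A = "\<lambda>s. {S. S \<subseteq> I \<and> card S = s}"
  have fin: "finite (?A s)" for s using I by simp
  have finS: "\<forall>S\<in>?A s. finite S" for s using I finite_subset by blast
  have "(\<Sum>S\<in>?A (Suc s). \<Sum>a\<in>S. F (S - {a}))
      = (\<Sum>(S, a)\<in>Sigma (?A (Suc s)) (\<lambda>S. S). F (S - {a}))"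
    by (rule sum.Sigma[OF fin finS])
  also have "\<dots> = (\<Sum>(S, a)\<in>Sigma (?A s) (\<lambda>S. I - S). F S)"
    by (rule sum.reindex_bij_witness[where
        i = "\<lambda>(S, a). (insert a S, a)" and j = "\<lambda>(S, a). (S - {a}, a)"])
       (auto simp: card_insert_if insert_absorb dest: finite_subset[OF _ I])
  also have "\<dots> = (\<Sum>S\<in>?A s. \<Sum>a\<in>I - S. F S)"
    by (rule sum.Sigma[OF fin, symmetric]) (simp add: I)
  also have "\<dots> = (\<Sum>S\<in>?A s. (real (card I) - real s) * F S)"
  proof (rule sum.cong)
    fix S assume S: "S \<in> ?A s"
    then have "card (I - S) = card I - s" "s \<le> card I"
      using finite_subset[OF _ I, of S] card_mono[OF I, of S] by (auto simp: card_Diff_subset)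
    then show "(\<Sum>a\<in>I - S. F S) = (real (card I) - real s) * F S" by simp
  qed simp
  finally show ?thesis by (simp add: sum_distrib_left)
qed

text \<open>Bernoulli's inequality: the power lies above its tangent at \<open>t\<close>. The
  left-hand side is what the recursion for the averaged traces produces.\<close>

lemma power_diff_ge:
  fixes t h :: real
  assumes "0 \<le> h" "h \<le> t"
  shows "t ^ Suc q - real (Suc q) * h * t ^ q \<le> (t - h) ^ Suc q"
proof (cases "t = 0")
  case False
  with assms have t: "0 < t" by simp
  have "1 + real (Suc q) * (- h / t) \<le> (1 + - h / t) ^ Suc q"
    using assms t by (intro Bernoulli_inequality) (simp add: field_simps)
  then have "(1 + real (Suc q) * (- h / t)) * t ^ Suc q \<le> ((1 + - h / t) * t) ^ Suc q"
    using t by (simp add: power_mult_distrib mult_right_mono del: power_Suc)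
  moreover have "(1 + - h / t) * t = t - h"
    using t by (simp add: field_simps)
  moreover have "(1 + real (Suc q) * (- h / t)) * t ^ Suc q = t ^ Suc q - real (Suc q) * h * t ^ q"
    using t by (simp add: field_simps)
  ultimately show ?thesis by (simp only:)
qed (use assms in simp)

context vector_family begin

definition avg_tr :: "nat \<Rightarrow> nat \<Rightarrow> real" where
  "avg_tr s q = (\<Sum>S | S \<subseteq> I \<and> card S = s. tr S q) / real (card I choose s)"

text \<open>The double count turns the sum over removals into an average over \<open>s\<close>-sets;
  absorption reconciles the two binomial normalizations.\<close>

lemma avg_tr_step:
  assumes \<nu>: "\<And>a. a \<in> I \<Longrightarrow> ip I (x a) (x a) \<le> \<nu>" and s: "s < card I"
  shows "real (Suc s) * avg_tr s (Suc q) \<le> (real (Suc s) - real (Suc q)) * avg_tr (Suc s) (Suc q)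
           + real q * real (Suc q) / 2 * \<nu> * avg_tr (Suc s) q"
proof -
  let ?N = "card I"
  let ?A = "\<lambda>s q. \<Sum>S | S \<subseteq> I \<and> card S = s. tr S q"
  let ?c = "real (?N choose Suc s)"
  have c: "0 < ?c" "0 < real (?N choose s)" using s by simp_all
  have ch: "real (Suc s) * ?c = (real ?N - real s) * real (?N choose s)"
  proof -
    have "Suc s * (?N choose Suc s) = (?N - s) * (?N choose s)"
      by (simp only: binomial_absorb_comp binomial_absorption)
    then show ?thesis using s by (metis of_nat_mult of_nat_diff less_imp_le)
  qed
  have "(real ?N - real s) * ?A s (Suc q)
      = (\<Sum>S | S \<subseteq> I \<and> card S = Suc s. \<Sum>a\<in>S. tr (S - {a}) (Suc q))"
    by (rule sum_subsets_remove[OF finite_I, symmetric])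
  also have "\<dots> \<le> (\<Sum>S | S \<subseteq> I \<and> card S = Suc s. (real (Suc s) - real (Suc q)) * tr S (Suc q)
          + real q * real (Suc q) / 2 * \<nu> * tr S q)"
  proof (rule sum_mono)
    fix S assume "S \<in> {S. S \<subseteq> I \<and> card S = Suc s}"
    then show "(\<Sum>a\<in>S. tr (S - {a}) (Suc q)) \<le> (real (Suc s) - real (Suc q)) * tr S (Suc q)
          + real q * real (Suc q) / 2 * \<nu> * tr S q"
      using sum_tr_remove_le[OF finite_subset[OF _ finite_I], of S \<nu> q] \<nu> by auto
  qed
  finally have "(real ?N - real s) * ?A s (Suc q) \<le> (real (Suc s) - real (Suc q)) * ?A (Suc s) (Suc q)
          + real q * real (Suc q) / 2 * \<nu> * ?A (Suc s) q"
    by (simp only: sum.distrib sum_distrib_left)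
  then have "(real ?N - real s) * ?A s (Suc q) / ?c
      \<le> ((real (Suc s) - real (Suc q)) * ?A (Suc s) (Suc q)
          + real q * real (Suc q) / 2 * \<nu> * ?A (Suc s) q) / ?c"
    by (rule divide_right_mono) simp
  also have "\<dots> = (real (Suc s) - real (Suc q)) * avg_tr (Suc s) (Suc q)
           + real q * real (Suc q) / 2 * \<nu> * avg_tr (Suc s) q"
    by (simp add: avg_tr_def add_divide_distrib)
  also have "(real ?N - real s) * ?A s (Suc q) / ?c = real (Suc s) * avg_tr s (Suc q)"
  proof -
    have "(real ?N - real s) * ?A s (Suc q) / ?c
        = ((real ?N - real s) * real (?N choose s)) * avg_tr s (Suc q) / ?c"
      using c by (simp add: avg_tr_def)
    then show ?thesis unfolding ch[symmetric] using c by simp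
  qed
  finally show ?thesis .
qed

lemma tr_0: "tr S 0 = real (card I)"
proof -
  have "moment S (\<delta> e) 0 = 1" if "e \<in> I" for e
    using ip_delta[OF that, of "\<delta> e"] by (simp add: moment_def \<delta>_def)
  then show ?thesis by (simp add: tr_def)
qed

text \<open>The ansatz \<open>(\<epsilon> + (1 - \<epsilon>) s / N) ^ q\<close> is what a loss of the relative size \<open>\<epsilon>\<close> in each
  removal step leads to.\<close>

lemma avg_tr_le:
  assumes \<nu>: "\<And>a. a \<in> I \<Longrightarrow> ip I (x a) (x a) \<le> \<nu>" and "0 \<le> \<nu>"
    and full: "\<And>q. tr I q \<le> real (card I)"
    and \<epsilon>: "0 \<le> \<epsilon>" "\<epsilon> \<le> 1" "real Q * \<nu> / 2 \<le> \<epsilon>"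
    and q: "q \<le> Q" "q \<le> s" and s: "s \<le> card I" and N: "0 < card I"
  shows "avg_tr s q \<le> real (card I) * (\<epsilon> + (1 - \<epsilon>) * real s / real (card I)) ^ q"
  using s q
proof (induction s arbitrary: q rule: inc_induct)
  case base
  have "{S. S \<subseteq> I \<and> card S = card I} = {I}"
    using card_subset_eq[OF finite_I] by auto
  then show ?case using full[of q] N by (simp add: avg_tr_def)
next
  case (step s)
  let ?N = "real (card I)"
  define t where "t = \<epsilon> + (1 - \<epsilon>) * real (Suc s) / ?N"
  define h where "h = (1 - \<epsilon>) / ?N"
  have N0: "0 < ?N" using N by simp
  have th: "t - h = \<epsilon> + (1 - \<epsilon>) * real s / ?N"
    using N0 by (simp add: t_def h_def field_simps)
  have h0: "0 \<le> h" using \<epsilon> by (simp add: h_def)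
  have "0 \<le> t - h" unfolding th using \<epsilon> by simp
  then have ht: "h \<le> t" and t0: "0 \<le> t" using h0 by simp_all
  show ?case
  proof (cases q)
    case 0
    have "avg_tr s 0 = ?N"
      using step.hyps by (simp add: avg_tr_def tr_0 n_subsets[OF finite_I])
    then show ?thesis by (simp add: 0)
  next
    case (Suc r)
    have IH1: "avg_tr (Suc s) (Suc r) \<le> ?N * t ^ Suc r"
      using step.IH[of "Suc r"] step.prems Suc by (simp add: t_def)
    have IH0: "avg_tr (Suc s) r \<le> ?N * t ^ r"
      using step.IH[of r] step.prems Suc by (simp add: t_def)
    have sh: "real (Suc s) * h = t - \<epsilon>" by (simp add: t_def h_def)
    have r\<nu>: "real r * \<nu> / 2 \<le> \<epsilon>"
    proof -
      have "real r * \<nu> \<le> real Q * \<nu>"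
        using step.prems Suc \<open>0 \<le> \<nu>\<close> by (intro mult_right_mono) auto
      then show ?thesis using \<epsilon>(3) by linarith
    qed
    have "real (Suc s) * avg_tr s (Suc r)
        \<le> (real (Suc s) - real (Suc r)) * avg_tr (Suc s) (Suc r)
           + real r * real (Suc r) / 2 * \<nu> * avg_tr (Suc s) r"
      using avg_tr_step[OF \<nu>, of s r] step.hyps by simp
    \<comment> \<open>The coefficient of the higher trace has to be nonnegative for the induction
      hypothesis to apply; this is where \<open>q \<le> s\<close> enters.\<close>
    also have "\<dots> \<le> (real (Suc s) - real (Suc r)) * (?N * t ^ Suc r)
           + real r * real (Suc r) / 2 * \<nu> * (?N * t ^ r)"
      using step.prems Suc IH1 IH0 \<open>0 \<le> \<nu>\<close> by (intro add_mono mult_left_mono) auto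
    also have "\<dots> = ?N * (real (Suc s) * t ^ Suc r) - ?N * (real (Suc r) * t ^ r) * (t - real r * \<nu> / 2)"
      by (simp add: field_simps)
    also have "\<dots> \<le> ?N * (real (Suc s) * t ^ Suc r) - ?N * (real (Suc r) * t ^ r) * (t - \<epsilon>)"
      using r\<nu> t0 by (intro diff_left_mono mult_left_mono) auto
    also have "\<dots> = ?N * real (Suc s) * (t ^ Suc r - real (Suc r) * h * t ^ r)"
      unfolding sh[symmetric] by (simp add: algebra_simps)
    also have "\<dots> \<le> ?N * real (Suc s) * (t - h) ^ Suc r"
      using power_diff_ge[OF h0 ht] by (intro mult_left_mono) auto
    finally have "real (Suc s) * avg_tr s (Suc r) \<le> real (Suc s) * (?N * (t - h) ^ Suc r)"
      by (simp add: ac_simps)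
    then have "avg_tr s (Suc r) \<le> ?N * (t - h) ^ Suc r"
      by (rule mult_left_le_imp_le) simp
    then show ?thesis by (simp add: Suc th)
  qed
qed

end

text \<open>The condition says that the matrix \<open>x\<close> is symmetric and idempotent on
  \<open>I\<close>: the vectors \<open>x i\<close> are the rows of an orthogonal projection,
  \<open>x i i\<close> is the squared norm of the row, and \<open>M I\<close> is the projection
  itself.\<close>

locale projection_kernel = vector_family +
  assumes proj: "\<And>i j. i \<in> I \<Longrightarrow> j \<in> I \<Longrightarrow> ip I (x i) (x j) = x i j"
begin

lemma x_sym: "i \<in> I \<Longrightarrow> j \<in> I \<Longrightarrow> x i j = x j i"
  using proj[of i j] proj[of j i] by (simp add: ip_commute)

lemma diag_le_one:
  assumes "i \<in> I" shows "x i i \<le> 1"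
proof (rule ccontr)
  assume "\<not> ?thesis"
  then have gt: "1 < x i i" by simp
  have "(x i i)\<^sup>2 \<le> ip I (x i) (x i)"
    unfolding ip_def power2_eq_square using assms finite_I
    by (intro member_le_sum[of i I "\<lambda>j. x i j * x i j"]) auto
  also have "\<dots> = x i i" using proj assms by simp
  finally show False using gt by (simp add: power2_eq_square)
qed

text \<open>\<open>M I\<close> reproduces every \<open>x a\<close>, so all positive powers have the
  trace of the projection, a sum of diagonal entries that are at most 1.\<close>

lemma tr_full_le: "tr I q \<le> real (card I)"
proof (cases q)
  case 0 then show ?thesis by (simp add: tr_0)
next
  case (Suc k)
  have fix_pow: "ip I (x b) ((M I ^^ k) (x a)) = x b a" if "a \<in> I" "b \<in> I" for a b k
    using that
  proof (induction k arbitrary: b)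
    case 0 then show ?case by (simp add: proj)
  next
    case (Suc k)
    have "ip I (x b) ((M I ^^ Suc k) (x a)) = (\<Sum>i\<in>I. x b i * x i a)"
      using Suc by (simp add: ip_M proj)
    also have "\<dots> = ip I (x b) (x a)"
      unfolding ip_def using Suc.prems x_sym by (intro sum.cong) auto
    finally show ?case using Suc.prems by (simp add: proj)
  qed
  have "tr I q = (\<Sum>a\<in>I. x a a)"
    unfolding Suc sum_moment_eq_tr[symmetric] moment_def
    by (intro sum.cong fix_pow) auto
  also have "\<dots> \<le> (\<Sum>a\<in>I. 1)" by (intro sum_mono diag_le_one)
  finally show ?thesis by simp
qed

text \<open>Markov's inequality for the trace, as a count of sets: an exceptional \<open>S\<close>
  has trace at least \<open>L ^ q\<close>.\<close>

lemma card_large_eigenvalue_le: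
  assumes \<nu>: "\<And>a. a \<in> I \<Longrightarrow> x a a \<le> \<nu>" "0 \<le> \<nu>"
    and q: "even q" "0 < q" "q \<le> s" and s: "s \<le> card I"
    and \<epsilon>: "\<epsilon> \<le> 1" "real q * \<nu> / 2 \<le> \<epsilon>" and L: "0 \<le> L"
  shows "real (card {S. S \<subseteq> I \<and> card S = s \<and> \<not> (\<forall>v. ip I v (M S v) \<le> L * ip I v v)}) * L ^ q
    \<le> real (card I choose s) * real (card I) * (\<epsilon> + (1 - \<epsilon>) * real s / real (card I)) ^ q"
proof -
  let ?B = "{S. S \<subseteq> I \<and> card S = s \<and> \<not> (\<forall>v. ip I v (M S v) \<le> L * ip I v v)}"
  let ?A = "{S. S \<subseteq> I \<and> card S = s}"
  have fin: "finite ?A" using finite_I by simp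
  have N: "0 < card I" and c: "0 < real (card I choose s)" using q s by auto
  have "0 \<le> real q * \<nu> / 2" using \<nu>(2) by simp
  with \<epsilon> have \<epsilon>0: "0 \<le> \<epsilon>" by linarith
  have "real (card ?B) * L ^ q = (\<Sum>S\<in>?B. L ^ q)" by simp
  also have "\<dots> \<le> (\<Sum>S\<in>?B. tr S q)"
  proof (rule sum_mono)
    fix S assume "S \<in> ?B"
    then show "L ^ q \<le> tr S q" using moment_one_le_of_tr_le[OF q(1,2) L, of S] by force
  qed
  also have "\<dots> \<le> (\<Sum>S\<in>?A. tr S q)"
    using fin by (intro sum_mono2) (auto simp: tr_nonneg)
  also have "\<dots> = real (card I choose s) * avg_tr s q"
    using c by (simp add: avg_tr_def)
  also have "\<dots> \<le> real (card I choose s)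
      * (real (card I) * (\<epsilon> + (1 - \<epsilon>) * real s / real (card I)) ^ q)"
    using \<nu> \<epsilon> \<epsilon>0 q s N by (intro mult_left_mono avg_tr_le[where \<nu> = \<nu> and Q = q])
       (auto simp: proj tr_full_le)
  finally show ?thesis by (simp add: mult.assoc)
qed

end

section \<open>Tail bounds for both ends of the spectrum\<close>

context projection_kernel begin

text \<open>The loss \<open>\<epsilon> = p\<close> makes the base at most \<open>2 * p\<close>, so
  the threshold \<open>8 * p\<close> wins a factor \<open>4 ^ q\<close>. With an exponent of at
  least \<open>5 * ln n\<close> this is at least \<open>n ^ 5\<close>, of which \<open>n ^ 2\<close>
  pays for \<open>card I\<close>.\<close>

lemma card_large_eigenvalue_upper:
  fixes n p \<nu> :: real
  assumes n: "2 \<le> n" and N: "real (card I) \<le> n\<^sup>2"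
    and \<nu>: "\<And>a. a \<in> I \<Longrightarrow> x a a \<le> \<nu>" "0 \<le> \<nu>"
    and m: "m \<le> card I" "8 * ln n \<le> real m" and p: "p = real m / real (card I)"
    and rate: "46 * \<nu> * ln n \<le> p"
  shows "real (card {S. S \<subseteq> I \<and> card S = m \<and> \<not> (\<forall>v. ip I v (M S v) \<le> 8 * p * ip I v v)})
    \<le> real (card I choose m) / n ^ 3"
proof -
  let ?B = "{S. S \<subseteq> I \<and> card S = m \<and> \<not> (\<forall>v. ip I v (M S v) \<le> 8 * p * ip I v v)}"
  have ln2: "2 / 3 \<le> ln n"
    using ln2_ge_two_thirds n ln_le_cancel_iff[of 2 n] by linarith
  \<comment> \<open>Half of the exponent, which has to be even; \<open>8 * ln n \<le> real m\<close>
    leaves room for the rounding and ensures \<open>q \<le> m\<close>.\<close>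
  define h where "h = nat \<lceil>5 / 2 * ln n\<rceil>"
  define q where "q = 2 * h"
  have h: "5 / 2 * ln n \<le> real h" "real h \<le> 5 / 2 * ln n + 1"
    unfolding h_def using ln2 by linarith+
  have q: "5 * ln n \<le> real q" "real q \<le> 8 * ln n" "0 < q" "even q"
    using h ln2 by (auto simp: q_def)
  have "0 < real m" using m ln2 by linarith
  then have m0: "0 < real m" "0 < real (card I)" using m by linarith+
  then have p0: "0 < p" "p \<le> 1" using m by (simp_all add: p)
  have "real q * \<nu> \<le> 8 * ln n * \<nu>" using q \<nu> by (intro mult_right_mono)
  moreover have "0 \<le> \<nu> * ln n" using \<nu>(2) ln2 by simp
  ultimately have eps: "real q * \<nu> / 2 \<le> p" using rate by (simp add: mult.assoc mult.commute[of "ln n" \<nu>])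
  have "real q \<le> real m" using q m by linarith
  then have qm: "q \<le> m" by simp
  have "real (card ?B) * (8 * p) ^ q
      \<le> real (card I choose m) * real (card I) * (p + (1 - p) * real m / real (card I)) ^ q"
    using card_large_eigenvalue_le[OF \<nu> q(4) q(3) qm m(1) p0(2) eps, of "8 * p"] p0 by simp
  also have "(1 - p) * real m / real (card I) = (1 - p) * p" by (simp add: p)
  also have "real (card I choose m) * real (card I) * (p + (1 - p) * p) ^ q
      \<le> real (card I choose m) * n\<^sup>2 * (2 * p) ^ q"
    using N p0 by (intro mult_mono power_mono) (auto simp: algebra_simps)
  also have "\<dots> \<le> real (card I choose m) / n ^ 3 * (8 * p) ^ q"
  proof -
    have "n ^ 5 = exp (ln n * 5)" using n by (simp add: exp_of_nat2_mult[of "ln n" 5, simplified])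
    also have "\<dots> \<le> exp (real q)" using q by simp
    also have "\<dots> = exp 1 ^ q" by (simp add: exp_of_nat_mult[of q 1, simplified])
    also have "\<dots> \<le> 4 ^ q" using exp_le by (intro power_mono) auto
    finally have "n ^ 5 \<le> 4 ^ q" .
    moreover have "n ^ 5 = n ^ 2 * n ^ 3" using power_add[of n 2 3] by simp
    ultimately have "n ^ 2 * n ^ 3 \<le> 4 ^ q" by (simp only:)
    then have "n ^ 2 * n ^ 3 * (2 * p) ^ q \<le> 4 ^ q * (2 * p) ^ q"
      by (rule mult_right_mono) (use p0 in simp)
    also have "\<dots> = (4 * (2 * p)) ^ q" by (rule power_mult_distrib[symmetric])
    also have "4 * (2 * p) = 8 * p" by simp
    finally have "n\<^sup>2 * (2 * p) ^ q \<le> (8 * p) ^ q / n ^ 3" using n by (simp add: field_simps)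
    from mult_left_mono[OF this, of "real (card I choose m)"] show ?thesis by (simp add: mult.assoc)
  qed
  finally have "real (card ?B) * (8 * p) ^ q \<le> real (card I choose m) / n ^ 3 * (8 * p) ^ q" .
  then show ?thesis by (rule mult_right_le_imp_le) (use p0 in simp)
qed

lemma ip_M_le_card:
  assumes "S \<subseteq> I" "\<And>a. a \<in> I \<Longrightarrow> x a a \<le> \<nu>"
  shows "ip I v (M S v) \<le> real (card S) * \<nu> * ip I v v"
proof -
  have "ip I v (M S v) = (\<Sum>a\<in>S. (ip I (x a) v)\<^sup>2)"
    by (simp add: ip_M power2_eq_square ip_commute)
  also have "\<dots> \<le> (\<Sum>a\<in>S. \<nu> * ip I v v)"
  proof (rule sum_mono)
    fix a assume "a \<in> S"
    then have a: "a \<in> I" using assms by auto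
    have "(ip I (x a) v)\<^sup>2 \<le> x a a * ip I v v"
      using ip_Cauchy_Schwarz[of I "x a" v] proj[OF a a] by simp
    also have "\<dots> \<le> \<nu> * ip I v v" by (intro mult_right_mono assms a ip_self_nonneg)
    finally show "(ip I (x a) v)\<^sup>2 \<le> \<nu> * ip I v v" .
  qed
  finally show ?thesis by (simp add: mult.assoc)
qed

text \<open>Here \<open>\<epsilon> = 1 / 4\<close> turns the base into \<open>1 - 3 * p / 4\<close>,
  which beats the threshold \<open>1 - p / 2\<close> only by the factor \<open>1 - p / 4\<close>;
  hence an exponent of order \<open>ln n / p\<close>, at most \<open>23 * (ln n / p)\<close>.
  Keeping \<open>q * \<nu>\<close> below \<open>1 / 2\<close> then leads to the number 46 in the
  hypothesis.\<close>

lemma card_large_eigenvalue_complement: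
  fixes n p \<nu> :: real
  assumes n: "2 \<le> n" and N: "real (card I) \<le> n\<^sup>2"
    and \<nu>: "\<And>a. a \<in> I \<Longrightarrow> x a a \<le> \<nu>" "0 \<le> \<nu>"
    and m: "0 < m" "m \<le> card I" and p: "p = real m / real (card I)"
    and rate: "46 * \<nu> * ln n \<le> p"
  shows "real (card {S. S \<subseteq> I \<and> card S = card I - m
             \<and> \<not> (\<forall>v. ip I v (M S v) \<le> (1 - p / 2) * ip I v v)})
    \<le> real (card I choose (card I - m)) / n ^ 3"
proof -
  let ?s = "card I - m"
  let ?B = "{S. S \<subseteq> I \<and> card S = ?s \<and> \<not> (\<forall>v. ip I v (M S v) \<le> (1 - p / 2) * ip I v v)}"
  have ln2: "2 / 3 \<le> ln n"
    using ln2_ge_two_thirds n ln_le_cancel_iff[of 2 n] by linarith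
  have m0: "0 < real m" "0 < real (card I)" using m by linarith+
  then have p0: "0 < p" "p \<le> 1" using m by (simp_all add: p)
  define h where "h = nat \<lceil>10 * ln n / p\<rceil>"
  define q where "q = 2 * h"
  have lnp: "ln n \<le> ln n / p" using p0 ln2 by (simp add: field_simps)
  have h: "10 * ln n / p \<le> real h" "real h \<le> 10 * ln n / p + 1"
    unfolding h_def using lnp ln2 by linarith+
  have q: "20 * (ln n / p) \<le> real q" "real q \<le> 23 * (ln n / p)" "0 < q" "even q"
    using h ln2 lnp by (auto simp: q_def)
  have "real q * \<nu> \<le> 23 * (ln n / p) * \<nu>" using q \<nu> by (intro mult_right_mono)
  also have "\<dots> = (46 * \<nu> * ln n) / (2 * p)" by simp
  also have "\<dots> \<le> p / (2 * p)" using rate p0 by (intro divide_right_mono) auto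
  finally have q\<nu>: "real q * \<nu> \<le> 1 / 2" using p0 by simp
  then have eps: "real q * \<nu> / 2 \<le> 1 / 4" by linarith
  show ?thesis
  proof (cases "q \<le> ?s")
    case True
    have eq: "1 / 4 + (1 - 1 / 4) * real ?s / real (card I) = 1 - 3 * p / 4"
      using m m0 by (simp add: p of_nat_diff field_simps)
    have "real (card ?B) * (1 - p / 2) ^ q
        \<le> real (card I choose ?s) * real (card I) * (1 - 3 * p / 4) ^ q"
      using card_large_eigenvalue_le[OF \<nu> q(4) q(3) True _ _ eps, of "1 - p / 2"] p0
      unfolding eq by simp
    also have "\<dots> \<le> real (card I choose ?s) * n\<^sup>2 * (1 - 3 * p / 4) ^ q"
      using N p0 by (intro mult_mono) auto
    also have "\<dots> \<le> real (card I choose ?s) / n ^ 3 * (1 - p / 2) ^ q"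
    proof -
      have "(1 - 3 * p / 4) ^ q \<le> ((1 - p / 4) * (1 - p / 2)) ^ q"
        using p0 by (intro power_mono) (auto simp: algebra_simps)
      also have "\<dots> = (1 - p / 4) ^ q * (1 - p / 2) ^ q" by (rule power_mult_distrib)
      also have "\<dots> \<le> (1 / n ^ 5) * (1 - p / 2) ^ q"
      proof (rule mult_right_mono)
        have "(1 - p / 4) ^ q \<le> exp (- p / 4) ^ q"
          using exp_ge_add_one_self[of "- p / 4"] p0 by (intro power_mono) auto
        also have "\<dots> = exp (- (p * real q / 4))" by (simp flip: exp_of_nat_mult)
        also have "\<dots> \<le> exp (- (ln n * 5))" using q(1) p0 by (simp add: field_simps)
        also have "\<dots> = 1 / n ^ 5"
          using n by (simp add: exp_minus exp_of_nat2_mult[of "ln n" 5, simplified] inverse_eq_divide)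
        finally show "(1 - p / 4) ^ q \<le> 1 / n ^ 5" .
      qed (use p0 in simp)
      finally have "n\<^sup>2 * (1 - 3 * p / 4) ^ q \<le> n\<^sup>2 * ((1 / n ^ 5) * (1 - p / 2) ^ q)"
        by (rule mult_left_mono) simp
      also have "\<dots> = (1 - p / 2) ^ q / n ^ 3"
        using n by (simp add: field_simps)
      finally have "n\<^sup>2 * (1 - 3 * p / 4) ^ q \<le> (1 - p / 2) ^ q / n ^ 3" .
      from mult_left_mono[OF this, of "real (card I choose ?s)"] show ?thesis
        by (simp add: mult.assoc)
    qed
    finally have "real (card ?B) * (1 - p / 2) ^ q
        \<le> real (card I choose ?s) / n ^ 3 * (1 - p / 2) ^ q" .
    then show ?thesis by (rule mult_right_le_imp_le) (use p0 in simp)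
  next
    case False
    \<comment> \<open>The complement has fewer than \<open>q\<close> elements, too few for the
      moment bound, but then the squared norms of its vectors add up to at most
      \<open>q * \<nu> \<le> 1 / 2\<close>.\<close>
    have "ip I v (M S v) \<le> (1 - p / 2) * ip I v v" if "S \<subseteq> I" "card S = ?s" for S v
    proof -
      have "real (card S) * \<nu> \<le> real q * \<nu>"
        using that False \<nu> by (intro mult_right_mono) auto
      then have "real (card S) * \<nu> \<le> 1 - p / 2" using q\<nu> p0 by linarith
      then have "real (card S) * \<nu> * ip I v v \<le> (1 - p / 2) * ip I v v"
        by (intro mult_right_mono ip_self_nonneg)
      then show ?thesis using ip_M_le_card[OF that(1) \<nu>(1), of v] by linarith
    qed
    then have "?B = {}" by blast
    then show ?thesis using n by (simp only: card.empty) simp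
  qed
qed

end

section \<open>Complements, tensor products and orthonormal systems\<close>

lemma ip_diff_left: "ip I (\<lambda>i. u i - v i) w = ip I u w - ip I v w"
  by (simp add: ip_def left_diff_distrib sum_subtractf)

lemma projection_kernel_complement:
  assumes "projection_kernel I x"
  shows "projection_kernel I (\<lambda>i j. (if j = i then 1 else 0) - x i j)"
proof -
  interpret projection_kernel I x by fact
  have dl: "ip I (\<lambda>k. if k = i then 1 else 0) w = w i" if "i \<in> I" for i w
    using ip_delta[OF that, of w] by (simp add: \<delta>_def)
  show ?thesis
  proof
    fix i j assume ij: "i \<in> I" "j \<in> I"
    have "ip I (x i) (\<lambda>k. (if k = j then 1 else 0) - x j k) = x i j - x i j"
      unfolding ip_commute[of I "x i"] ip_diff_left using ij by (simp add: dl proj x_sym)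
    then show "ip I (\<lambda>k. (if k = i then 1 else 0) - x i k) (\<lambda>k. (if k = j then 1 else 0) - x j k)
        = (if j = i then 1 else 0) - x i j"
      unfolding ip_diff_left using ij by (simp add: dl x_sym)
  qed
qed

lemma ip_tensor: "ip (I \<times> J) (\<lambda>p. u (fst p) * v (snd p)) (\<lambda>p. f (fst p) * g (snd p)) = ip I u f * ip J v g"
  by (simp add: ip_def sum_product sum.cartesian_product case_prod_beta ac_simps)

lemma projection_kernel_tensor:
  assumes "projection_kernel I x" "projection_kernel J y"
  shows "projection_kernel (I \<times> J) (\<lambda>p q. x (fst p) (fst q) * y (snd p) (snd q))"
proof -
  interpret X: projection_kernel I x by fact
  interpret Y: projection_kernel J y by fact
  show ?thesis
    by unfold_locales (auto simp: X.finite_I Y.finite_I ip_tensor X.proj Y.proj)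
qed

lemma projection_kernel_orthonormal:
  fixes u :: "'i \<Rightarrow> 'a \<Rightarrow> real"
  assumes "finite I" and R: "finite R"
    and orth: "\<And>a b. a \<in> R \<Longrightarrow> b \<in> R \<Longrightarrow> (\<Sum>i\<in>I. u i a * u i b) = (if a = b then 1 else 0)"
  shows "projection_kernel I (\<lambda>i k. \<Sum>a\<in>R. u i a * u k a)"
proof
  fix i j assume "i \<in> I" "j \<in> I"
  have "ip I (\<lambda>k. \<Sum>a\<in>R. u i a * u k a) (\<lambda>k. \<Sum>a\<in>R. u j a * u k a)
      = (\<Sum>k\<in>I. \<Sum>a\<in>R. \<Sum>b\<in>R. (u i a * u j b) * (u k a * u k b))"
    by (simp add: ip_def sum_product ac_simps)
  also have "\<dots> = (\<Sum>a\<in>R. \<Sum>b\<in>R. (u i a * u j b) * (\<Sum>k\<in>I. u k a * u k b))"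
    unfolding sum_distrib_left by (subst sum.swap) (subst (2) sum.swap, simp)
  also have "\<dots> = (\<Sum>a\<in>R. u i a * u j a)"
    using R by (simp add: orth if_distrib[of "\<lambda>c. _ * c"] cong: if_cong sum.cong)
  finally show "ip I (\<lambda>k. \<Sum>a\<in>R. u i a * u k a) (\<lambda>k. \<Sum>a\<in>R. u j a * u k a) = (\<Sum>a\<in>R. u i a * u j a)" .
qed (rule \<open>finite I\<close>)

section \<open>Isometry on the tangent space\<close>

text \<open>Matrix of the projection onto the tangent space, the identity minus
  \<open>(1 - u u^T) \<otimes> (1 - w w^T)\<close>, indexed by pairs of matrix positions.\<close>

definition tangent_kernel ::
  "nat \<Rightarrow> (nat \<Rightarrow> nat \<Rightarrow> real) \<Rightarrow> (nat \<Rightarrow> nat \<Rightarrow> real) \<Rightarrow> nat \<times> nat \<Rightarrow> nat \<times> nat \<Rightarrow> real" where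
  "tangent_kernel r u w = (\<lambda>p q. (if q = p then 1 else 0) -
     ((if fst q = fst p then 1 else 0) - (\<Sum>a<r. u (fst p) a * u (fst q) a)) *
     ((if snd q = snd p then 1 else 0) - (\<Sum>a<r. w (snd p) a * w (snd q) a)))"

text \<open>The first sum has its columns in the span of \<open>u\<close>, which \<open>c\<close>
  annihilates; the second has its rows in the span of \<open>w\<close>, which \<open>d\<close>
  annihilates.\<close>

lemma bilinear_sum_eq_0:
  fixes c :: "'i \<Rightarrow> real" and d :: "'j \<Rightarrow> real"
  assumes Z: "\<And>i j. i \<in> I \<Longrightarrow> j \<in> J \<Longrightarrow> Z (i, j) = (\<Sum>a\<in>R. u i a * f a j) + (\<Sum>a\<in>R. g i a * w j a)"
    and c: "\<And>a. a \<in> R \<Longrightarrow> (\<Sum>i\<in>I. c i * u i a) = 0"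
    and d: "\<And>a. a \<in> R \<Longrightarrow> (\<Sum>j\<in>J. d j * w j a) = 0"
  shows "(\<Sum>i\<in>I. \<Sum>j\<in>J. c i * d j * Z (i, j)) = 0"
proof -
  have "(\<Sum>i\<in>I. \<Sum>j\<in>J. c i * d j * Z (i, j))
      = (\<Sum>i\<in>I. \<Sum>j\<in>J. \<Sum>a\<in>R. (c i * u i a) * (d j * f a j))
      + (\<Sum>i\<in>I. \<Sum>j\<in>J. \<Sum>a\<in>R. (c i * g i a) * (d j * w j a))"
    by (simp add: Z ring_distribs sum.distrib sum_distrib_left mult_ac)
  also have "(\<Sum>i\<in>I. \<Sum>j\<in>J. \<Sum>a\<in>R. (c i * u i a) * (d j * f a j))
      = (\<Sum>j\<in>J. \<Sum>a\<in>R. (\<Sum>i\<in>I. c i * u i a) * (d j * f a j))"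
    by (subst sum.swap) (simp add: sum_distrib_right sum.swap[of _ R I])
  also have "\<dots> = 0" by (simp add: c)
  also have "(\<Sum>i\<in>I. \<Sum>j\<in>J. \<Sum>a\<in>R. (c i * g i a) * (d j * w j a))
      = (\<Sum>i\<in>I. \<Sum>a\<in>R. (c i * g i a) * (\<Sum>j\<in>J. d j * w j a))"
    by (simp add: sum_distrib_left sum.swap[of _ R J])
  also have "\<dots> = 0" by (simp add: d)
  finally show ?thesis by simp
qed

locale tangent_space =
  fixes n1 n2 r :: nat and u w :: "nat \<Rightarrow> nat \<Rightarrow> real"
  assumes u_orth: "\<And>a b. a < r \<Longrightarrow> b < r \<Longrightarrow> (\<Sum>i<n1. u i a * u i b) = (if a = b then 1 else 0)"
    and w_orth: "\<And>a b. a < r \<Longrightarrow> b < r \<Longrightarrow> (\<Sum>i<n2. w i a * w i b) = (if a = b then 1 else 0)"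
begin

abbreviation "E \<equiv> {..<n1} \<times> {..<n2}"

definition tangent :: "(nat \<times> nat \<Rightarrow> real) \<Rightarrow> bool" where
  "tangent Z \<longleftrightarrow> (\<exists>f g. \<forall>i<n1. \<forall>j<n2. Z (i, j) = (\<Sum>a<r. u i a * f a j) + (\<Sum>a<r. g i a * w j a))"

sublocale U: projection_kernel "{..<n1}" "\<lambda>i k. \<Sum>a<r. u i a * u k a"
  by (rule projection_kernel_orthonormal) (auto simp: u_orth)

sublocale W: projection_kernel "{..<n2}" "\<lambda>i k. \<Sum>a<r. w i a * w k a"
  by (rule projection_kernel_orthonormal) (auto simp: w_orth)

sublocale Q: projection_kernel E "\<lambda>p q.
    ((if fst q = fst p then 1 else 0) - (\<Sum>a<r. u (fst p) a * u (fst q) a)) *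
    ((if snd q = snd p then 1 else 0) - (\<Sum>a<r. w (snd p) a * w (snd q) a))"
  by (rule projection_kernel_tensor[OF
        projection_kernel_complement[OF U.projection_kernel_axioms]
        projection_kernel_complement[OF W.projection_kernel_axioms]])

sublocale P: projection_kernel E "tangent_kernel r u w"
  unfolding tangent_kernel_def
  by (rule projection_kernel_complement[OF Q.projection_kernel_axioms])

text \<open>The complementary tensor projection kills tangent matrices, so the kernel row at
  \<open>p\<close> evaluates them at \<open>p\<close>. This is the link between sums of rank-one
  operators and sampling of entries.\<close>

lemma tangent_kernel_reproducing:
  assumes Z: "tangent Z" and p: "p \<in> E"
  shows "ip E (tangent_kernel r u w p) Z = Z p"
proof -
  obtain f g where fg: "\<And>i j. i < n1 \<Longrightarrow> j < n2 \<Longrightarrow>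
      Z (i, j) = (\<Sum>a<r. u i a * f a j) + (\<Sum>a<r. g i a * w j a)"
    using Z unfolding tangent_def by blast
  let ?cu = "\<lambda>k. (if k = fst p then 1 else 0) - (\<Sum>a<r. u (fst p) a * u k a)"
  let ?cw = "\<lambda>l. (if l = snd p then 1 else 0) - (\<Sum>a<r. w (snd p) a * w l a)"
  have cu: "(\<Sum>k<n1. ?cu k * u k a) = 0" if "a < r" for a
  proof -
    have "(\<Sum>k<n1. ?cu k * u k a)
        = (\<Sum>k<n1. (if k = fst p then 1 else 0) * u k a) - (\<Sum>b<r. u (fst p) b * (\<Sum>k<n1. u k b * u k a))"
      by (simp add: left_diff_distrib sum_subtractf sum_distrib_left sum_distrib_right mult.assoc)
         (rule sum.swap)
    also have "(\<Sum>b<r. u (fst p) b * (\<Sum>k<n1. u k b * u k a)) = (\<Sum>b<r. if b = a then u (fst p) b else 0)"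
      using that by (intro sum.cong) (auto simp: u_orth)
    finally show ?thesis using p that by (auto simp: if_distrib[of "\<lambda>c. c * _"] cong: if_cong)
  qed
  have cw: "(\<Sum>l<n2. ?cw l * w l a) = 0" if "a < r" for a
  proof -
    have "(\<Sum>k<n2. ?cw k * w k a)
        = (\<Sum>k<n2. (if k = snd p then 1 else 0) * w k a) - (\<Sum>b<r. w (snd p) b * (\<Sum>k<n2. w k b * w k a))"
      by (simp add: left_diff_distrib sum_subtractf sum_distrib_left sum_distrib_right mult.assoc)
         (rule sum.swap)
    also have "(\<Sum>b<r. w (snd p) b * (\<Sum>k<n2. w k b * w k a)) = (\<Sum>b<r. if b = a then w (snd p) b else 0)"
      using that by (intro sum.cong) (auto simp: w_orth)
    finally show ?thesis using p that by (auto simp: if_distrib[of "\<lambda>c. c * _"] cong: if_cong)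
  qed
  have "ip E (\<lambda>q. ?cu (fst q) * ?cw (snd q)) Z = (\<Sum>k<n1. \<Sum>l<n2. ?cu k * ?cw l * Z (k, l))"
    by (simp add: ip_def sum.cartesian_product case_prod_beta)
  also have "\<dots> = 0"
    by (rule bilinear_sum_eq_0[where R = "{..<r}" and u = u and w = w and f = f and g = g])
       (use fg cu cw in auto)
  finally have "ip E (\<lambda>q. ?cu (fst q) * ?cw (snd q)) Z = 0" .
  moreover have "ip E (\<lambda>q. if q = p then 1 else 0) Z = Z p"
    using P.ip_delta[OF p, of Z] by (simp add: P.\<delta>_def)
  ultimately show ?thesis by (simp add: tangent_kernel_def ip_diff_left)
qed

lemma ip_M_tangent:
  assumes "tangent Z" "S \<subseteq> E"
  shows "ip E Z (P.M S Z) = (\<Sum>p\<in>S. (Z p)\<^sup>2)"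
proof -
  have "ip E Z (P.M S Z) = (\<Sum>p\<in>S. (ip E (tangent_kernel r u w p) Z)\<^sup>2)"
    by (simp add: P.ip_M power2_eq_square ip_commute)
  also have "\<dots> = (\<Sum>p\<in>S. (Z p)\<^sup>2)"
    using assms by (intro sum.cong) (auto simp: tangent_kernel_reproducing)
  finally show ?thesis .
qed

text \<open>Incoherence becomes a bound on the squared norms of the rank-one vectors, by
  \<open>1 - (1 - a) (1 - b) \<le> a + b\<close>.\<close>

lemma tangent_kernel_diag_le:
  assumes "\<And>i. i < n1 \<Longrightarrow> (\<Sum>a<r. (u i a)\<^sup>2) \<le> \<nu>1" "\<And>j. j < n2 \<Longrightarrow> (\<Sum>a<r. (w j a)\<^sup>2) \<le> \<nu>2"
    and p: "p \<in> E"
  shows "tangent_kernel r u w p p \<le> \<nu>1 + \<nu>2"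
proof -
  let ?a = "\<Sum>a<r. (u (fst p) a)\<^sup>2" and ?b = "\<Sum>a<r. (w (snd p) a)\<^sup>2"
  have "tangent_kernel r u w p p = 1 - (1 - ?a) * (1 - ?b)"
    by (simp add: tangent_kernel_def power2_eq_square)
  also have "\<dots> = ?a + ?b - ?a * ?b" by (simp add: algebra_simps)
  also have "\<dots> \<le> ?a + ?b" by (simp add: sum_nonneg)
  also have "\<dots> \<le> \<nu>1 + \<nu>2" using assms by (intro add_mono) auto
  finally show ?thesis .
qed

end

lemma prob_uniform_sample:
  assumes "m \<le> n1 * n2"
  shows "measure_pmf.prob (uniform_sample n1 n2 m) A
    = real (card ({\<Omega>. \<Omega> \<subseteq> {..<n1} \<times> {..<n2} \<and> card \<Omega> = m} \<inter> A)) / real (n1 * n2 choose m)"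
proof -
  let ?E = "{..<n1} \<times> {..<n2}"
  have card: "card {\<Omega>. \<Omega> \<subseteq> ?E \<and> card \<Omega> = m} = (n1 * n2 choose m)"
    by (subst n_subsets) simp_all
  have "0 < (n1 * n2 choose m)" using assms by simp
  then have "{\<Omega>. \<Omega> \<subseteq> ?E \<and> card \<Omega> = m} \<noteq> {}" using card by (metis card.empty less_irrefl)
  moreover have "finite {\<Omega>. \<Omega> \<subseteq> ?E \<and> card \<Omega> = m}" by simp
  ultimately show ?thesis
    unfolding uniform_sample_def by (simp add: measure_pmf_of_set card)
qed

context tangent_space begin

lemma prob_tangent_RIP:
  fixes n p \<nu> :: real
  assumes n: "2 \<le> n" and N: "real n1 * real n2 \<le> n\<^sup>2"
    and \<nu>: "\<And>i. i < n1 \<Longrightarrow> (\<Sum>a<r. (u i a)\<^sup>2) \<le> \<nu> / 2" "\<And>j. j < n2 \<Longrightarrow> (\<Sum>a<r. (w j a)\<^sup>2) \<le> \<nu> / 2"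
      "0 \<le> \<nu>"
    and m: "m \<le> n1 * n2" "8 * ln n \<le> real m" and p: "p = real m / (real n1 * real n2)"
    and rate: "46 * \<nu> * ln n \<le> p"
  shows "measure_pmf.prob (uniform_sample n1 n2 m)
      {\<Omega>. \<not> (\<forall>Z. tangent Z \<longrightarrow> (\<Sum>p\<in>\<Omega>. (Z p)\<^sup>2) \<le> 8 * p * (\<Sum>p\<in>E. (Z p)\<^sup>2))} \<le> 1 / n ^ 3" (is "?upper")
    and "measure_pmf.prob (uniform_sample n1 n2 m)
      {\<Omega>. \<not> (\<forall>Z. tangent Z \<longrightarrow> p / 2 * (\<Sum>p\<in>E. (Z p)\<^sup>2) \<le> (\<Sum>p\<in>\<Omega>. (Z p)\<^sup>2))} \<le> 1 / n ^ 3" (is "?lower")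
proof -
  have cE: "card E = n1 * n2" by simp
  have diag: "tangent_kernel r u w q q \<le> \<nu>" if "q \<in> E" for q
    using tangent_kernel_diag_le[OF \<nu>(1,2) that] by simp
  have c: "0 < real (n1 * n2 choose m)" using m by simp
  have ipE: "ip E Z Z = (\<Sum>p\<in>E. (Z p)\<^sup>2)" for Z by (simp add: ip_def power2_eq_square)
  have "0 < ln n" using n by simp
  then have m0: "0 < m" using m(2) by (cases m) auto
  let ?S = "{\<Omega>. \<Omega> \<subseteq> E \<and> card \<Omega> = m}"
  let ?B = "{S. S \<subseteq> E \<and> card S = m \<and> \<not> (\<forall>v. ip E v (P.M S v) \<le> 8 * p * ip E v v)}"
  have "real (card ?B) \<le> real (n1 * n2 choose m) / n ^ 3"
    using P.card_large_eigenvalue_upper[of n \<nu> m p] n N \<nu>(3) m p rate diag unfolding cE by simp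
  moreover have "?S \<inter> {\<Omega>. \<not> (\<forall>Z. tangent Z \<longrightarrow> (\<Sum>p\<in>\<Omega>. (Z p)\<^sup>2) \<le> 8 * p * (\<Sum>p\<in>E. (Z p)\<^sup>2))} \<subseteq> ?B"
    by (auto simp flip: ipE ip_M_tangent)
  then have "card (?S \<inter> {\<Omega>. \<not> (\<forall>Z. tangent Z \<longrightarrow> (\<Sum>p\<in>\<Omega>. (Z p)\<^sup>2) \<le> 8 * p * (\<Sum>p\<in>E. (Z p)\<^sup>2))}) \<le> card ?B"
    by (intro card_mono) simp_all
  then have "real (card (?S \<inter> {\<Omega>. \<not> (\<forall>Z. tangent Z \<longrightarrow> (\<Sum>p\<in>\<Omega>. (Z p)\<^sup>2) \<le> 8 * p * (\<Sum>p\<in>E. (Z p)\<^sup>2))}))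
      \<le> real (card ?B)" by simp
  ultimately show ?upper
    unfolding prob_uniform_sample[OF m(1)] using c n by (simp add: pos_divide_le_eq)
  let ?C = "{S. S \<subseteq> E \<and> card S = card E - m \<and> \<not> (\<forall>v. ip E v (P.M S v) \<le> (1 - p / 2) * ip E v v)}"
  have "real (card ?C) \<le> real (n1 * n2 choose (n1 * n2 - m)) / n ^ 3"
    using P.card_large_eigenvalue_complement[of n \<nu> m p] n N \<nu>(3) m m0 p rate diag unfolding cE by simp
  also have "(n1 * n2 choose (n1 * n2 - m)) = (n1 * n2 choose m)"
    using m(1) by (rule binomial_symmetric[symmetric])
  finally have C: "real (card ?C) \<le> real (n1 * n2 choose m) / n ^ 3" .
  let ?D = "?S \<inter> {\<Omega>. \<not> (\<forall>Z. tangent Z \<longrightarrow> p / 2 * (\<Sum>p\<in>E. (Z p)\<^sup>2) \<le> (\<Sum>p\<in>\<Omega>. (Z p)\<^sup>2))}"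
  have "card ?D \<le> card ?C"
  proof (rule card_inj_on_le[of "\<lambda>\<Omega>. E - \<Omega>"])
    show "inj_on (\<lambda>\<Omega>. E - \<Omega>) ?D" by (rule inj_onI) blast
    show "(\<lambda>\<Omega>. E - \<Omega>) ` ?D \<subseteq> ?C"
    proof (rule image_subsetI)
      fix \<Omega> assume "\<Omega> \<in> ?D"
      then obtain Z where \<Omega>: "\<Omega> \<subseteq> E" "card \<Omega> = m" and Z: "tangent Z"
        and lt: "(\<Sum>p\<in>\<Omega>. (Z p)\<^sup>2) < p / 2 * (\<Sum>p\<in>E. (Z p)\<^sup>2)" by (auto simp: not_le)
      have "(\<Sum>p\<in>E. (Z p)\<^sup>2) = (\<Sum>p\<in>E - \<Omega>. (Z p)\<^sup>2) + (\<Sum>p\<in>\<Omega>. (Z p)\<^sup>2)"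
        using \<Omega> by (intro sum.subset_diff) auto
      \<comment> \<open>The energy splits over \<open>\<Omega>\<close> and its complement: a deficit
        on \<open>\<Omega>\<close> means more than the share \<open>1 - p / 2\<close>
        outside.\<close>
      then have "(1 - p / 2) * ip E Z Z < ip E Z (P.M (E - \<Omega>) Z)"
        using lt ip_M_tangent[OF Z, of "E - \<Omega>"] by (simp add: ipE left_diff_distrib)
      moreover have "card (E - \<Omega>) = card E - m"
        using \<Omega> finite_subset[of \<Omega> E] by (simp add: card_Diff_subset)
      ultimately show "E - \<Omega> \<in> ?C" by (auto simp: not_le)
    qed
  qed simp
  then have "real (card ?D) \<le> real (card ?C)" by simp
  with C show ?lower
    unfolding prob_uniform_sample[OF m(1)] using c n by (simp add: pos_divide_le_eq)
qed

end

section \<open>Discrepancy of rectangles\<close>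

text \<open>The quotient of the two binomials is a product of \<open>k\<close> factors
  \<open>(m - i) / (N - i)\<close>, each at most \<open>m / N\<close>.\<close>

lemma binomial_diff_diff_le:
  assumes "k \<le> m" "m \<le> N"
  shows "real (N - k choose (m - k)) * real N ^ k \<le> real (N choose m) * real m ^ k"
  using assms
proof (induction k)
  case (Suc k)
  have abs: "(N - k) * (N - Suc k choose (m - Suc k)) = (m - k) * (N - k choose (m - k))"
    using binomial_absorption[of "m - Suc k" "N - k"] Suc.prems by (simp add: Suc_diff_Suc)
  have frac: "real N * real (m - k) \<le> real m * real (N - k)"
    using Suc.prems mult_left_mono[of "real m" "real N" "real k"]
    by (simp add: of_nat_diff algebra_simps)
  have pos: "0 < real (N - k)" using Suc.prems by simp
  have "real (N - k) * (real (N - Suc k choose (m - Suc k)) * real N ^ Suc k)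
      = (real (m - k) * real (N - k choose (m - k))) * real N ^ Suc k"
    by (simp only: abs mult.assoc[symmetric] flip: of_nat_mult)
  also have "\<dots> = real N * real (m - k) * (real (N - k choose (m - k)) * real N ^ k)" by simp
  also have "\<dots> \<le> real N * real (m - k) * (real (N choose m) * real m ^ k)"
    using Suc by (intro mult_left_mono) auto
  also have "\<dots> \<le> real m * real (N - k) * (real (N choose m) * real m ^ k)"
    using frac by (intro mult_right_mono) auto
  also have "\<dots> = real (N - k) * (real (N choose m) * real m ^ Suc k)" by simp
  finally show ?case using pos by (rule mult_left_le_imp_le)
qed simp

text \<open>A fixed \<open>K\<close> is contained in the sample with probability at most
  \<open>p ^ card K\<close>, as if the entries were drawn independently.\<close>

lemma card_supersets_le:
  assumes E: "finite E" and K: "K \<subseteq> E" and m: "m \<le> card E" and N: "0 < card E"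
  shows "real (card {\<Omega>. \<Omega> \<subseteq> E \<and> card \<Omega> = m \<and> K \<subseteq> \<Omega>})
     \<le> real (card E choose m) * (real m / real (card E)) ^ card K"
proof (cases "card K \<le> m")
  case True
  have finK: "finite K" using K E by (rule finite_subset)
  have "card {\<Omega>. \<Omega> \<subseteq> E \<and> card \<Omega> = m \<and> K \<subseteq> \<Omega>} \<le> card {\<Omega>. \<Omega> \<subseteq> E - K \<and> card \<Omega> = m - card K}"
  proof (rule card_inj_on_le[of "\<lambda>\<Omega>. \<Omega> - K"])
    show "inj_on (\<lambda>\<Omega>. \<Omega> - K) {\<Omega>. \<Omega> \<subseteq> E \<and> card \<Omega> = m \<and> K \<subseteq> \<Omega>}"
      by (rule inj_onI) blast
    show "(\<lambda>\<Omega>. \<Omega> - K) ` {\<Omega>. \<Omega> \<subseteq> E \<and> card \<Omega> = m \<and> K \<subseteq> \<Omega>}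
        \<subseteq> {\<Omega>. \<Omega> \<subseteq> E - K \<and> card \<Omega> = m - card K}"
      using finK by (auto simp: card_Diff_subset)
  qed (use E in simp)
  also have "\<dots> = (card E - card K choose (m - card K))"
    using E K finK by (subst n_subsets) (auto simp: card_Diff_subset)
  finally have "real (card {\<Omega>. \<Omega> \<subseteq> E \<and> card \<Omega> = m \<and> K \<subseteq> \<Omega>})
      \<le> real (card E - card K choose (m - card K))" by simp
  also have "\<dots> \<le> real (card E choose m) * (real m / real (card E)) ^ card K"
    using binomial_diff_diff_le[OF True m] N by (simp add: power_divide field_simps)
  finally show ?thesis .
next
  case False
  have "\<not> (\<Omega> \<subseteq> E \<and> card \<Omega> = m \<and> K \<subseteq> \<Omega>)" for \<Omega>
    using False card_mono[of \<Omega> K] finite_subset[OF _ E, of \<Omega>] by auto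
  then have "{\<Omega>. \<Omega> \<subseteq> E \<and> card \<Omega> = m \<and> K \<subseteq> \<Omega>} = {}" by blast
  then show ?thesis by (simp only: card.empty) simp
qed

lemma sum_Pow_power_card:
  fixes c :: real
  assumes "finite A"
  shows "(\<Sum>K\<in>Pow A. c ^ card K) = (1 + c) ^ card A"
proof -
  have "(\<Prod>a\<in>A. c + 1) = (\<Sum>K\<in>Pow A. (\<Prod>a\<in>K. c) * (\<Prod>a\<in>A - K. 1))"
    by (rule prod_add[OF assms])
  then show ?thesis by (simp add: add.commute)
qed

text \<open>The moment generating function is expanded over the subsets of \<open>\<Omega> \<inter> A\<close>, so that only
  the probabilities of \<open>K \<subseteq> \<Omega>\<close> are needed.\<close>

lemma sum_power_card_Int_le:
  fixes z :: real
  assumes E: "finite E" and A: "A \<subseteq> E" and m: "m \<le> card E" and N: "0 < card E" and z: "1 \<le> z"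
    and p: "p = real m / real (card E)"
  shows "(\<Sum>\<Omega> | \<Omega> \<subseteq> E \<and> card \<Omega> = m. z ^ card (\<Omega> \<inter> A))
     \<le> real (card E choose m) * exp (z * p * real (card A))"
proof -
  let ?S = "{\<Omega>. \<Omega> \<subseteq> E \<and> card \<Omega> = m}"
  have finA: "finite A" using A E by (rule finite_subset)
  have fin: "finite ?S" using E by simp
  have "(\<Sum>\<Omega>\<in>?S. z ^ card (\<Omega> \<inter> A)) = (\<Sum>\<Omega>\<in>?S. \<Sum>K\<in>Pow (\<Omega> \<inter> A). (z - 1) ^ card K)"
    using finA by (intro sum.cong refl, subst sum_Pow_power_card) auto
  also have "\<dots> = (\<Sum>\<Omega>\<in>?S. \<Sum>K\<in>Pow A. if K \<subseteq> \<Omega> then (z - 1) ^ card K else 0)"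
    using finA by (intro sum.cong refl sum.mono_neutral_cong_left) auto
  also have "\<dots> = (\<Sum>K\<in>Pow A. \<Sum>\<Omega>\<in>?S. if K \<subseteq> \<Omega> then (z - 1) ^ card K else 0)"
    by (rule sum.swap)
  also have "\<dots> = (\<Sum>K\<in>Pow A. real (card {\<Omega>. \<Omega> \<subseteq> E \<and> card \<Omega> = m \<and> K \<subseteq> \<Omega>}) * (z - 1) ^ card K)"
    using fin by (intro sum.cong refl) (simp add: sum.If_cases Int_def conj_ac)
  also have "\<dots> \<le> (\<Sum>K\<in>Pow A. real (card E choose m) * p ^ card K * (z - 1) ^ card K)"
    using z A unfolding p by (intro sum_mono mult_right_mono card_supersets_le E m N) auto
  also have "\<dots> = real (card E choose m) * (1 + p * (z - 1)) ^ card A"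
    using finA by (simp add: mult.assoc sum_distrib_left[symmetric] sum_Pow_power_card flip: power_mult_distrib)
  also have "\<dots> \<le> real (card E choose m) * exp (p * (z - 1)) ^ card A"
    using z by (intro mult_left_mono power_mono) (auto simp: p)
  also have "\<dots> \<le> real (card E choose m) * exp (z * p * real (card A))"
  proof (rule mult_left_mono)
    have "0 \<le> p * real (card A)" by (simp add: p)
    then have "real (card A) * (p * (z - 1)) \<le> z * p * real (card A)" by (simp add: algebra_simps)
    then show "exp (p * (z - 1)) ^ card A \<le> exp (z * p * real (card A))"
      by (simp flip: exp_of_nat_mult)
  qed simp
  finally show ?thesis .
qed

text \<open>Chernoff's method: Markov's inequality for
  \<open>z ^ card (\<Omega> \<inter> A)\<close>. The parameter stays free because its best value
  depends on the shape of the rectangle.\<close>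

lemma card_large_intersection_le:
  fixes y z :: real
  assumes E: "finite E" and A: "A \<subseteq> E" and m: "m \<le> card E" and N: "0 < card E" and z: "1 \<le> z"
    and p: "p = real m / real (card E)"
  shows "real (card {\<Omega>. \<Omega> \<subseteq> E \<and> card \<Omega> = m \<and> y < real (card (\<Omega> \<inter> A))})
     \<le> real (card E choose m) * exp (z * p * real (card A) - y * ln z)"
proof -
  let ?S = "{\<Omega>. \<Omega> \<subseteq> E \<and> card \<Omega> = m}"
  let ?B = "{\<Omega>. \<Omega> \<subseteq> E \<and> card \<Omega> = m \<and> y < real (card (\<Omega> \<inter> A))}"
  have "real (card ?B) * exp (y * ln z) = (\<Sum>\<Omega>\<in>?B. exp (y * ln z))" by simp
  also have "\<dots> \<le> (\<Sum>\<Omega>\<in>?B. z ^ card (\<Omega> \<inter> A))"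
  proof (rule sum_mono)
    fix \<Omega> assume "\<Omega> \<in> ?B"
    then have "y * ln z \<le> real (card (\<Omega> \<inter> A)) * ln z" using z by (intro mult_right_mono) auto
    then have "exp (y * ln z) \<le> exp (real (card (\<Omega> \<inter> A)) * ln z)" by simp
    also have "\<dots> = z ^ card (\<Omega> \<inter> A)" using z by (simp add: exp_of_nat_mult)
    finally show "exp (y * ln z) \<le> z ^ card (\<Omega> \<inter> A)" .
  qed
  also have "\<dots> \<le> (\<Sum>\<Omega>\<in>?S. z ^ card (\<Omega> \<inter> A))"
    using E z by (intro sum_mono2) auto
  also have "\<dots> \<le> real (card E choose m) * exp (z * p * real (card A))"
    by (rule sum_power_card_Int_le[OF assms])
  finally show ?thesis by (simp add: exp_diff pos_le_divide_eq)
qed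

lemma power_self_le_fact_exp: "real s ^ s \<le> fact s * exp (real s)"
proof (induction s)
  case (Suc s)
  have "(1 + real s) ^ s \<le> exp 1 * real s ^ s"
  proof (cases "s = 0")
    case False
    have "(1 + 1 / real s) ^ s \<le> exp (1 / real s) ^ s" by (intro power_mono) auto
    also have "\<dots> = exp 1" using False by (simp flip: exp_of_nat_mult)
    finally have "(1 + 1 / real s) ^ s * real s ^ s \<le> exp 1 * real s ^ s"
      by (rule mult_right_mono) simp
    moreover have "(1 + 1 / real s) * real s = 1 + real s" using False by (simp add: field_simps)
    ultimately show ?thesis by (simp flip: power_mult_distrib)
  qed simp
  also have "\<dots> \<le> exp 1 * (fact s * exp (real s))" by (intro mult_left_mono Suc) simp
  finally have "(1 + real s) * (1 + real s) ^ s \<le> (1 + real s) * (exp 1 * (fact s * exp (real s)))"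
    by (rule mult_left_mono) simp
  then show ?case by (simp add: exp_add mult_ac)
qed simp

text \<open>The usual bound \<open>(e n / s) ^ s\<close>, in exponential form so that it can be
  added to a Chernoff exponent.\<close>

lemma binomial_le_exp:
  assumes "0 < s" "real n1 \<le> n"
  shows "real (n1 choose s) \<le> exp (real s * (1 + ln (n / real s)))"
proof (cases "n1 = 0")
  case True then show ?thesis using assms(1) by (cases s) auto
next
  case False
  then have n: "0 < n" using assms by linarith
  have "real (n1 choose s) * fact s \<le> real n1 ^ s"
    using binomial_fact_pow[of n1 s] by (metis of_nat_fact of_nat_le_iff of_nat_mult of_nat_power)
  also have "\<dots> \<le> n ^ s" using assms by (intro power_mono) auto
  finally have le: "real (n1 choose s) * fact s \<le> n ^ s" .
  have "real (n1 choose s) * real s ^ s \<le> real (n1 choose s) * (fact s * exp (real s))"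
    by (intro mult_left_mono power_self_le_fact_exp) simp
  also have "\<dots> \<le> n ^ s * exp (real s)" using le by (simp add: mult.assoc[symmetric])
  finally have "real (n1 choose s) \<le> (n / real s) ^ s * exp (real s)"
    using assms by (simp add: field_simps)
  also have "(n / real s) ^ s = exp (real s * ln (n / real s))"
    using n assms(1) by (simp add: exp_of_nat_mult)
  finally show ?thesis by (simp add: exp_add[symmetric] algebra_simps)
qed

text \<open>The discrepancy property of random bipartite graphs, with \<open>\<Omega>\<close> as the
  edge set. The first term is a multiple of the expected count; the second takes over for small or
  thin rectangles and is applied with \<open>\<rho> = sqrt (n * p)\<close>.\<close>

definition discrepancy_bound :: "nat \<Rightarrow> nat \<Rightarrow> real \<Rightarrow> real \<Rightarrow> (nat \<times> nat) set \<Rightarrow> bool" where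
  "discrepancy_bound n1 n2 p \<rho> \<Omega> \<longleftrightarrow> (\<forall>S T. S \<subseteq> {..<n1} \<longrightarrow> T \<subseteq> {..<n2} \<longrightarrow>
     real (card (\<Omega> \<inter> S \<times> T)) \<le> exp 2 * p * real (card S) * real (card T)
        + 42 * \<rho> * (real (card S) + real (card T)))"

text \<open>The exponent retains half of \<open>y * L\<close>, hence at least 21 units of
  \<open>B = \<rho> * t * L\<close>. The two counts of subsets cost at most 3 units each and
  \<open>5 * ln n\<close> at most 15, which explains \<open>42 = 2 * (3 + 3 + 15)\<close>.\<close>

lemma exists_Chernoff_parameter:
  fixes n p \<rho> s t :: real
  assumes np: "n * p = \<rho>\<^sup>2" and \<rho>: "1 \<le> \<rho>" and s: "1 \<le> s" "s \<le> t" and t: "t \<le> n"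
  shows "\<exists>z\<ge>1. exp (s * (1 + ln (n / s))) * exp (t * (1 + ln (n / t)))
     * exp (z * p * (s * t) - (exp 2 * p * s * t + 42 * \<rho> * (s + t)) * ln z) \<le> 1 / n ^ 5"
proof -
  define y where "y = exp 2 * p * s * t + 42 * \<rho> * (s + t)"
  define l where "l = ln (n / (s * \<rho>))"
  define L where "L = max 1 l"
  have pos: "0 < n" "0 < s" "0 < t" "0 < \<rho>" using assms by linarith+
  have p: "0 < p" using np pos by (metis zero_less_mult_pos zero_less_power)
  have L: "1 \<le> L" "l \<le> L" by (auto simp: L_def)
  have y1: "42 * (\<rho> * t) \<le> y"
  proof -
    have "0 \<le> exp 2 * p * s * t" "0 \<le> 42 * \<rho> * s" using p pos by auto
    then show ?thesis by (simp add: y_def algebra_simps)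
  qed
  have y2: "exp 2 * (p * (s * t)) \<le> y" using pos by (simp add: y_def algebra_simps)
  have y0: "0 \<le> y" using y1 pos mult_pos_pos[of \<rho> t] by linarith
  have "\<exists>z\<ge>1. z * p * (s * t) - y * ln z \<le> - (y / 2 * L)"
  proof (cases "2 \<le> l")
    case True
    \<comment> \<open>For a short side \<open>s\<close> this choice reduces the exponential moment
      term to exactly \<open>\<rho> * t\<close>, since
      \<open>n * p = \<rho>\<^sup>2\<close>.\<close>
    define z where "z = n / (s * \<rho>)"
    have "0 < z" using pos by (simp add: z_def)
    moreover have "ln z = l" by (simp add: z_def l_def)
    ultimately have z: "1 \<le> z" "ln z = l" using True ln_ge_zero_iff[of z] by linarith+
    have "z * p * (s * t) = (n * p) * t / \<rho>" using pos by (simp add: z_def)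
    also have "\<dots> = \<rho> * t" using pos by (simp add: np power2_eq_square)
    also have "\<dots> \<le> y" using y1 pos mult_pos_pos[of \<rho> t] by linarith
    also have "\<dots> \<le> y / 2 * l" using True y0 mult_left_mono[of 2 l "y / 2"] by simp
    finally have "z * p * (s * t) - y * ln z \<le> - (y / 2 * l)" by (simp add: z(2))
    moreover have "L = l" using True by (simp add: L_def)
    ultimately show ?thesis using z(1) by auto
  next
    case False
    \<comment> \<open>In the remaining case the constant parameter \<open>exp 2\<close> is enough,
      because the first term of \<open>y\<close> carries the same factor.\<close>
    then have "y / 2 * L \<le> y" using y0 mult_left_mono[of L 2 "y / 2"] by (simp add: L_def)
    then have "exp 2 * p * (s * t) - y * ln (exp 2) \<le> - (y / 2 * L)" using y2 by (simp add: mult.assoc)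
    then show ?thesis by (intro exI[of _ "exp 2"]) simp
  qed
  then obtain z where z: "1 \<le> z" "z * p * (s * t) - y * ln z \<le> - (y / 2 * L)" by blast
  define B where "B = \<rho> * t * L"
  have yL: "21 * B \<le> y / 2 * L" using y1 L mult_right_mono[of "21 * (\<rho> * t)" "y / 2" L] by (simp add: B_def)
  have "ln \<rho> \<le> \<rho>" using pos by (intro ln_bound) auto
  have lns: "1 + ln (n / s) \<le> 3 * \<rho> * L"
  proof -
    have "ln (n / s) = l + ln \<rho>" using pos by (simp add: l_def ln_div ln_mult)
    moreover have "1 \<le> \<rho> * L" "L \<le> \<rho> * L" "\<rho> \<le> \<rho> * L"
      using \<rho> L mult_mono[of 1 \<rho> 1 L] by auto
    ultimately show ?thesis using L \<open>ln \<rho> \<le> \<rho>\<close> by linarith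
  qed
  have ln_ts: "ln (n / t) \<le> ln (n / s)" using s pos by (simp add: frac_le)
  have ln0: "0 \<le> ln (n / t)" using t pos by simp
  have a: "s * (1 + ln (n / s)) \<le> 3 * B"
    using mult_mono[of s t "1 + ln (n / s)" "3 * \<rho> * L"] s lns ln_ts ln0 pos by (simp add: B_def mult_ac)
  have "1 + ln (n / t) \<le> 3 * \<rho> * L" using lns ln_ts by linarith
  then have b: "t * (1 + ln (n / t)) \<le> 3 * B"
    using mult_left_mono[of "1 + ln (n / t)" "3 * \<rho> * L" t] pos by (simp add: B_def mult_ac)
  have c: "ln n \<le> 3 * B"
  proof -
    have "ln n = ln t + ln (n / t)" using pos by (simp add: ln_div)
    also have "\<dots> \<le> t + t * ln (n / t)"
      using ln_bound[of t] pos s ln0 mult_right_mono[of 1 t "ln (n / t)"] by simp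
    also have "\<dots> \<le> 3 * B" using b by (simp add: algebra_simps)
    finally show ?thesis .
  qed
  have "exp (s * (1 + ln (n / s))) * exp (t * (1 + ln (n / t))) * exp (z * p * (s * t) - y * ln z)
      = exp (s * (1 + ln (n / s)) + t * (1 + ln (n / t)) + (z * p * (s * t) - y * ln z))"
    by (simp add: exp_add)
  also have "\<dots> \<le> exp (- (5 * ln n))" unfolding exp_le_cancel_iff using a b c yL z(2) by linarith
  also have "\<dots> = 1 / n ^ 5"
    using pos by (simp add: exp_minus exp_of_nat_mult[of 5 "ln n", simplified] inverse_eq_divide)
  finally show ?thesis using z(1) unfolding y_def by blast
qed

text \<open>The binomials in the denominator prepare the union bound over all rectangles of the same
  shape. The longer side takes the role of \<open>t\<close>, hence the case distinction.\<close>

lemma card_large_rectangle_le: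
  fixes n p \<rho> :: real
  assumes n: "real n1 \<le> n" "real n2 \<le> n" and np: "n * p = \<rho>\<^sup>2" and \<rho>: "1 \<le> \<rho>"
    and m: "m \<le> n1 * n2" and p: "p = real m / (real n1 * real n2)"
    and S: "S \<subseteq> {..<n1}" "S \<noteq> {}" and T: "T \<subseteq> {..<n2}" "T \<noteq> {}"
  shows "real (card {\<Omega>. \<Omega> \<subseteq> {..<n1} \<times> {..<n2} \<and> card \<Omega> = m \<and>
       exp 2 * p * real (card S) * real (card T) + 42 * \<rho> * (real (card S) + real (card T))
         < real (card (\<Omega> \<inter> S \<times> T))})
    \<le> real (n1 * n2 choose m) / (n ^ 5 * real (n1 choose card S) * real (n2 choose card T))"
proof -
  let ?E = "{..<n1} \<times> {..<n2}"
  let ?s = "real (card S)" and ?t = "real (card T)"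
  let ?y = "exp 2 * p * ?s * ?t + 42 * \<rho> * (?s + ?t)"
  have fin: "finite S" "finite T" using S T finite_subset by blast+
  have s: "1 \<le> card S" "card S \<le> n1" using S fin card_mono[of "{..<n1}" S] by (auto simp: Suc_le_eq card_gt_0_iff)
  have t: "1 \<le> card T" "card T \<le> n2" using T fin card_mono[of "{..<n2}" T] by (auto simp: Suc_le_eq card_gt_0_iff)
  have s': "1 \<le> ?s" "?s \<le> n" and t': "1 \<le> ?t" "?t \<le> n" using s t n by linarith+
  have pos: "0 < card ?E" "0 < n" using s t s' by (auto simp: zero_less_mult_iff)
  obtain z where z: "1 \<le> z" and bound: "exp (?s * (1 + ln (n / ?s))) * exp (?t * (1 + ln (n / ?t)))
      * exp (z * p * (?s * ?t) - ?y * ln z) \<le> 1 / n ^ 5"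
  proof (cases "?s \<le> ?t")
    case True
    from exists_Chernoff_parameter[OF np \<rho> s'(1) this t'(2)] show ?thesis using that by blast
  next
    case False
    then have "?t \<le> ?s" by simp
    from exists_Chernoff_parameter[OF np \<rho> t'(1) this s'(2)] show ?thesis
      using that by (force simp: ac_simps)
  qed
  let ?a = "real (n1 choose card S)" and ?b = "real (n2 choose card T)"
  have a: "0 < ?a" "?a \<le> exp (?s * (1 + ln (n / ?s)))"
    using s n binomial_le_exp[of "card S" n1 n] by auto
  have b: "0 < ?b" "?b \<le> exp (?t * (1 + ln (n / ?t)))"
    using t n binomial_le_exp[of "card T" n2 n] by auto
  let ?e = "exp (z * p * (?s * ?t) - ?y * ln z)"
  have "?a * ?b * ?e \<le> exp (?s * (1 + ln (n / ?s))) * exp (?t * (1 + ln (n / ?t))) * ?e"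
    using a b by (intro mult_right_mono mult_mono) auto
  then have "?a * ?b * ?e \<le> 1 / n ^ 5" using bound by linarith
  then have "?e \<le> 1 / (n ^ 5 * ?a * ?b)" using a(1) b(1) pos by (simp add: field_simps)
  then have e: "real (n1 * n2 choose m) * ?e \<le> real (n1 * n2 choose m) * (1 / (n ^ 5 * ?a * ?b))"
    by (rule mult_left_mono) simp
  have "real (card {\<Omega>. \<Omega> \<subseteq> ?E \<and> card \<Omega> = m \<and> ?y < real (card (\<Omega> \<inter> S \<times> T))})
      \<le> real (card ?E choose m) * exp (z * p * real (card (S \<times> T)) - ?y * ln z)"
    using S T m pos z by (intro card_large_intersection_le) (auto simp: p)
  also have "\<dots> = real (n1 * n2 choose m) * ?e" by (simp add: card_cartesian_product)
  also have "\<dots> \<le> real (n1 * n2 choose m) * (1 / (n ^ 5 * ?a * ?b))" by (rule e)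
  finally show ?thesis by simp
qed

text \<open>Every size from 1 to \<open>n\<close> contributes exactly 1. Hence the union bound over
  all rectangles costs only the factor \<open>n1 * n2\<close>.\<close>

lemma sum_subsets_inverse_binomial:
  "(\<Sum>S\<in>{S. S \<subseteq> {..<n} \<and> S \<noteq> {}}. 1 / real (n choose card S)) = real n"
proof -
  let ?P = "{S. S \<subseteq> {..<n} \<and> S \<noteq> {}}"
  have img: "card ` ?P \<subseteq> {1..n}"
  proof
    fix k assume "k \<in> card ` ?P"
    then obtain S where S: "S \<subseteq> {..<n}" "S \<noteq> {}" "k = card S" by blast
    then show "k \<in> {1..n}"
      using card_mono[of "{..<n}" S] finite_subset[of S "{..<n}"] by (auto simp: Suc_le_eq card_gt_0_iff)
  qed
  have "(\<Sum>S\<in>?P. 1 / real (n choose card S))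
      = (\<Sum>k\<in>{1..n}. \<Sum>S\<in>{S \<in> ?P. card S = k}. 1 / real (n choose card S))"
    by (rule sum.group[symmetric]) (use img in auto)
  also have "\<dots> = (\<Sum>k\<in>{1..n}. 1)"
  proof (rule sum.cong)
    fix k assume k: "k \<in> {1..n}"
    have "{S \<in> ?P. card S = k} = {S. S \<subseteq> {..<n} \<and> card S = k}" using k by auto
    then have "card {S \<in> ?P. card S = k} = (n choose k)" by (simp add: n_subsets)
    then show "(\<Sum>S\<in>{S \<in> ?P. card S = k}. 1 / real (n choose card S)) = 1" using k by simp
  qed simp
  finally show ?thesis by simp
qed

lemma prob_discrepancy_bound:
  fixes n p \<rho> :: real
  assumes n: "real n1 \<le> n" "real n2 \<le> n" "1 \<le> n" and np: "n * p = \<rho>\<^sup>2" and \<rho>: "1 \<le> \<rho>"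
    and m: "m \<le> n1 * n2" and p: "p = real m / (real n1 * real n2)"
  shows "measure_pmf.prob (uniform_sample n1 n2 m) {\<Omega>. \<not> discrepancy_bound n1 n2 p \<rho> \<Omega>} \<le> 1 / n ^ 3"
proof -
  let ?E = "{..<n1} \<times> {..<n2}"
  let ?P = "\<lambda>n. {S. S \<subseteq> {..<n::nat} \<and> S \<noteq> {}}"
  let ?c = "real (n1 * n2 choose m)"
  let ?bad = "\<lambda>S T. {\<Omega>. \<Omega> \<subseteq> ?E \<and> card \<Omega> = m \<and>
       exp 2 * p * real (card S) * real (card T) + 42 * \<rho> * (real (card S) + real (card T))
         < real (card (\<Omega> \<inter> S \<times> T))}"
  let ?B = "{\<Omega>. \<Omega> \<subseteq> ?E \<and> card \<Omega> = m} \<inter> {\<Omega>. \<not> discrepancy_bound n1 n2 p \<rho> \<Omega>}"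
  have c: "0 < ?c" using m by simp
  have finP: "finite (?P k)" for k by simp
  have "?B \<subseteq> (\<Union>S\<in>?P n1. \<Union>T\<in>?P n2. ?bad S T)"
  proof
    fix \<Omega> assume "\<Omega> \<in> ?B"
    then obtain S T where ST: "S \<subseteq> {..<n1}" "T \<subseteq> {..<n2}"
      and \<Omega>: "\<Omega> \<in> ?bad S T" by (auto simp: discrepancy_bound_def not_le)
    have "0 \<le> \<rho> * real (card S)" "0 \<le> \<rho> * real (card T)" using \<rho> by simp_all
    then have "S \<noteq> {}" "T \<noteq> {}" using \<Omega> by auto
    then show "\<Omega> \<in> (\<Union>S\<in>?P n1. \<Union>T\<in>?P n2. ?bad S T)" using ST \<Omega> by blast
  qed
  then have "card ?B \<le> card (\<Union>S\<in>?P n1. \<Union>T\<in>?P n2. ?bad S T)"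
    by (intro card_mono) auto
  also have "\<dots> \<le> (\<Sum>S\<in>?P n1. card (\<Union>T\<in>?P n2. ?bad S T))" by (rule card_UN_le[OF finP])
  also have "\<dots> \<le> (\<Sum>S\<in>?P n1. \<Sum>T\<in>?P n2. card (?bad S T))" by (intro sum_mono card_UN_le[OF finP])
  finally have "real (card ?B) \<le> (\<Sum>S\<in>?P n1. \<Sum>T\<in>?P n2. real (card (?bad S T)))"
    by (simp flip: of_nat_sum)
  also have "\<dots> \<le> (\<Sum>S\<in>?P n1. \<Sum>T\<in>?P n2.
      ?c / (n ^ 5 * real (n1 choose card S) * real (n2 choose card T)))"
    by (intro sum_mono card_large_rectangle_le[OF n(1,2) np \<rho> m p]) auto
  also have "\<dots> = (\<Sum>S\<in>?P n1. \<Sum>T\<in>?P n2.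
      ?c / n ^ 5 * ((1 / real (n1 choose card S)) * (1 / real (n2 choose card T))))"
    by (simp add: mult.assoc)
  also have "\<dots> = ?c / n ^ 5 * ((\<Sum>S\<in>?P n1. 1 / real (n1 choose card S)) * (\<Sum>T\<in>?P n2. 1 / real (n2 choose card T)))"
    unfolding sum_product by (simp only: sum_distrib_left)
  also have "\<dots> = ?c / n ^ 5 * (real n1 * real n2)"
    by (simp only: sum_subsets_inverse_binomial)
  also have "\<dots> \<le> ?c / n ^ 5 * (n * n)"
    using n by (intro mult_left_mono mult_mono) auto
  also have "\<dots> = ?c / n ^ 3" using n(3) by (simp add: field_simps eval_nat_numeral)
  finally show ?thesis
    unfolding prob_uniform_sample[OF m] using c n(3) by (simp add: pos_divide_le_eq)
qed

text \<open>Both sides are affine in each coordinate of \<open>x\<close> and of \<open>y\<close>, so that it suffices to compare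
  them at the vertices of the cube, that is, for indicator functions.\<close>

lemma discrepancy_bound_sum_le:
  assumes disc: "discrepancy_bound n1 n2 p \<rho> \<Omega>" and \<Omega>: "\<Omega> \<subseteq> {..<n1} \<times> {..<n2}"
    and x: "\<And>i. i < n1 \<Longrightarrow> 0 \<le> x i \<and> x i \<le> b" and y: "\<And>j. j < n2 \<Longrightarrow> 0 \<le> y j \<and> y j \<le> b"
    and b: "0 < b"
  shows "(\<Sum>(i, j)\<in>\<Omega>. x i * y j) \<le> exp 2 * p * (\<Sum>i<n1. x i) * (\<Sum>j<n2. y j)
     + 42 * \<rho> * b * ((\<Sum>i<n1. x i) + (\<Sum>j<n2. y j))"
proof -
  define \<omega> :: "nat \<Rightarrow> nat \<Rightarrow> real" where "\<omega> i j = (if (i, j) \<in> \<Omega> then 1 else 0)" for i j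
  define K where "K = exp 2 * p"
  define D where "D = 42 * \<rho>"
  define G where "G x y = (\<Sum>i<n1. \<Sum>j<n2. \<omega> i j * x i * y j) - K * (\<Sum>i<n1. x i) * (\<Sum>j<n2. y j)
     - D * ((\<Sum>i<n1. x i) + (\<Sum>j<n2. y j))" for x y
  define ind :: "nat set \<Rightarrow> nat \<Rightarrow> real" where "ind S i = (if i \<in> S then 1 else 0)" for S i
  have linear_le: "\<exists>S\<subseteq>{..<k}. (\<Sum>i<k. c i * z i) \<le> (\<Sum>i<k. c i * ind S i)"
    if "\<And>i. i < k \<Longrightarrow> 0 \<le> z i \<and> z i \<le> 1" for k and c z :: "nat \<Rightarrow> real"
  proof (intro exI[of _ "{i. i < k \<and> 0 < c i}"] conjI sum_mono)
    fix i assume "i \<in> {..<k}"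
    then show "c i * z i \<le> c i * ind {i. i < k \<and> 0 < c i} i"
      using that[of i] mult_left_mono[of "z i" 1 "c i"] mult_nonneg_nonneg[of "- c i" "z i"]
      by (auto simp: ind_def)
  qed auto
  have G1: "G x y = (\<Sum>i<n1. ((\<Sum>j<n2. \<omega> i j * y j) - K * (\<Sum>j<n2. y j) - D) * x i) - D * (\<Sum>j<n2. y j)" for x y
  proof -
    have "(\<Sum>i<n1. \<Sum>j<n2. \<omega> i j * x i * y j) = (\<Sum>i<n1. (\<Sum>j<n2. \<omega> i j * y j) * x i)"
      by (simp add: sum_distrib_left sum_distrib_right mult_ac)
    then show ?thesis
      by (simp add: G_def left_diff_distrib sum_subtractf sum_distrib_left[symmetric] distrib_left)
  qed
  have G2: "G x y = (\<Sum>j<n2. ((\<Sum>i<n1. \<omega> i j * x i) - K * (\<Sum>i<n1. x i) - D) * y j) - D * (\<Sum>i<n1. x i)" for x y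
  proof -
    have "(\<Sum>i<n1. \<Sum>j<n2. \<omega> i j * x i * y j) = (\<Sum>j<n2. (\<Sum>i<n1. \<omega> i j * x i) * y j)"
      by (subst sum.swap) (simp add: sum_distrib_right)
    then show ?thesis
      by (simp add: G_def left_diff_distrib sum_subtractf sum_distrib_left[symmetric] distrib_left)
  qed
  have G_ind: "G (ind S) (ind T) \<le> 0" if S: "S \<subseteq> {..<n1}" and T: "T \<subseteq> {..<n2}" for S T
  proof -
    have card: "(\<Sum>i<k. ind S i) = real (card S)" if "S \<subseteq> {..<k}" for k S
      using that by (simp add: ind_def sum.If_cases Int_absorb1)
    have "(\<Sum>i<n1. \<Sum>j<n2. \<omega> i j * ind S i * ind T j) = (\<Sum>q\<in>{..<n1} \<times> {..<n2}. if q \<in> \<Omega> \<inter> S \<times> T then 1 else 0)"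
      unfolding sum.cartesian_product by (intro sum.cong) (auto simp: \<omega>_def ind_def split: if_splits)
    also have "\<dots> = real (card (\<Omega> \<inter> S \<times> T))"
      using \<Omega> by (subst sum.If_cases) (auto intro!: arg_cong[where f = card])
    also have "\<dots> \<le> exp 2 * p * real (card S) * real (card T) + 42 * \<rho> * (real (card S) + real (card T))"
      using disc S T unfolding discrepancy_bound_def by blast
    finally show ?thesis
      using S T by (simp add: G_def card K_def D_def)
  qed
  have G_le: "G x y \<le> 0"
    if x01: "\<And>i. i < n1 \<Longrightarrow> 0 \<le> x i \<and> x i \<le> 1" and y01: "\<And>j. j < n2 \<Longrightarrow> 0 \<le> y j \<and> y j \<le> 1" for x y
  proof -
    obtain S where S: "S \<subseteq> {..<n1}" "G x y \<le> G (ind S) y"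
      using linear_le[of n1 x "\<lambda>i. (\<Sum>j<n2. \<omega> i j * y j) - K * (\<Sum>j<n2. y j) - D", OF x01]
      unfolding G1 by auto
    obtain T where T: "T \<subseteq> {..<n2}" "G (ind S) y \<le> G (ind S) (ind T)"
      using linear_le[of n2 y "\<lambda>j. (\<Sum>i<n1. \<omega> i j * ind S i) - K * (\<Sum>i<n1. ind S i) - D", OF y01]
      unfolding G2 by auto
    show ?thesis using S T G_ind[OF S(1) T(1)] by linarith
  qed
  \<comment> \<open>Scaling to the unit cube: the bilinear terms have degree two and the linear one
    degree one, which leaves the factor \<open>b\<close> in the latter.\<close>
  have "G (\<lambda>i. x i / b) (\<lambda>j. y j / b) \<le> 0"
    using x y b by (intro G_le) auto
  moreover have "b\<^sup>2 * G (\<lambda>i. x i / b) (\<lambda>j. y j / b)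
      = (\<Sum>i<n1. \<Sum>j<n2. \<omega> i j * x i * y j) - K * (\<Sum>i<n1. x i) * (\<Sum>j<n2. y j)
     - D * b * ((\<Sum>i<n1. x i) + (\<Sum>j<n2. y j))"
    using b by (simp add: G_def sum_divide_distrib[symmetric] power2_eq_square field_simps)
  moreover have "(\<Sum>i<n1. \<Sum>j<n2. \<omega> i j * x i * y j) = (\<Sum>(i, j)\<in>\<Omega>. x i * y j)"
    unfolding sum.cartesian_product using \<Omega>
    by (intro sum.mono_neutral_cong_right) (auto simp: \<omega>_def)
  ultimately show ?thesis
    using b mult_nonneg_nonpos[of "b\<^sup>2" "G (\<lambda>i. x i / b) (\<lambda>j. y j / b)"]
    by (simp add: K_def D_def)
qed

section \<open>Matrix norms\<close>

definition vnorm :: "real vec \<Rightarrow> real" where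
  "vnorm v = L2_set (\<lambda>i. v $ i) {..<dim_vec v}"

lemma vnorm_nonneg [simp]: "0 \<le> vnorm v"
  by (simp add: vnorm_def)

lemma vnorm_square: "(vnorm v)\<^sup>2 = v \<bullet> v"
  by (simp add: vnorm_def L2_set_def sum_nonneg scalar_prod_def power2_eq_square atLeast0LessThan)

lemma abs_scalar_prod_le:
  assumes "u \<in> carrier_vec n" "v \<in> carrier_vec n"
  shows "\<bar>u \<bullet> v\<bar> \<le> vnorm u * vnorm v"
proof -
  have "\<bar>u \<bullet> v\<bar> \<le> (\<Sum>i<n. \<bar>u $ i\<bar> * \<bar>v $ i\<bar>)"
    using assms by (auto simp: scalar_prod_def atLeast0LessThan abs_mult[symmetric] intro: sum_abs)
  also have "\<dots> \<le> vnorm u * vnorm v"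
    using assms L2_set_mult_ineq[of "($) u" "($) v" "{..<n}"] by (simp add: vnorm_def)
  finally show ?thesis .
qed

lemma vnorm_eq_0D: "v \<in> carrier_vec n \<Longrightarrow> vnorm v = 0 \<Longrightarrow> v = 0\<^sub>v n"
  by (auto simp: vnorm_def L2_set_eq_0_iff)

lemma vnorm_add_le:
  assumes "u \<in> carrier_vec n" "v \<in> carrier_vec n"
  shows "vnorm (u + v) \<le> vnorm u + vnorm v"
proof -
  have "vnorm (u + v) = L2_set (\<lambda>i. u $ i + v $ i) {..<n}"
    using assms by (auto simp: vnorm_def intro!: L2_set_cong)
  also have "\<dots> \<le> vnorm u + vnorm v"
    using assms by (auto simp: vnorm_def intro: L2_set_triangle_ineq)
  finally show ?thesis .
qed

lemma vnorm_uminus: "vnorm (- v) = vnorm v"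
  by (simp add: vnorm_def L2_set_def)

lemma vnorm_diff_le:
  assumes "u \<in> carrier_vec n" "v \<in> carrier_vec n"
  shows "vnorm (u - v) \<le> vnorm u + vnorm v"
  using vnorm_add_le[of u n "- v"] assms by (simp add: vnorm_uminus minus_add_uminus_vec)

lemma norm_F_square: "A \<in> carrier_mat n k \<Longrightarrow> (norm_F A)\<^sup>2 = (\<Sum>i<n. \<Sum>j<k. (A $$ (i, j))\<^sup>2)"
  by (auto simp: norm_F_def norm_F_on_def L2_set_def sum_nonneg sum.cartesian_product)

lemma norm_F_nonneg [simp]: "0 \<le> norm_F A" "0 \<le> norm_F_on \<Omega> A"
  by (simp_all add: norm_F_def norm_F_on_def)

lemma norm_F_square_rows: "A \<in> carrier_mat n k \<Longrightarrow> (norm_F A)\<^sup>2 = (\<Sum>i<n. (vnorm (row A i))\<^sup>2)"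
  by (simp add: norm_F_square vnorm_def L2_set_def sum_nonneg)

lemma norm_F_square_cols: "A \<in> carrier_mat n k \<Longrightarrow> (norm_F A)\<^sup>2 = (\<Sum>j<k. (vnorm (col A j))\<^sup>2)"
  by (simp add: norm_F_square vnorm_def L2_set_def sum_nonneg) (rule sum.swap)

lemma norm_F_transpose: "norm_F (transpose_mat A) = norm_F A"
proof -
  have "(norm_F (transpose_mat A))\<^sup>2 = (norm_F A)\<^sup>2"
    using norm_F_square_rows[of A "dim_row A" "dim_col A"]
      norm_F_square_cols[of "transpose_mat A" "dim_col A" "dim_row A"] by simp
  then show ?thesis by (simp add: power2_eq_iff_nonneg)
qed

lemma norm_F_on_add_le:
  assumes "A \<in> carrier_mat n k" "B \<in> carrier_mat n k" "\<Omega> \<subseteq> {..<n} \<times> {..<k}"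
  shows "norm_F_on \<Omega> (A + B) \<le> norm_F_on \<Omega> A + norm_F_on \<Omega> B"
proof -
  have "norm_F_on \<Omega> (A + B) = L2_set (\<lambda>ij. A $$ ij + B $$ ij) \<Omega>"
    using assms unfolding norm_F_on_def by (intro L2_set_cong) auto
  then show ?thesis by (simp add: norm_F_on_def L2_set_triangle_ineq)
qed

lemma norm_F_on_uminus:
  assumes "A \<in> carrier_mat n k" "\<Omega> \<subseteq> {..<n} \<times> {..<k}"
  shows "norm_F_on \<Omega> (- A) = norm_F_on \<Omega> A"
proof -
  have "norm_F_on \<Omega> (- A) = L2_set (\<lambda>ij. - (A $$ ij)) \<Omega>"
    using assms unfolding norm_F_on_def by (intro L2_set_cong) auto
  then show ?thesis by (simp add: norm_F_on_def L2_set_def)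
qed

lemma norm_F_on_diff_le:
  assumes "A \<in> carrier_mat n k" "B \<in> carrier_mat n k" "\<Omega> \<subseteq> {..<n} \<times> {..<k}"
  shows "norm_F_on \<Omega> (A - B) \<le> norm_F_on \<Omega> A + norm_F_on \<Omega> B"
  using norm_F_on_add_le[of A n k "- B" \<Omega>] norm_F_on_uminus[of B n k \<Omega>] assms
  by (simp add: minus_add_uminus_mat)

lemma norm_F_eq_on: "A \<in> carrier_mat n k \<Longrightarrow> norm_F A = norm_F_on ({..<n} \<times> {..<k}) A"
  by (auto simp: norm_F_def)

lemma norm_F_add_le:
  assumes "A \<in> carrier_mat n k" "B \<in> carrier_mat n k"
  shows "norm_F (A + B) \<le> norm_F A + norm_F B"
  using norm_F_on_add_le[OF assms order_refl] assms by (simp add: norm_F_eq_on[of _ n k])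

lemma norm_F_diff_le:
  assumes "A \<in> carrier_mat n k" "B \<in> carrier_mat n k"
  shows "norm_F (A - B) \<le> norm_F A + norm_F B"
  using norm_F_on_diff_le[OF assms order_refl] assms
  by (simp add: norm_F_eq_on[of _ n k] minus_carrier_mat)

text \<open>A bound on the operator norm as a predicate, so that no supremum has to be formed;
  \<open>op_ge\<close> bounds the smallest stretching factor from below in the same way.\<close>

definition op_le :: "real mat \<Rightarrow> real \<Rightarrow> bool" where
  "op_le A c \<longleftrightarrow> (\<forall>v\<in>carrier_vec (dim_col A). vnorm (A *\<^sub>v v) \<le> c * vnorm v)"

definition op_ge :: "real mat \<Rightarrow> real \<Rightarrow> bool" where
  "op_ge A c \<longleftrightarrow> (\<forall>v\<in>carrier_vec (dim_col A). c * vnorm v \<le> vnorm (A *\<^sub>v v))"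

lemma op_leI:
  "A \<in> carrier_mat n k \<Longrightarrow> (\<And>v. v \<in> carrier_vec k \<Longrightarrow> vnorm (A *\<^sub>v v) \<le> c * vnorm v) \<Longrightarrow> op_le A c"
  by (auto simp: op_le_def)

lemma op_geI:
  "A \<in> carrier_mat n k \<Longrightarrow> (\<And>v. v \<in> carrier_vec k \<Longrightarrow> c * vnorm v \<le> vnorm (A *\<^sub>v v)) \<Longrightarrow> op_ge A c"
  by (auto simp: op_ge_def)

lemma op_leD: "op_le A c \<Longrightarrow> A \<in> carrier_mat n k \<Longrightarrow> v \<in> carrier_vec k \<Longrightarrow> vnorm (A *\<^sub>v v) \<le> c * vnorm v"
  by (auto simp: op_le_def)

lemma op_geD: "op_ge A c \<Longrightarrow> A \<in> carrier_mat n k \<Longrightarrow> v \<in> carrier_vec k \<Longrightarrow> c * vnorm v \<le> vnorm (A *\<^sub>v v)"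
  by (auto simp: op_ge_def)

lemma op_le_mono: "op_le A c \<Longrightarrow> c \<le> d \<Longrightarrow> op_le A d"
  unfolding op_le_def by (meson mult_right_mono order_trans vnorm_nonneg)

lemma vnorm_mult_mat_vec_le:
  assumes A: "A \<in> carrier_mat n k" and v: "v \<in> carrier_vec k"
  shows "vnorm (A *\<^sub>v v) \<le> norm_F A * vnorm v"
proof -
  have "(vnorm (A *\<^sub>v v))\<^sup>2 = (\<Sum>i<n. (row A i \<bullet> v)\<^sup>2)"
    using A by (simp add: vnorm_def L2_set_def sum_nonneg)
  also have "\<dots> \<le> (\<Sum>i<n. (vnorm (row A i))\<^sup>2 * (vnorm v)\<^sup>2)"
  proof (rule sum_mono)
    fix i assume "i \<in> {..<n}"
    then have "\<bar>row A i \<bullet> v\<bar> \<le> vnorm (row A i) * vnorm v"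
      using A v by (intro abs_scalar_prod_le[of _ k]) auto
    then have "\<bar>row A i \<bullet> v\<bar>\<^sup>2 \<le> (vnorm (row A i) * vnorm v)\<^sup>2" by (rule power_mono) simp
    then show "(row A i \<bullet> v)\<^sup>2 \<le> (vnorm (row A i))\<^sup>2 * (vnorm v)\<^sup>2"
      by (simp add: power_mult_distrib)
  qed
  also have "\<dots> = (norm_F A * vnorm v)\<^sup>2"
    using A by (simp add: norm_F_square_rows power_mult_distrib sum_distrib_right)
  finally show ?thesis by (rule power2_le_imp_le) simp
qed

lemma op_le_norm_F: "op_le A (norm_F A)"
  using vnorm_mult_mat_vec_le[of A "dim_row A" "dim_col A"] by (auto simp: op_le_def)

text \<open>\<open>|A^T w|^2\<close> equals \<open><A A^T w, w>\<close>, to which Cauchy-Schwarz and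
  the bound for \<open>A\<close> apply; one factor \<open>|A^T w|\<close> cancels.\<close>

lemma op_le_transpose:
  assumes "op_le A c" "0 \<le> c"
  shows "op_le (transpose_mat A) c"
proof (rule op_leI)
  let ?n = "dim_row A" and ?k = "dim_col A"
  have A: "A \<in> carrier_mat ?n ?k" by simp
  show "transpose_mat A \<in> carrier_mat ?k ?n" by simp
  fix w :: "real vec" assume w: "w \<in> carrier_vec ?n"
  let ?a = "transpose_mat A *\<^sub>v w"
  have a: "?a \<in> carrier_vec ?k"
    by (rule mult_mat_vec_carrier[OF _ w]) simp
  have "(vnorm ?a)\<^sup>2 = (A *\<^sub>v ?a) \<bullet> w"
    using transpose_vec_mult_scalar[OF A a w] comm_scalar_prod[OF w, of "A *\<^sub>v ?a"]
      mult_mat_vec_carrier[OF A a] by (simp add: vnorm_square)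
  also have "\<dots> \<le> vnorm (A *\<^sub>v ?a) * vnorm w"
    using abs_scalar_prod_le[OF mult_mat_vec_carrier[OF A a] w] by linarith
  also have "\<dots> \<le> (c * vnorm ?a) * vnorm w"
    using op_leD[OF assms(1) A a] by (intro mult_right_mono) auto
  finally have le: "vnorm ?a * vnorm ?a \<le> (c * vnorm w) * vnorm ?a"
    by (simp add: power2_eq_square mult_ac)
  show "vnorm ?a \<le> c * vnorm w"
  proof (cases "vnorm ?a = 0")
    case False
    then have "0 < vnorm ?a" using vnorm_nonneg[of ?a] by linarith
    then show ?thesis using le by (simp add: mult_le_cancel_right)
  qed (use assms in simp)
qed

lemma op_le_mult:
  assumes "op_le A c" "op_le B d" "A \<in> carrier_mat n k" "B \<in> carrier_mat k l" "0 \<le> c"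
  shows "op_le (A * B) (c * d)"
proof (rule op_leI)
  fix v :: "real vec" assume v: "v \<in> carrier_vec l"
  have "vnorm (A * B *\<^sub>v v) = vnorm (A *\<^sub>v (B *\<^sub>v v))" using assms v by simp
  also have "\<dots> \<le> c * vnorm (B *\<^sub>v v)"
    using assms v by (intro op_leD[OF assms(1,3)]) auto
  also have "\<dots> \<le> c * (d * vnorm v)" using assms v by (intro mult_left_mono op_leD[OF assms(2,4)]) auto
  finally show "vnorm (A * B *\<^sub>v v) \<le> c * d * vnorm v" by simp
qed (use assms in auto)

lemma norm_F_square_mult:
  assumes A: "A \<in> carrier_mat n k" and B: "B \<in> carrier_mat k l"
  shows "(norm_F (A * B))\<^sup>2 = (\<Sum>j<l. (vnorm (A *\<^sub>v col B j))\<^sup>2)"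
  unfolding norm_F_square_cols[OF mult_carrier_mat[OF A B]]
  by (intro sum.cong refl) (simp only: lessThan_iff col_mult2[OF A B])

lemma norm_F_mult_le:
  assumes "op_le A c" "A \<in> carrier_mat n k" "B \<in> carrier_mat k l" "0 \<le> c"
  shows "norm_F (A * B) \<le> c * norm_F B"
proof -
  have "(norm_F (A * B))\<^sup>2 = (\<Sum>j<l. (vnorm (A *\<^sub>v col B j))\<^sup>2)"
    by (rule norm_F_square_mult[OF assms(2,3)])
  also have "\<dots> \<le> (\<Sum>j<l. (c * vnorm (col B j))\<^sup>2)"
    using assms by (intro sum_mono power_mono op_leD[OF assms(1,2)]) auto
  also have "\<dots> = (c * norm_F B)\<^sup>2"
    using assms by (simp add: norm_F_square_cols[of B k l] power_mult_distrib sum_distrib_left)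
  finally show ?thesis by (rule power2_le_imp_le) (use assms in simp)
qed

lemma norm_F_mult_ge:
  assumes "op_ge A c" "A \<in> carrier_mat n k" "B \<in> carrier_mat k l" "0 \<le> c"
  shows "c * norm_F B \<le> norm_F (A * B)"
proof -
  have "(c * norm_F B)\<^sup>2 = (\<Sum>j<l. (c * vnorm (col B j))\<^sup>2)"
    using assms by (simp add: norm_F_square_cols[of B k l] power_mult_distrib sum_distrib_left)
  also have "\<dots> \<le> (\<Sum>j<l. (vnorm (A *\<^sub>v col B j))\<^sup>2)"
    using assms by (intro sum_mono power_mono op_geD[OF assms(1,2)]) auto
  also have "\<dots> = (norm_F (A * B))\<^sup>2"
    by (rule sym, rule norm_F_square_mult[OF assms(2,3)])
  finally show ?thesis by (rule power2_le_imp_le) simp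
qed

lemma norm_F_mult_transpose_le:
  assumes "op_le A c" "A \<in> carrier_mat n k" "B \<in> carrier_mat l k" "0 \<le> c"
  shows "norm_F (B * transpose_mat A) \<le> c * norm_F B"
proof -
  have "norm_F (B * transpose_mat A) = norm_F (A * transpose_mat B)"
    using assms norm_F_transpose[of "A * transpose_mat B"]
    by (simp add: transpose_mult[of A n k "transpose_mat B" l])
  also have "\<dots> \<le> c * norm_F B"
    using assms norm_F_mult_le[of A c n k "transpose_mat B" l] by (simp add: norm_F_transpose)
  finally show ?thesis .
qed

lemma norm_F_mult_transpose_ge:
  assumes "op_ge A c" "A \<in> carrier_mat n k" "B \<in> carrier_mat l k" "0 \<le> c"
  shows "c * norm_F B \<le> norm_F (B * transpose_mat A)"
proof -
  have "c * norm_F B \<le> norm_F (A * transpose_mat B)"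
    using assms norm_F_mult_ge[of A c n k "transpose_mat B" l] by (simp add: norm_F_transpose)
  also have "\<dots> = norm_F (B * transpose_mat A)"
    using assms norm_F_transpose[of "A * transpose_mat B"]
    by (simp add: transpose_mult[of A n k "transpose_mat B" l])
  finally show ?thesis .
qed

section \<open>Orthonormal columns and orthogonal projections\<close>

lemma vnorm_orthonormal:
  assumes P: "P \<in> carrier_mat n r" "transpose_mat P * P = 1\<^sub>m r" and v: "v \<in> carrier_vec r"
  shows "vnorm (P *\<^sub>v v) = vnorm v"
proof -
  have "(P *\<^sub>v v) \<bullet> (P *\<^sub>v v) = v \<bullet> (transpose_mat P *\<^sub>v (P *\<^sub>v v))"
    using P v transpose_vec_mult_scalar[of "transpose_mat P" r n "P *\<^sub>v v" v] by simp
  also have "transpose_mat P *\<^sub>v (P *\<^sub>v v) = v"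
    using P v assoc_mult_mat_vec[of "transpose_mat P" r n P r v] by simp
  finally have "(vnorm (P *\<^sub>v v))\<^sup>2 = (vnorm v)\<^sup>2" by (simp add: vnorm_square)
  then show ?thesis by (simp add: power2_eq_iff_nonneg)
qed

lemma op_le_orthonormal:
  assumes "P \<in> carrier_mat n r" "transpose_mat P * P = 1\<^sub>m r"
  shows "op_le P 1"
  using assms by (intro op_leI[of P n r]) (auto simp: vnorm_orthonormal)

lemma vnorm_complement:
  assumes P: "P \<in> carrier_mat n r" "transpose_mat P * P = 1\<^sub>m r" and v: "v \<in> carrier_vec n"
  shows "(vnorm v)\<^sup>2 = (vnorm (transpose_mat P *\<^sub>v v))\<^sup>2
      + (vnorm (v - P *\<^sub>v (transpose_mat P *\<^sub>v v)))\<^sup>2"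
proof -
  let ?a = "transpose_mat P *\<^sub>v v"
  let ?w = "P *\<^sub>v ?a"
  have a: "?a \<in> carrier_vec r" and w: "?w \<in> carrier_vec n" using P v by auto
  have ww: "?w \<bullet> ?w = ?a \<bullet> ?a"
    using vnorm_orthonormal[OF P a] by (simp flip: vnorm_square)
  have vw: "v \<bullet> ?w = ?a \<bullet> ?a" using transpose_vec_mult_scalar[OF P(1) a v] by simp
  have wv: "?w \<bullet> v = ?a \<bullet> ?a" using vw comm_scalar_prod[OF v w] by simp
  have "(v - ?w) \<bullet> (v - ?w) = v \<bullet> v - ?a \<bullet> ?a"
    using v w by (simp add: minus_scalar_prod_distrib[of v n ?w] scalar_prod_minus_distrib[of _ n v ?w] ww wv vw)
  then show ?thesis by (simp add: vnorm_square)
qed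

lemma col_minus:
  assumes "A \<in> carrier_mat n k" "B \<in> carrier_mat n k" "j < k"
  shows "col (A - B) j = col A j - col B j"
  using assms by (intro eq_vecI) auto

lemma norm_F_complement:
  assumes P: "P \<in> carrier_mat n r" "transpose_mat P * P = 1\<^sub>m r" and A: "A \<in> carrier_mat n k"
  shows "(norm_F A)\<^sup>2 = (norm_F (transpose_mat P * A))\<^sup>2
      + (norm_F (A - P * (transpose_mat P * A)))\<^sup>2"
proof -
  have c1: "transpose_mat P * A \<in> carrier_mat r k" using P A by simp
  then have c2: "P * (transpose_mat P * A) \<in> carrier_mat n k" using P by simp
  have col1: "col (transpose_mat P * A) j = transpose_mat P *\<^sub>v col A j" if "j < k" for j
    by (rule col_mult2[OF _ A that, of _ r]) (use P in simp)
  have col2: "col (A - P * (transpose_mat P * A)) j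
      = col A j - P *\<^sub>v (transpose_mat P *\<^sub>v col A j)" if "j < k" for j
  proof -
    have "col (P * (transpose_mat P * A)) j = P *\<^sub>v col (transpose_mat P * A) j"
      by (rule col_mult2[OF P(1) c1 that])
    moreover have "col (A - P * (transpose_mat P * A)) j = col A j - col (P * (transpose_mat P * A)) j"
      by (rule col_minus[OF A c2 that])
    ultimately show ?thesis by (simp only: col1[OF that])
  qed
  show ?thesis
    unfolding norm_F_square_cols[OF A] norm_F_square_cols[OF c1]
      norm_F_square_cols[OF minus_carrier_mat[OF c2]]
    using A by (simp add: col1 col2 vnorm_complement[OF P] sum.distrib)
qed

section \<open>Alignment with a factorization of the target\<close>

lemma add_diff_cancel_vec:
  fixes u v :: "real vec"
  assumes "u \<in> carrier_vec n" "v \<in> carrier_vec n"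
  shows "u = (u + v) - v"
  using assms by (intro eq_vecI) auto

lemma ex_inverse_of_injective:
  fixes A :: "real mat"
  assumes A: "A \<in> carrier_mat n n" and inj: "\<And>v. v \<in> carrier_vec n \<Longrightarrow> A *\<^sub>v v = 0\<^sub>v n \<Longrightarrow> v = 0\<^sub>v n"
  shows "\<exists>B\<in>carrier_mat n n. A * B = 1\<^sub>m n \<and> B * A = 1\<^sub>m n"
proof -
  have "det A \<noteq> 0" using inj det_0_iff_vec_prod_zero_field[OF A] by blast
  from det_non_zero_imp_unit[OF A this] show ?thesis
    by (auto simp: Units_def ring_mat_def)
qed

lemma op_ge_inverse:
  assumes "op_ge A c" "0 < c" "A \<in> carrier_mat n n"
  shows "\<exists>B\<in>carrier_mat n n. A * B = 1\<^sub>m n \<and> B * A = 1\<^sub>m n \<and> op_le B (1 / c)"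
proof -
  have "v = 0\<^sub>v n" if "v \<in> carrier_vec n" "A *\<^sub>v v = 0\<^sub>v n" for v
  proof -
    have "c * vnorm v \<le> vnorm (0\<^sub>v n)" using op_geD[OF assms(1,3) that(1)] that(2) by simp
    also have "vnorm (0\<^sub>v n) = 0" by (simp add: vnorm_def L2_set_def)
    finally have "vnorm v \<le> 0" using assms(2) by (simp add: mult_le_0_iff)
    then have "vnorm v = 0" using vnorm_nonneg[of v] by linarith
    then show ?thesis using that(1) vnorm_eq_0D by blast
  qed
  then obtain B where B: "B \<in> carrier_mat n n" "A * B = 1\<^sub>m n" "B * A = 1\<^sub>m n"
    using ex_inverse_of_injective[OF assms(3)] by blast
  have "op_le B (1 / c)"
  proof (rule op_leI[OF B(1)])
    fix v :: "real vec" assume v: "v \<in> carrier_vec n"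
    have "A *\<^sub>v (B *\<^sub>v v) = A * B *\<^sub>v v" by (rule assoc_mult_mat_vec[symmetric, OF assms(3) B(1) v])
    then have "A *\<^sub>v (B *\<^sub>v v) = v" using v B by simp
    moreover have "c * vnorm (B *\<^sub>v v) \<le> vnorm (A *\<^sub>v (B *\<^sub>v v))"
      using B v by (intro op_geD[OF assms(1,3)]) auto
    ultimately show "vnorm (B *\<^sub>v v) \<le> 1 / c * vnorm v" using assms(2) by (simp add: field_simps)
  qed
  then show ?thesis using B by blast
qed

lemma vnorm_Gram:
  assumes "U \<in> carrier_mat n r" "z \<in> carrier_vec r"
  shows "(vnorm (U *\<^sub>v z))\<^sup>2 = z \<bullet> (U\<^sup>T * U *\<^sub>v z)"
proof -
  have "U *\<^sub>v z \<in> carrier_vec n" using assms by simp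
  from transpose_vec_mult_scalar[OF assms this]
  have "(U *\<^sub>v z) \<bullet> (U *\<^sub>v z) = (U\<^sup>T *\<^sub>v (U *\<^sub>v z)) \<bullet> z" by simp
  also have "U\<^sup>T *\<^sub>v (U *\<^sub>v z) = U\<^sup>T * U *\<^sub>v z"
    using assms by (intro assoc_mult_mat_vec[symmetric, of _ r n _ r]) auto
  also have "(U\<^sup>T * U *\<^sub>v z) \<bullet> z = z \<bullet> (U\<^sup>T * U *\<^sub>v z)"
    using assms by (intro comm_scalar_prod[of _ r] mult_mat_vec_carrier[of _ r r] mult_carrier_mat[of _ r n]) auto
  finally show ?thesis by (simp add: vnorm_square)
qed

lemma imbalance_vnorm_le:
  assumes U: "U \<in> carrier_mat n1 r" and V: "V \<in> carrier_mat n2 r" and z: "z \<in> carrier_vec r"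
  shows "\<bar>(vnorm (U *\<^sub>v z))\<^sup>2 - (vnorm (V *\<^sub>v z))\<^sup>2\<bar> \<le> norm_F (U\<^sup>T * U - V\<^sup>T * V) * (vnorm z)\<^sup>2"
proof -
  let ?G = "U\<^sup>T * U - V\<^sup>T * V"
  have c: "U\<^sup>T * U \<in> carrier_mat r r" "V\<^sup>T * V \<in> carrier_mat r r"
    using U V by (auto intro: mult_carrier_mat)
  have G: "?G \<in> carrier_mat r r" using c by (simp add: minus_carrier_mat)
  have v: "U\<^sup>T * U *\<^sub>v z \<in> carrier_vec r" "V\<^sup>T * V *\<^sub>v z \<in> carrier_vec r" "?G *\<^sub>v z \<in> carrier_vec r"
    using c G z by (auto intro: mult_mat_vec_carrier)
  have "(vnorm (U *\<^sub>v z))\<^sup>2 - (vnorm (V *\<^sub>v z))\<^sup>2 = z \<bullet> (?G *\<^sub>v z)"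
    unfolding vnorm_Gram[OF U z] vnorm_Gram[OF V z] minus_mult_distrib_mat_vec[OF c z]
    by (rule scalar_prod_minus_distrib[OF z v(1,2), symmetric])
  then have "\<bar>(vnorm (U *\<^sub>v z))\<^sup>2 - (vnorm (V *\<^sub>v z))\<^sup>2\<bar> \<le> vnorm z * vnorm (?G *\<^sub>v z)"
    using abs_scalar_prod_le[OF z v(3)] by simp
  also have "\<dots> \<le> vnorm z * (norm_F ?G * vnorm z)"
    by (intro mult_left_mono vnorm_mult_mat_vec_le[OF G z]) simp
  finally show ?thesis by (simp add: power2_eq_square mult_ac)
qed

text \<open>Balance lets a bound on the product control a single factor. With
  \<open>t = |U^T w|^2\<close> and \<open>q = |w|^2\<close>, Cauchy-Schwarz gives
  \<open>t^2 \<le> q |U U^T w|^2\<close>, and balance replaces the outer \<open>U\<close> by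
  \<open>V\<close>, so that the product \<open>V U^T\<close> appears. If \<open>t\<close> exceeded
  \<open>2 * s * q\<close>, the resulting right-hand side would stay below
  \<open>t^2\<close>.\<close>

lemma balanced_op_le:
  assumes U: "U \<in> carrier_mat n1 r" and V: "V \<in> carrier_mat n2 r"
    and le: "op_le (V * U\<^sup>T) c" and c: "0 \<le> c" "c \<le> 17 / 16 * s" and d: "d \<le> s / 8" and s: "0 < s"
    and bal: "\<And>z. z \<in> carrier_vec r \<Longrightarrow> (vnorm (U *\<^sub>v z))\<^sup>2 \<le> (vnorm (V *\<^sub>v z))\<^sup>2 + d * (vnorm z)\<^sup>2"
  shows "op_le U\<^sup>T (sqrt (2 * s))"
proof (rule op_leI)
  show "U\<^sup>T \<in> carrier_mat r n1" using U by simp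
  fix w :: "real vec" assume w: "w \<in> carrier_vec n1"
  define a where "a = U\<^sup>T *\<^sub>v w"
  have a: "a \<in> carrier_vec r" using U w by (auto simp: a_def intro: mult_mat_vec_carrier)
  have Ua: "U *\<^sub>v a \<in> carrier_vec n1" using U a by (auto intro: mult_mat_vec_carrier)
  define t where "t = (vnorm a)\<^sup>2"
  define q where "q = (vnorm w)\<^sup>2"
  have t0: "0 \<le> t" and q0: "0 \<le> q" by (simp_all add: t_def q_def)
  have "V *\<^sub>v a = V * U\<^sup>T *\<^sub>v w"
    unfolding a_def using U V w by (intro assoc_mult_mat_vec[symmetric, of V n2 r _ n1]) auto
  moreover have "vnorm (V * U\<^sup>T *\<^sub>v w) \<le> c * vnorm w"
    using U V w by (intro op_leD[OF le, of n2 n1] mult_carrier_mat) auto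
  ultimately have "vnorm (V *\<^sub>v a) \<le> c * vnorm w" by simp
  then have "(vnorm (V *\<^sub>v a))\<^sup>2 \<le> (c * vnorm w)\<^sup>2" by (rule power_mono) simp
  also have "\<dots> = c\<^sup>2 * q" by (simp add: power_mult_distrib q_def)
  also have "\<dots> \<le> (17 / 16 * s)\<^sup>2 * q" by (rule mult_right_mono[OF power_mono[OF c(2,1)] q0])
  finally have Va: "(vnorm (V *\<^sub>v a))\<^sup>2 \<le> (17 / 16 * s)\<^sup>2 * q" .
  have "d * t \<le> s / 8 * t" using d t0 by (rule mult_right_mono)
  then have Uab: "(vnorm (U *\<^sub>v a))\<^sup>2 \<le> (17 / 16 * s)\<^sup>2 * q + s / 8 * t"
    using bal[OF a] Va unfolding t_def by linarith
  have "t = w \<bullet> (U *\<^sub>v a)"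
    using transpose_vec_mult_scalar[OF U a w] by (simp add: t_def vnorm_square a_def)
  then have "t \<le> vnorm w * vnorm (U *\<^sub>v a)" using abs_scalar_prod_le[OF w Ua] by linarith
  then have "t\<^sup>2 \<le> (vnorm w * vnorm (U *\<^sub>v a))\<^sup>2" using t0 by (intro power_mono) auto
  also have "\<dots> = q * (vnorm (U *\<^sub>v a))\<^sup>2" by (simp add: power_mult_distrib q_def)
  also have "\<dots> \<le> q * ((17 / 16 * s)\<^sup>2 * q + s / 8 * t)" using Uab q0 by (rule mult_left_mono)
  finally have tt: "t\<^sup>2 \<le> q * ((17 / 16 * s)\<^sup>2 * q + s / 8 * t)" .
  have "t \<le> 2 * s * q"
  proof (rule ccontr)
    assume "\<not> ?thesis"
    then have gt: "2 * (s * q) < t" by simp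
    have sq: "0 \<le> s * q" using s q0 by simp
    have "(17 / 16)\<^sup>2 * (s * q)\<^sup>2 \<le> (17 / 16)\<^sup>2 * (t / 2)\<^sup>2"
      using gt sq by (intro mult_left_mono power_mono) auto
    moreover have "1 / 8 * (s * q) * t \<le> 1 / 8 * (t / 2) * t"
      using gt t0 by (intro mult_right_mono mult_left_mono) auto
    moreover have "q * ((17 / 16 * s)\<^sup>2 * q + s / 8 * t) = (17 / 16)\<^sup>2 * (s * q)\<^sup>2 + 1 / 8 * (s * q) * t"
      by (simp add: power2_eq_square algebra_simps)
    ultimately have "t\<^sup>2 \<le> (17 / 16)\<^sup>2 * (t / 2)\<^sup>2 + 1 / 8 * (t / 2) * t" using tt by linarith
    then have "t\<^sup>2 \<le> 0" by (simp add: power2_eq_square)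
    moreover have "0 < t\<^sup>2" using gt sq by simp
    ultimately show False by linarith
  qed
  then have "(vnorm a)\<^sup>2 \<le> (sqrt (2 * s) * vnorm w)\<^sup>2"
    using s by (simp add: t_def q_def power_mult_distrib)
  then show "vnorm (U\<^sup>T *\<^sub>v w) \<le> sqrt (2 * s) * vnorm w"
    unfolding a_def[symmetric] by (rule power2_le_imp_le) (use s in simp)
qed

lemma orthonormal_cancel:
  fixes P A :: "real mat"
  assumes "P \<in> carrier_mat n r" "P\<^sup>T * P = 1\<^sub>m r" "A \<in> carrier_mat r k"
  shows "P\<^sup>T * (P * A) = A"
proof -
  have "P\<^sup>T * (P * A) = P\<^sup>T * P * A"
    using assms by (intro assoc_mult_mat[symmetric, of _ r n _ r _ k]) auto
  then show ?thesis using assms left_mult_one_mat[OF assms(3)] by simp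
qed

text \<open>The compact singular value decomposition seen through operator bounds: a symmetric core
  \<open>S\<close> that stretches vectors by factors between \<open>\<sigma>\<close> and
  \<open>\<sigma>1\<close>.\<close>

locale target =
  fixes n1 n2 r :: nat and P S W Xs :: "real mat" and \<sigma>1 \<sigma> :: real
  assumes P: "P \<in> carrier_mat n1 r" and S: "S \<in> carrier_mat r r" and W: "W \<in> carrier_mat n2 r"
    and PP: "P\<^sup>T * P = 1\<^sub>m r" and WW: "W\<^sup>T * W = 1\<^sub>m r"
    and Xs: "Xs = P * S * W\<^sup>T" and S_sym: "S\<^sup>T = S"
    and S_le: "op_le S \<sigma>1" and S_ge: "op_ge S \<sigma>" and \<sigma>: "0 < \<sigma>" "\<sigma> \<le> \<sigma>1"
begin

lemma Xs_carrier: "Xs \<in> carrier_mat n1 n2"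
  using P S W by (simp add: Xs)

lemma PT_Xs: "P\<^sup>T * Xs = S * W\<^sup>T"
proof -
  have "Xs = P * (S * W\<^sup>T)"
    unfolding Xs using P S W by (intro assoc_mult_mat[of _ n1 r _ r _ n2]) auto
  then show ?thesis using P S W PP by (simp add: orthonormal_cancel[of P n1 r "S * W\<^sup>T" n2])
qed

lemma op_le_Xs: "op_le Xs \<sigma>1"
proof -
  have W1: "op_le W\<^sup>T 1" by (rule op_le_transpose[OF op_le_orthonormal[OF W WW]]) simp
  have "op_le (P * S) (1 * \<sigma>1)" by (rule op_le_mult[OF op_le_orthonormal[OF P PP] S_le P S]) simp
  then have "op_le (P * S * W\<^sup>T) (1 * \<sigma>1 * 1)"
    using P S W \<sigma> by (intro op_le_mult[OF _ W1, of _ _ n1 r n2]) auto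
  then show ?thesis by (simp add: Xs)
qed

end

text \<open>Error and imbalance are measured against the smallest singular value, so that the
  compressed product \<open>P^T U V^T W\<close> stays invertible.\<close>

locale near_target = target +
  fixes U V :: "real mat"
  assumes U: "U \<in> carrier_mat n1 r" and V: "V \<in> carrier_mat n2 r"
    and err: "norm_F (U * V\<^sup>T - Xs) \<le> \<sigma> / 16"
    and bal: "norm_F (U\<^sup>T * U - V\<^sup>T * V) \<le> \<sigma> / 8"
begin

definition E :: "real mat" where "E = U * V\<^sup>T - Xs"

lemma UV_carrier: "U * V\<^sup>T \<in> carrier_mat n1 n2"
  using U V by simp

lemma E_carrier: "E \<in> carrier_mat n1 n2"
  using Xs_carrier by (simp add: E_def minus_carrier_mat)

lemma UV_eq: "U * V\<^sup>T = Xs + E"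
proof (rule eq_matI)
  fix i j assume "i < dim_row (Xs + E)" "j < dim_col (Xs + E)"
  then have "i < n1" "j < n2" using E_carrier by auto
  then show "(U * V\<^sup>T) $$ (i, j) = (Xs + E) $$ (i, j)"
    using UV_carrier Xs_carrier by (simp add: E_def del: index_mult_mat)
qed (use UV_carrier E_carrier in auto)

lemma imbalance:
  assumes "z \<in> carrier_vec r"
  shows "(vnorm (U *\<^sub>v z))\<^sup>2 \<le> (vnorm (V *\<^sub>v z))\<^sup>2 + \<sigma> / 8 * (vnorm z)\<^sup>2"
    and "(vnorm (V *\<^sub>v z))\<^sup>2 \<le> (vnorm (U *\<^sub>v z))\<^sup>2 + \<sigma> / 8 * (vnorm z)\<^sup>2"
proof -
  have "\<bar>(vnorm (U *\<^sub>v z))\<^sup>2 - (vnorm (V *\<^sub>v z))\<^sup>2\<bar> \<le> \<sigma> / 8 * (vnorm z)\<^sup>2"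
    using imbalance_vnorm_le[OF U V assms] mult_right_mono[OF bal zero_le_power2[of "vnorm z"]] by linarith
  from abs_le_D1[OF this] abs_le_D2[OF this]
  show "(vnorm (U *\<^sub>v z))\<^sup>2 \<le> (vnorm (V *\<^sub>v z))\<^sup>2 + \<sigma> / 8 * (vnorm z)\<^sup>2"
    and "(vnorm (V *\<^sub>v z))\<^sup>2 \<le> (vnorm (U *\<^sub>v z))\<^sup>2 + \<sigma> / 8 * (vnorm z)\<^sup>2" by linarith+
qed

lemma op_le_UV: "op_le (U * V\<^sup>T) (17 / 16 * \<sigma>1)"
proof (rule op_leI[OF UV_carrier])
  fix v :: "real vec" assume v: "v \<in> carrier_vec n2"
  have "(Xs + E) *\<^sub>v v = Xs *\<^sub>v v + E *\<^sub>v v"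
    by (rule add_mult_distrib_mat_vec[OF Xs_carrier E_carrier v])
  then have "vnorm (U * V\<^sup>T *\<^sub>v v) \<le> vnorm (Xs *\<^sub>v v) + vnorm (E *\<^sub>v v)"
    unfolding UV_eq using vnorm_add_le[OF mult_mat_vec_carrier[OF Xs_carrier v] mult_mat_vec_carrier[OF E_carrier v]]
    by simp
  also have "\<dots> \<le> \<sigma>1 * vnorm v + \<sigma> / 16 * vnorm v"
  proof (rule add_mono)
    show "vnorm (Xs *\<^sub>v v) \<le> \<sigma>1 * vnorm v" by (rule op_leD[OF op_le_Xs Xs_carrier v])
    have "vnorm (E *\<^sub>v v) \<le> norm_F E * vnorm v" by (rule vnorm_mult_mat_vec_le[OF E_carrier v])
    also have "\<dots> \<le> \<sigma> / 16 * vnorm v" using err by (intro mult_right_mono) (auto simp: E_def)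
    finally show "vnorm (E *\<^sub>v v) \<le> \<sigma> / 16 * vnorm v" .
  qed
  also have "\<dots> \<le> 17 / 16 * \<sigma>1 * vnorm v"
    using mult_right_mono[OF \<sigma>(2), of "vnorm v"] by simp
  finally show "vnorm (U * V\<^sup>T *\<^sub>v v) \<le> 17 / 16 * \<sigma>1 * vnorm v" .
qed

lemma op_le_UT: "op_le U\<^sup>T (sqrt (2 * \<sigma>1))" and op_le_VT: "op_le V\<^sup>T (sqrt (2 * \<sigma>1))"
proof -
  have "op_le (U * V\<^sup>T)\<^sup>T (17 / 16 * \<sigma>1)" using \<sigma> by (intro op_le_transpose op_le_UV) auto
  moreover have "(U * V\<^sup>T)\<^sup>T = V * U\<^sup>T" using U V by (simp add: transpose_mult[of U n1 r "V\<^sup>T" n2])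
  ultimately have VU: "op_le (V * U\<^sup>T) (17 / 16 * \<sigma>1)" by simp
  show "op_le U\<^sup>T (sqrt (2 * \<sigma>1))"
    using \<sigma> by (intro balanced_op_le[OF U V VU, of \<sigma>1 "\<sigma> / 8"] imbalance) auto
  show "op_le V\<^sup>T (sqrt (2 * \<sigma>1))"
    using \<sigma> by (intro balanced_op_le[OF V U op_le_UV, of \<sigma>1 "\<sigma> / 8"] imbalance) auto
qed

lemma op_le_U: "op_le U (sqrt (2 * \<sigma>1))" and op_le_V: "op_le V (sqrt (2 * \<sigma>1))"
  using op_le_transpose[OF op_le_UT] op_le_transpose[OF op_le_VT] \<sigma> by simp_all

text \<open>\<open>P^T U V^T W\<close> is \<open>S\<close> plus a compression of the error, a
  perturbation of norm at most \<open>\<sigma> / 16\<close>.\<close>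

lemma vnorm_core_ge:
  assumes w: "w \<in> carrier_vec r"
  shows "15 / 16 * \<sigma> * vnorm w \<le> vnorm (P\<^sup>T *\<^sub>v (U *\<^sub>v (V\<^sup>T *\<^sub>v (W *\<^sub>v w))))"
proof -
  have Ww: "W *\<^sub>v w \<in> carrier_vec n2" using W w by (auto intro: mult_mat_vec_carrier)
  have EW: "E *\<^sub>v (W *\<^sub>v w) \<in> carrier_vec n1" by (rule mult_mat_vec_carrier[OF E_carrier Ww])
  have XW: "Xs *\<^sub>v (W *\<^sub>v w) \<in> carrier_vec n1" by (rule mult_mat_vec_carrier[OF Xs_carrier Ww])
  have Sw: "S *\<^sub>v w \<in> carrier_vec r" by (rule mult_mat_vec_carrier[OF S w])
  have PT: "P\<^sup>T \<in> carrier_mat r n1" using P by simp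
  have "U *\<^sub>v (V\<^sup>T *\<^sub>v (W *\<^sub>v w)) = (Xs + E) *\<^sub>v (W *\<^sub>v w)"
    unfolding UV_eq[symmetric] using U V Ww by (intro assoc_mult_mat_vec[symmetric, of _ n1 r _ n2]) auto
  also have "\<dots> = Xs *\<^sub>v (W *\<^sub>v w) + E *\<^sub>v (W *\<^sub>v w)"
    by (rule add_mult_distrib_mat_vec[OF Xs_carrier E_carrier Ww])
  finally have "P\<^sup>T *\<^sub>v (U *\<^sub>v (V\<^sup>T *\<^sub>v (W *\<^sub>v w))) = P\<^sup>T *\<^sub>v (Xs *\<^sub>v (W *\<^sub>v w)) + P\<^sup>T *\<^sub>v (E *\<^sub>v (W *\<^sub>v w))"
    using mult_add_distrib_mat_vec[OF PT XW EW] by simp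
  also have "P\<^sup>T *\<^sub>v (Xs *\<^sub>v (W *\<^sub>v w)) = S *\<^sub>v w"
  proof -
    have "P\<^sup>T *\<^sub>v (Xs *\<^sub>v (W *\<^sub>v w)) = (P\<^sup>T * Xs) *\<^sub>v (W *\<^sub>v w)"
      by (rule assoc_mult_mat_vec[symmetric, OF PT Xs_carrier Ww])
    also have "\<dots> = S *\<^sub>v (W\<^sup>T *\<^sub>v (W *\<^sub>v w))"
      unfolding PT_Xs using S W Ww by (intro assoc_mult_mat_vec[of _ r r _ n2]) auto
    also have "W\<^sup>T *\<^sub>v (W *\<^sub>v w) = (W\<^sup>T * W) *\<^sub>v w"
      using W w by (intro assoc_mult_mat_vec[symmetric, of _ r n2 _ r]) auto
    finally show ?thesis using w WW by simp
  qed
  finally have eq: "P\<^sup>T *\<^sub>v (U *\<^sub>v (V\<^sup>T *\<^sub>v (W *\<^sub>v w))) = S *\<^sub>v w + P\<^sup>T *\<^sub>v (E *\<^sub>v (W *\<^sub>v w))" .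
  have PE: "P\<^sup>T *\<^sub>v (E *\<^sub>v (W *\<^sub>v w)) \<in> carrier_vec r" by (rule mult_mat_vec_carrier[OF PT EW])
  have "vnorm (P\<^sup>T *\<^sub>v (E *\<^sub>v (W *\<^sub>v w))) \<le> 1 * vnorm (E *\<^sub>v (W *\<^sub>v w))"
    by (rule op_leD[OF op_le_transpose[OF op_le_orthonormal[OF P PP]] PT EW]) simp
  also have "\<dots> \<le> norm_F E * vnorm (W *\<^sub>v w)"
    using vnorm_mult_mat_vec_le[OF E_carrier Ww] by simp
  also have "\<dots> \<le> \<sigma> / 16 * vnorm w"
    unfolding vnorm_orthonormal[OF W WW w] using err by (intro mult_right_mono) (auto simp: E_def)
  finally have small: "vnorm (P\<^sup>T *\<^sub>v (E *\<^sub>v (W *\<^sub>v w))) \<le> \<sigma> / 16 * vnorm w" .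
  have "S *\<^sub>v w = (S *\<^sub>v w + P\<^sup>T *\<^sub>v (E *\<^sub>v (W *\<^sub>v w))) - P\<^sup>T *\<^sub>v (E *\<^sub>v (W *\<^sub>v w))"
    by (rule add_diff_cancel_vec[OF Sw PE])
  then have "vnorm (S *\<^sub>v w) \<le> vnorm (S *\<^sub>v w + P\<^sup>T *\<^sub>v (E *\<^sub>v (W *\<^sub>v w))) + vnorm (P\<^sup>T *\<^sub>v (E *\<^sub>v (W *\<^sub>v w)))"
    using vnorm_diff_le[OF add_carrier_vec[OF Sw PE] PE] by simp
  moreover have "\<sigma> * vnorm w \<le> vnorm (S *\<^sub>v w)" by (rule op_geD[OF S_ge S w])
  ultimately show ?thesis unfolding eq using small by (simp add: algebra_simps)
qed

text \<open>The core bound makes the square matrix \<open>V^T W\<close> injective, so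
  \<open>z = V^T W w\<close> for some \<open>w\<close>. Then
  \<open>|z|^2 = <W w, V z> \<le> |w| |V z|\<close>, while the core bound reads
  \<open>15 / 16 * \<sigma> * |w| \<le> |U z|\<close>.\<close>

lemma vnorm_product_ge:
  assumes z: "z \<in> carrier_vec r"
  shows "15 / 16 * \<sigma> * (vnorm z)\<^sup>2 \<le> vnorm (U *\<^sub>v z) * vnorm (V *\<^sub>v z)"
proof -
  let ?R = "V\<^sup>T * W"
  have R: "?R \<in> carrier_mat r r" using V W by (auto intro: mult_carrier_mat)
  have PT: "P\<^sup>T \<in> carrier_mat r n1" using P by simp
  have Rw: "?R *\<^sub>v w = V\<^sup>T *\<^sub>v (W *\<^sub>v w)" if "w \<in> carrier_vec r" for w
    using V W that by (intro assoc_mult_mat_vec[of _ r n2 _ r]) auto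
  have core: "15 / 16 * \<sigma> * vnorm w \<le> vnorm (U *\<^sub>v (?R *\<^sub>v w))" if w: "w \<in> carrier_vec r" for w
  proof -
    have "U *\<^sub>v (?R *\<^sub>v w) \<in> carrier_vec n1" using U R w by (auto intro!: mult_mat_vec_carrier)
    then have "vnorm (P\<^sup>T *\<^sub>v (U *\<^sub>v (?R *\<^sub>v w))) \<le> 1 * vnorm (U *\<^sub>v (?R *\<^sub>v w))"
      by (intro op_leD[OF op_le_transpose[OF op_le_orthonormal[OF P PP]] PT]) auto
    then show ?thesis using vnorm_core_ge[OF w] by (simp add: Rw[OF w])
  qed
  have "w = 0\<^sub>v r" if w: "w \<in> carrier_vec r" "?R *\<^sub>v w = 0\<^sub>v r" for w
  proof -
    have "U *\<^sub>v 0\<^sub>v r = 0\<^sub>v n1" using U by auto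
    then have "15 / 16 * \<sigma> * vnorm w \<le> vnorm (0\<^sub>v n1)" using core[OF w(1)] w(2) by simp
    also have "vnorm (0\<^sub>v n1) = 0" by (simp add: vnorm_def L2_set_def)
    finally have "vnorm w \<le> 0" using \<sigma> by (simp add: mult_le_0_iff)
    then have "vnorm w = 0" using vnorm_nonneg[of w] by linarith
    then show ?thesis using w(1) vnorm_eq_0D by blast
  qed
  then obtain B where B: "B \<in> carrier_mat r r" "?R * B = 1\<^sub>m r"
    using ex_inverse_of_injective[OF R] by blast
  define w where "w = B *\<^sub>v z"
  have w: "w \<in> carrier_vec r" unfolding w_def by (rule mult_mat_vec_carrier[OF B(1) z])
  have "?R *\<^sub>v w = (?R * B) *\<^sub>v z" unfolding w_def by (rule assoc_mult_mat_vec[symmetric, OF R B(1) z])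
  then have Rwz: "?R *\<^sub>v w = z" using B z by simp
  have Vz: "V *\<^sub>v z \<in> carrier_vec n2" and Ww: "W *\<^sub>v w \<in> carrier_vec n2"
    using V W z w by (auto intro: mult_mat_vec_carrier)
  have "(vnorm z)\<^sup>2 = z \<bullet> (V\<^sup>T *\<^sub>v (W *\<^sub>v w))"
    using Rwz Rw[OF w] by (simp add: vnorm_square)
  also have "\<dots> = (V\<^sup>T *\<^sub>v (W *\<^sub>v w)) \<bullet> z"
    using V Ww z by (intro comm_scalar_prod[of _ r] mult_mat_vec_carrier[of _ r n2]) auto
  also have "\<dots> = (W *\<^sub>v w) \<bullet> (V *\<^sub>v z)" by (rule transpose_vec_mult_scalar[OF V z Ww])
  also have "\<dots> \<le> vnorm (W *\<^sub>v w) * vnorm (V *\<^sub>v z)" using abs_scalar_prod_le[OF Ww Vz] by linarith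
  also have "\<dots> = vnorm w * vnorm (V *\<^sub>v z)" by (simp add: vnorm_orthonormal[OF W WW w])
  finally have "15 / 16 * \<sigma> * (vnorm z)\<^sup>2 \<le> 15 / 16 * \<sigma> * (vnorm w * vnorm (V *\<^sub>v z))"
    using \<sigma> by (intro mult_left_mono) auto
  also have "\<dots> = (15 / 16 * \<sigma> * vnorm w) * vnorm (V *\<^sub>v z)" by simp
  also have "\<dots> \<le> vnorm (U *\<^sub>v z) * vnorm (V *\<^sub>v z)"
    using core[OF w] by (intro mult_right_mono) (auto simp: Rwz)
  finally show ?thesis .
qed

text \<open>In units of \<open>\<sigma> * |z|^2\<close> the two squares have sum at least
  \<open>15 / 8\<close>, by the product bound, and difference at most \<open>1 / 8\<close>, by
  balance.\<close>

lemma vnorm_square_ge: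
  assumes z: "z \<in> carrier_vec r"
  shows "7 / 8 * \<sigma> * (vnorm z)\<^sup>2 \<le> (vnorm (U *\<^sub>v z))\<^sup>2" "7 / 8 * \<sigma> * (vnorm z)\<^sup>2 \<le> (vnorm (V *\<^sub>v z))\<^sup>2"
proof -
  let ?u = "vnorm (U *\<^sub>v z)" and ?v = "vnorm (V *\<^sub>v z)"
  have "2 * (?u * ?v) \<le> ?u\<^sup>2 + ?v\<^sup>2"
    using sum_squares_bound[of ?u ?v] by (simp add: mult.assoc)
  then have *: "15 / 8 * (\<sigma> * (vnorm z)\<^sup>2) \<le> ?u\<^sup>2 + ?v\<^sup>2" using vnorm_product_ge[OF z] by simp
  from * imbalance[OF z] show "7 / 8 * \<sigma> * (vnorm z)\<^sup>2 \<le> ?u\<^sup>2" "7 / 8 * \<sigma> * (vnorm z)\<^sup>2 \<le> ?v\<^sup>2"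
    by linarith+
qed

end

lemma add_diff_add_mat:
  fixes A B C :: "real mat"
  assumes "A \<in> carrier_mat n k" "B \<in> carrier_mat n k" "C \<in> carrier_mat n k"
  shows "(A + B) - (A + C) = B - C"
  using assms by (intro eq_matI) auto

lemma op_geI_square:
  assumes "A \<in> carrier_mat n k" "0 \<le> c"
    and "\<And>v. v \<in> carrier_vec k \<Longrightarrow> c * (vnorm v)\<^sup>2 \<le> (vnorm (A *\<^sub>v v))\<^sup>2"
  shows "op_ge A (sqrt c)"
proof (rule op_geI[OF assms(1)])
  fix v :: "real vec" assume "v \<in> carrier_vec k"
  then have "(sqrt c * vnorm v)\<^sup>2 \<le> (vnorm (A *\<^sub>v v))\<^sup>2"
    using assms by (simp add: power_mult_distrib)
  then show "sqrt c * vnorm v \<le> vnorm (A *\<^sub>v v)" by (rule power2_le_imp_le) simp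
qed

section \<open>An explicit aligned factorization of the target\<close>

context near_target begin

lemma op_ge_V: "op_ge V (sqrt (3 / 4 * \<sigma>))"
proof (rule op_geI_square[OF V])
  fix v :: "real vec" assume "v \<in> carrier_vec r"
  note vnorm_square_ge(2)[OF this]
  moreover have "0 \<le> \<sigma> * (vnorm v)\<^sup>2" using \<sigma> by simp
  ultimately show "3 / 4 * \<sigma> * (vnorm v)\<^sup>2 \<le> (vnorm (V *\<^sub>v v))\<^sup>2" by linarith
qed (use \<sigma> in simp)

text \<open>Coordinates of \<open>P P^T U\<close> in the columns of \<open>P\<close>; thus
  \<open>P * Q\<close> is the first factor of the comparison pair.\<close>

definition Q :: "real mat" where "Q = P\<^sup>T * U"

lemma PT: "P\<^sup>T \<in> carrier_mat r n1" using P by simp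

lemma VT: "V\<^sup>T \<in> carrier_mat r n2" using V by simp

lemma WT: "W\<^sup>T \<in> carrier_mat r n2" using W by simp

lemma Q: "Q \<in> carrier_mat r r" unfolding Q_def by (rule mult_carrier_mat[OF PT U])

lemma PQ: "P * Q \<in> carrier_mat n1 r" by (rule mult_carrier_mat[OF P Q])

lemma PTE: "P\<^sup>T * E \<in> carrier_mat r n2" by (rule mult_carrier_mat[OF PT E_carrier])

lemma SWT: "S * W\<^sup>T \<in> carrier_mat r n2" by (rule mult_carrier_mat[OF S WT])

lemma Q_VT: "Q * V\<^sup>T = S * W\<^sup>T + P\<^sup>T * E"
proof -
  have "Q * V\<^sup>T = P\<^sup>T * (U * V\<^sup>T)" unfolding Q_def by (rule assoc_mult_mat[OF PT U VT])
  also have "\<dots> = P\<^sup>T * Xs + P\<^sup>T * E"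
    unfolding UV_eq by (rule mult_add_distrib_mat[OF PT Xs_carrier E_carrier])
  finally show ?thesis by (simp only: PT_Xs)
qed

text \<open>Projecting out the columns of \<open>P\<close> removes the target from
  \<open>U V^T\<close> and leaves only the error.\<close>

lemma residual_VT: "(U - P * Q) * V\<^sup>T = E - P * (P\<^sup>T * E)"
proof -
  have Xs': "P * (S * W\<^sup>T) = Xs" unfolding Xs by (rule assoc_mult_mat[symmetric, OF P S WT])
  have "(U - P * Q) * V\<^sup>T = U * V\<^sup>T - P * Q * V\<^sup>T" by (rule minus_mult_distrib_mat[OF U PQ VT])
  also have "P * Q * V\<^sup>T = P * (S * W\<^sup>T + P\<^sup>T * E)"
    unfolding Q_VT[symmetric] by (rule assoc_mult_mat[OF P Q VT])
  also have "\<dots> = Xs + P * (P\<^sup>T * E)"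
    using mult_add_distrib_mat[OF P SWT PTE] by (simp only: Xs')
  finally show ?thesis
    unfolding UV_eq using add_diff_add_mat[OF Xs_carrier E_carrier mult_carrier_mat[OF P PTE]] by simp
qed

text \<open>\<open>V\<close> is bounded below, so the distance can be read off after multiplication
  by \<open>V^T\<close>, where it is the part of \<open>E\<close> orthogonal to the columns of
  \<open>P\<close>.\<close>

lemma residual_le: "3 / 4 * \<sigma> * (norm_F (U - P * Q))\<^sup>2 \<le> (norm_F (E - P * (P\<^sup>T * E)))\<^sup>2"
proof -
  have "sqrt (3 / 4 * \<sigma>) * norm_F (U - P * Q) \<le> norm_F ((U - P * Q) * V\<^sup>T)"
    using \<sigma> by (intro norm_F_mult_transpose_ge[OF op_ge_V V minus_carrier_mat[OF PQ]]) simp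
  then have "(sqrt (3 / 4 * \<sigma>) * norm_F (U - P * Q))\<^sup>2 \<le> (norm_F ((U - P * Q) * V\<^sup>T))\<^sup>2"
    by (rule power_mono) (use \<sigma> in simp)
  then show ?thesis using \<sigma> by (simp add: power_mult_distrib residual_VT)
qed

text \<open>Pythagoras: from the lower bound \<open>7 / 8 * \<sigma>\<close> for the square of
  \<open>U z\<close> only the residual part is lost, which is at most \<open>\<sigma> / 192\<close>,
  both relative to \<open>|z|^2\<close>.\<close>

lemma op_ge_Q: "op_ge Q (sqrt (3 / 4 * \<sigma>))"
proof (rule op_geI_square[OF Q])
  fix z :: "real vec" assume z: "z \<in> carrier_vec r"
  have Uz: "U *\<^sub>v z \<in> carrier_vec n1" by (rule mult_mat_vec_carrier[OF U z])
  have Qz: "P\<^sup>T *\<^sub>v (U *\<^sub>v z) = Q *\<^sub>v z" unfolding Q_def by (rule assoc_mult_mat_vec[symmetric, OF PT U z])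
  have "(U - P * Q) *\<^sub>v z = U *\<^sub>v z - (P * Q) *\<^sub>v z" by (rule minus_mult_distrib_mat_vec[OF U PQ z])
  also have "(P * Q) *\<^sub>v z = P *\<^sub>v (Q *\<^sub>v z)" by (rule assoc_mult_mat_vec[OF P Q z])
  finally have Nz: "U *\<^sub>v z - P *\<^sub>v (P\<^sup>T *\<^sub>v (U *\<^sub>v z)) = (U - P * Q) *\<^sub>v z" by (simp only: Qz)
  have split: "(vnorm (U *\<^sub>v z))\<^sup>2 = (vnorm (Q *\<^sub>v z))\<^sup>2 + (vnorm ((U - P * Q) *\<^sub>v z))\<^sup>2"
    using vnorm_complement[OF P PP Uz] unfolding Nz unfolding Qz .
  have "(norm_F (E - P * (P\<^sup>T * E)))\<^sup>2 \<le> (norm_F E)\<^sup>2"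
    using norm_F_complement[OF P PP E_carrier] zero_le_power2[of "norm_F (P\<^sup>T * E)"] by linarith
  also have "\<dots> \<le> (\<sigma> / 16)\<^sup>2" using err by (intro power_mono) (auto simp: E_def)
  also have "\<dots> = \<sigma> * \<sigma> / 256" by (simp add: power2_eq_square)
  finally have "3 / 4 * \<sigma> * (norm_F (U - P * Q))\<^sup>2 \<le> \<sigma> * \<sigma> / 256" using residual_le by linarith
  then have "\<sigma> * (3 / 4 * (norm_F (U - P * Q))\<^sup>2) \<le> \<sigma> * (\<sigma> / 256)" by (simp add: mult_ac)
  then have N2: "(norm_F (U - P * Q))\<^sup>2 \<le> \<sigma> / 192" using \<sigma> by (simp add: mult_le_cancel_left)
  have "vnorm ((U - P * Q) *\<^sub>v z) \<le> norm_F (U - P * Q) * vnorm z"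
    by (rule vnorm_mult_mat_vec_le[OF minus_carrier_mat[OF PQ] z])
  then have "(vnorm ((U - P * Q) *\<^sub>v z))\<^sup>2 \<le> (norm_F (U - P * Q) * vnorm z)\<^sup>2" by (rule power_mono) simp
  also have "\<dots> \<le> \<sigma> / 192 * (vnorm z)\<^sup>2"
    using mult_right_mono[OF N2 zero_le_power2[of "vnorm z"]] by (simp add: power_mult_distrib)
  finally have "(vnorm ((U - P * Q) *\<^sub>v z))\<^sup>2 \<le> \<sigma> / 192 * (vnorm z)\<^sup>2" .
  moreover have "0 \<le> \<sigma> * (vnorm z)\<^sup>2" using \<sigma> by simp
  ultimately show "3 / 4 * \<sigma> * (vnorm z)\<^sup>2 \<le> (vnorm (Q *\<^sub>v z))\<^sup>2"
    using vnorm_square_ge(1)[OF z] split by linarith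
qed (use \<sigma> in simp)

text \<open>Given the first factor \<open>P Q\<close>, the second is forced:
  \<open>Vs^T = Q^(-1) S W^T\<close>. Then \<open>(V - Vs)^T = Q^(-1) P^T E\<close>, while
  \<open>U - P Q\<close> is governed by \<open>E - P P^T E\<close>; these two parts of
  \<open>E\<close> are orthogonal, so the squared distances add up without loss. The operator bounds
  on \<open>Q^T\<close> and \<open>H^T\<close> are what puts the pair into the row constraint with
  its constant 3.\<close>

lemma aligned:
  "\<exists>Us Vs H. Us = P * Q \<and> H \<in> carrier_mat r r \<and> Vs = W * H \<and> Us * Vs\<^sup>T = Xs
     \<and> (norm_F (U - Us))\<^sup>2 + (norm_F (V - Vs))\<^sup>2 \<le> 8 / (3 * \<sigma>) * (norm_F E)\<^sup>2
     \<and> op_le Q\<^sup>T (sqrt (3 * \<sigma>1)) \<and> op_le H\<^sup>T (sqrt (3 * \<sigma>1))"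
proof -
  have c0: "0 < sqrt (3 / 4 * \<sigma>)" using \<sigma> by simp
  from op_ge_inverse[OF op_ge_Q c0 Q] obtain Qi where Qi: "Qi \<in> carrier_mat r r" "Q * Qi = 1\<^sub>m r" "Qi * Q = 1\<^sub>m r"
    and Qi_le: "op_le Qi (1 / sqrt (3 / 4 * \<sigma>))" by blast
  define H where "H = S * Qi\<^sup>T"
  have QiT: "Qi\<^sup>T \<in> carrier_mat r r" using Qi by simp
  have H: "H \<in> carrier_mat r r" unfolding H_def by (rule mult_carrier_mat[OF S QiT])
  have WH: "W * H \<in> carrier_mat n2 r" by (rule mult_carrier_mat[OF W H])
  have HT: "H\<^sup>T = Qi * S" unfolding H_def using transpose_mult[OF S QiT] S_sym by simp
  have WHT: "(W * H)\<^sup>T = Qi * (S * W\<^sup>T)"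
  proof -
    have "(W * H)\<^sup>T = H\<^sup>T * W\<^sup>T" by (rule transpose_mult[OF W H])
    also have "\<dots> = Qi * (S * W\<^sup>T)" unfolding HT by (rule assoc_mult_mat[OF Qi(1) S WT])
    finally show ?thesis .
  qed
  have prod: "P * Q * (W * H)\<^sup>T = Xs"
  proof -
    have "P * Q * (W * H)\<^sup>T = P * (Q * (Qi * (S * W\<^sup>T)))"
      unfolding WHT by (rule assoc_mult_mat[OF P Q mult_carrier_mat[OF Qi(1) SWT]])
    also have "Q * (Qi * (S * W\<^sup>T)) = S * W\<^sup>T"
      unfolding assoc_mult_mat[symmetric, OF Q Qi(1) SWT] Qi(2) by (rule left_mult_one_mat[OF SWT])
    also have "P * (S * W\<^sup>T) = Xs" unfolding Xs by (rule assoc_mult_mat[symmetric, OF P S WT])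
    finally show ?thesis .
  qed
  have diff: "(V - W * H)\<^sup>T = Qi * (P\<^sup>T * E)"
  proof -
    have cancel: "Qi * (Q * V\<^sup>T) = V\<^sup>T"
      unfolding assoc_mult_mat[symmetric, OF Qi(1) Q VT] Qi(3) by (rule left_mult_one_mat[OF VT])
    have "(V - W * H)\<^sup>T = V\<^sup>T - (W * H)\<^sup>T" by (rule transpose_minus[OF V WH])
    also have "\<dots> = Qi * (S * W\<^sup>T + P\<^sup>T * E) - Qi * (S * W\<^sup>T)"
      unfolding WHT by (subst cancel[symmetric]) (simp only: Q_VT)
    also have "Qi * (S * W\<^sup>T + P\<^sup>T * E) = Qi * (S * W\<^sup>T) + Qi * (P\<^sup>T * E)"
      by (rule mult_add_distrib_mat[OF Qi(1) SWT PTE])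
    finally have "(V - W * H)\<^sup>T = Qi * (S * W\<^sup>T) + Qi * (P\<^sup>T * E) - Qi * (S * W\<^sup>T)" .
    moreover have "A + B - A = B" if "A \<in> carrier_mat r n2" "B \<in> carrier_mat r n2" for A B :: "real mat"
      using that by (intro eq_matI) auto
    ultimately show ?thesis
      using mult_carrier_mat[OF Qi(1) SWT] mult_carrier_mat[OF Qi(1) PTE] by metis
  qed
  have "norm_F (V - W * H) \<le> 1 / sqrt (3 / 4 * \<sigma>) * norm_F (P\<^sup>T * E)"
    using norm_F_mult_le[OF Qi_le Qi(1) PTE] c0 norm_F_transpose[of "V - W * H"] by (simp add: diff)
  then have "(norm_F (V - W * H))\<^sup>2 \<le> (1 / sqrt (3 / 4 * \<sigma>) * norm_F (P\<^sup>T * E))\<^sup>2"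
    by (rule power_mono) simp
  also have "\<dots> = 4 / (3 * \<sigma>) * (norm_F (P\<^sup>T * E))\<^sup>2" using \<sigma> by (simp add: power_mult_distrib power_divide)
  finally have VW: "(norm_F (V - W * H))\<^sup>2 \<le> 4 / (3 * \<sigma>) * (norm_F (P\<^sup>T * E))\<^sup>2" .
  have UP: "(norm_F (U - P * Q))\<^sup>2 \<le> 4 / (3 * \<sigma>) * (norm_F (E - P * (P\<^sup>T * E)))\<^sup>2"
    using residual_le \<sigma> by (simp add: field_simps)
  have pyth: "(norm_F (P\<^sup>T * E))\<^sup>2 + (norm_F (E - P * (P\<^sup>T * E)))\<^sup>2 = (norm_F E)\<^sup>2"
    by (rule norm_F_complement[OF P PP E_carrier, symmetric])
  have "(norm_F (U - P * Q))\<^sup>2 + (norm_F (V - W * H))\<^sup>2 \<le> 4 / (3 * \<sigma>) * (norm_F E)\<^sup>2"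
    using UP VW unfolding pyth[symmetric] by (simp add: distrib_left)
  also have "\<dots> \<le> 8 / (3 * \<sigma>) * (norm_F E)\<^sup>2"
    using \<sigma> by (intro mult_right_mono divide_right_mono) auto
  finally have dist: "(norm_F (U - P * Q))\<^sup>2 + (norm_F (V - W * H))\<^sup>2 \<le> 8 / (3 * \<sigma>) * (norm_F E)\<^sup>2" .
  have "op_le Q\<^sup>T (sqrt (2 * \<sigma>1) * 1)"
  proof -
    have "Q\<^sup>T = U\<^sup>T * P" unfolding Q_def using transpose_mult[OF PT U] by simp
    moreover have "op_le (U\<^sup>T * P) (sqrt (2 * \<sigma>1) * 1)"
      using U \<sigma> by (intro op_le_mult[OF op_le_UT op_le_orthonormal[OF P PP] _ P]) auto
    ultimately show ?thesis by simp
  qed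
  then have QT: "op_le Q\<^sup>T (sqrt (3 * \<sigma>1))" by (rule op_le_mono) (use \<sigma> in simp)
  have HTle: "op_le H\<^sup>T (sqrt (3 * \<sigma>1))"
  proof (rule op_leI)
    show "H\<^sup>T \<in> carrier_mat r r" using H by simp
    fix y :: "real vec" assume y: "y \<in> carrier_vec r"
    have Wy: "W *\<^sub>v y \<in> carrier_vec n2" by (rule mult_mat_vec_carrier[OF W y])
    have D: "V - W * H \<in> carrier_mat n2 r" by (rule minus_carrier_mat[OF WH])
    have DT: "(V - W * H)\<^sup>T \<in> carrier_mat r n2" using D by simp
    have WHTc: "(W * H)\<^sup>T \<in> carrier_mat r n2" using WH by simp
    have "(V - W * H)\<^sup>T *\<^sub>v (W *\<^sub>v y) = V\<^sup>T *\<^sub>v (W *\<^sub>v y) - (W * H)\<^sup>T *\<^sub>v (W *\<^sub>v y)"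
      unfolding transpose_minus[OF V WH] by (rule minus_mult_distrib_mat_vec[OF VT WHTc Wy])
    moreover have "(W * H)\<^sup>T *\<^sub>v (W *\<^sub>v y) = H\<^sup>T *\<^sub>v y"
    proof -
      have HTc: "H\<^sup>T \<in> carrier_mat r r" using H by simp
      have "(W * H)\<^sup>T *\<^sub>v (W *\<^sub>v y) = H\<^sup>T *\<^sub>v (W\<^sup>T *\<^sub>v (W *\<^sub>v y))"
        unfolding transpose_mult[OF W H] by (rule assoc_mult_mat_vec[OF HTc WT Wy])
      also have "W\<^sup>T *\<^sub>v (W *\<^sub>v y) = W\<^sup>T * W *\<^sub>v y" by (rule assoc_mult_mat_vec[symmetric, OF WT W y])
      finally show ?thesis using y by (simp add: WW)
    qed
    moreover have "b = a - (a - b)" if "a \<in> carrier_vec r" "b \<in> carrier_vec r" for a b :: "real vec"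
      using that by (intro eq_vecI) auto
    ultimately have "H\<^sup>T *\<^sub>v y = V\<^sup>T *\<^sub>v (W *\<^sub>v y) - (V - W * H)\<^sup>T *\<^sub>v (W *\<^sub>v y)"
      using mult_mat_vec_carrier[OF VT Wy] mult_mat_vec_carrier[OF WHTc Wy] by metis
    then have "vnorm (H\<^sup>T *\<^sub>v y) \<le> vnorm (V\<^sup>T *\<^sub>v (W *\<^sub>v y)) + vnorm ((V - W * H)\<^sup>T *\<^sub>v (W *\<^sub>v y))"
      using vnorm_diff_le[OF mult_mat_vec_carrier[OF VT Wy] mult_mat_vec_carrier[OF DT Wy]] by simp
    also have "\<dots> \<le> sqrt (2 * \<sigma>1) * vnorm y + norm_F (V - W * H) * vnorm y"
      using op_leD[OF op_le_VT VT Wy] vnorm_mult_mat_vec_le[OF DT Wy]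
      by (simp add: vnorm_orthonormal[OF W WW y] norm_F_transpose)
    also have "\<dots> \<le> (sqrt (2 * \<sigma>1) + norm_F (V - W * H)) * vnorm y" by (simp add: distrib_right)
    also have "\<dots> \<le> sqrt (3 * \<sigma>1) * vnorm y"
    proof (rule mult_right_mono)
      have "(norm_F (V - W * H))\<^sup>2 \<le> 8 / (3 * \<sigma>) * (norm_F E)\<^sup>2" using dist zero_le_power2[of "norm_F (U - P * Q)"] by linarith
      also have "\<dots> \<le> 8 / (3 * \<sigma>) * (\<sigma> / 16)\<^sup>2"
        using err \<sigma> by (intro mult_left_mono power_mono) (auto simp: E_def)
      also have "\<dots> = \<sigma> / 96" using \<sigma> by (simp add: power2_eq_square)
      also have "\<dots> \<le> (sqrt \<sigma>1 / 9)\<^sup>2" using \<sigma> by (simp add: power_divide)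
      finally have a: "norm_F (V - W * H) \<le> sqrt \<sigma>1 / 9" by (rule power2_le_imp_le) (use \<sigma> in simp)
      \<comment> \<open>The margin between \<open>2 * \<sigma>1\<close> for the iterate and
        \<open>3 * \<sigma>1\<close> for the constraint absorbs the distance to the aligned
        factor.\<close>
      have "sqrt 2 + 1 / 9 \<le> sqrt 3"
      proof (rule real_le_rsqrt)
        have "sqrt 2 \<le> 3 / 2" by (rule real_le_lsqrt) (auto simp: power2_eq_square)
        then show "(sqrt 2 + 1 / 9)\<^sup>2 \<le> 3" by (simp add: power2_eq_square algebra_simps)
      qed
      then have "(sqrt 2 + 1 / 9) * sqrt \<sigma>1 \<le> sqrt 3 * sqrt \<sigma>1" by (rule mult_right_mono) (use \<sigma> in simp)
      then show "sqrt (2 * \<sigma>1) + norm_F (V - W * H) \<le> sqrt (3 * \<sigma>1)"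
        using a by (simp add: real_sqrt_mult distrib_right)
    qed simp
    finally show "vnorm (H\<^sup>T *\<^sub>v y) \<le> sqrt (3 * \<sigma>1) * vnorm y" .
  qed
  show ?thesis
    by (rule exI[of _ "P * Q"], rule exI[of _ "W * H"], rule exI[of _ H])
       (intro conjI refl H prod dist QT HTle)
qed

end

section \<open>One step of constrained GNMR\<close>

text \<open>A row of \<open>P * Q\<close> is \<open>Q^T\<close> applied to the row of
  \<open>P\<close>, so incoherence passes to the aligned factors.\<close>

lemma vnorm_row_mult_le:
  assumes P: "P \<in> carrier_mat n r" and Q: "Q \<in> carrier_mat r r" and le: "op_le Q\<^sup>T (sqrt c)" and c: "0 \<le> c"
    and i: "i < n" and row: "(vnorm (row P i))\<^sup>2 \<le> m"
  shows "(vnorm (row (P * Q) i))\<^sup>2 \<le> c * m"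
proof -
  have v: "row P i \<in> carrier_vec r" using P i by auto
  have QT: "Q\<^sup>T \<in> carrier_mat r r" using Q by simp
  have "row (P * Q) i = Q\<^sup>T *\<^sub>v row P i"
  proof (rule eq_vecI)
    fix j assume "j < dim_vec (Q\<^sup>T *\<^sub>v row P i)"
    then have j: "j < r" using Q by simp
    then have "col Q j \<in> carrier_vec r" using Q by auto
    from comm_scalar_prod[OF v this] show "row (P * Q) i $ j = (Q\<^sup>T *\<^sub>v row P i) $ j"
      using P Q i j by simp
  qed (use P Q i in simp)
  then have "vnorm (row (P * Q) i) \<le> sqrt c * vnorm (row P i)" using op_leD[OF le QT v] by simp
  then have "(vnorm (row (P * Q) i))\<^sup>2 \<le> (sqrt c * vnorm (row P i))\<^sup>2" by (rule power_mono) simp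
  also have "\<dots> = c * (vnorm (row P i))\<^sup>2" using c by (simp add: power_mult_distrib)
  also have "\<dots> \<le> c * m" using row c by (rule mult_left_mono)
  finally show ?thesis .
qed

lemma vnorm_row_diff_le:
  assumes A: "A \<in> carrier_mat n r" and B: "B \<in> carrier_mat n r" and i: "i < n"
    and "(vnorm (row A i))\<^sup>2 \<le> c" "(vnorm (row B i))\<^sup>2 \<le> c"
  shows "(vnorm (row (A - B) i))\<^sup>2 \<le> 4 * c"
proof -
  have "row (A - B) i = row A i - row B i" using A B i by (intro eq_vecI) auto
  then have "vnorm (row (A - B) i) \<le> vnorm (row A i) + vnorm (row B i)"
    using vnorm_diff_le[of "row A i" r "row B i"] A B i by auto
  then have "(vnorm (row (A - B) i))\<^sup>2 \<le> (vnorm (row A i) + vnorm (row B i))\<^sup>2" by (rule power_mono) simp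
  also have "\<dots> \<le> 2 * (vnorm (row A i))\<^sup>2 + 2 * (vnorm (row B i))\<^sup>2"
    using sum_squares_bound[of "vnorm (row A i)" "vnorm (row B i)"] by (simp add: power2_sum)
  finally show ?thesis using assms(4,5) by linarith
qed

lemma diff_mult_transpose_diff:
  fixes A B C D :: "real mat"
  assumes A: "A \<in> carrier_mat n1 r" and B: "B \<in> carrier_mat n2 r" and C: "C \<in> carrier_mat n1 r" and D: "D \<in> carrier_mat n2 r"
  shows "(A - C) * (B - D)\<^sup>T = (A * B\<^sup>T - A * D\<^sup>T) - (C * B\<^sup>T - C * D\<^sup>T)"
proof -
  have BT: "B\<^sup>T \<in> carrier_mat r n2" "D\<^sup>T \<in> carrier_mat r n2" using B D by auto
  show ?thesis
    unfolding transpose_minus[OF B D] minus_mult_distrib_mat[OF A C minus_carrier_mat[OF BT(2)]]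
      mult_minus_distrib_mat[OF A BT] mult_minus_distrib_mat[OF C BT] ..
qed

lemma norm_F_mult_le_norm_F:
  assumes "A \<in> carrier_mat n k" "B \<in> carrier_mat k l"
  shows "norm_F (A * B) \<le> norm_F A * norm_F B"
  by (rule norm_F_mult_le[OF op_le_norm_F assms]) simp

lemma norm_F_Gram_diff_le:
  assumes U: "U \<in> carrier_mat n r" and D: "D \<in> carrier_mat n r" and le: "op_le U c" "0 \<le> c"
  shows "norm_F ((U + D)\<^sup>T * (U + D) - U\<^sup>T * U) \<le> 2 * c * norm_F D + (norm_F D)\<^sup>2"
proof -
  have T: "U\<^sup>T \<in> carrier_mat r n" "D\<^sup>T \<in> carrier_mat r n" using U D by auto
  have c: "U\<^sup>T * U \<in> carrier_mat r r" "U\<^sup>T * D \<in> carrier_mat r r" "D\<^sup>T * U \<in> carrier_mat r r" "D\<^sup>T * D \<in> carrier_mat r r"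
    using T U D by (auto intro: mult_carrier_mat)
  have "(U + D)\<^sup>T * (U + D) = (U\<^sup>T * U + U\<^sup>T * D) + (D\<^sup>T * U + D\<^sup>T * D)"
    unfolding transpose_add[OF U D] add_mult_distrib_mat[OF T add_carrier_mat[OF D]]
      mult_add_distrib_mat[OF T(1) U D] mult_add_distrib_mat[OF T(2) U D] ..
  moreover have "(X + Y) + (Z + T) - X = (Y + Z) + T"
    if "X \<in> carrier_mat r r" "Y \<in> carrier_mat r r" "Z \<in> carrier_mat r r" "T \<in> carrier_mat r r" for X Y Z T :: "real mat"
    using that by (intro eq_matI) auto
  ultimately have eq: "(U + D)\<^sup>T * (U + D) - U\<^sup>T * U = (U\<^sup>T * D + D\<^sup>T * U) + D\<^sup>T * D"
    using c by metis
  have "norm_F (U\<^sup>T * D) \<le> c * norm_F D" by (rule norm_F_mult_le[OF op_le_transpose[OF le] T(1) D le(2)])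
  moreover have "D\<^sup>T * U = (U\<^sup>T * D)\<^sup>T" using transpose_mult[OF T(1) D] by simp
  ultimately have "norm_F (U\<^sup>T * D) \<le> c * norm_F D" "norm_F (D\<^sup>T * U) \<le> c * norm_F D"
    by (simp_all add: norm_F_transpose)
  moreover have "norm_F (D\<^sup>T * D) \<le> (norm_F D)\<^sup>2"
    using norm_F_mult_le_norm_F[OF T(2) D] by (simp add: norm_F_transpose power2_eq_square)
  moreover have "norm_F ((U\<^sup>T * D + D\<^sup>T * U) + D\<^sup>T * D) \<le> norm_F (U\<^sup>T * D) + norm_F (D\<^sup>T * U) + norm_F (D\<^sup>T * D)"
    using norm_F_add_le[OF c(2,3)] norm_F_add_le[OF add_carrier_mat[OF c(3)] c(4), of "U\<^sup>T * D"] by linarith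
  ultimately show ?thesis unfolding eq by linarith
qed

text \<open>What the step uses of the sample; from here on the argument is deterministic.
  \<open>m1\<close> and \<open>m2\<close> bound the squared row norms of the singular vectors.
  Feasible factors have squared row norms at most \<open>3 * \<sigma>1 * m1\<close> and
  \<open>3 * \<sigma>1 * m2\<close>, and a difference of two of them at most four times as much;
  hence the number 12 in the conditions on \<open>b\<close>.\<close>

locale sampled_target = target +
  fixes \<Omega> :: "(nat \<times> nat) set" and p b m1 m2 :: real
  assumes \<Omega>: "\<Omega> \<subseteq> {..<n1} \<times> {..<n2}" and p: "0 < p"
    and RIP_upper: "\<And>A B. A \<in> carrier_mat r n2 \<Longrightarrow> B \<in> carrier_mat n1 r \<Longrightarrow>
        (norm_F_on \<Omega> (P * A + B * W\<^sup>T))\<^sup>2 \<le> 8 * p * (norm_F (P * A + B * W\<^sup>T))\<^sup>2"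
    and RIP_lower: "\<And>A B. A \<in> carrier_mat r n2 \<Longrightarrow> B \<in> carrier_mat n1 r \<Longrightarrow>
        p / 2 * (norm_F (P * A + B * W\<^sup>T))\<^sup>2 \<le> (norm_F_on \<Omega> (P * A + B * W\<^sup>T))\<^sup>2"
    and product_bound: "\<And>A B. A \<in> carrier_mat n1 r \<Longrightarrow> B \<in> carrier_mat n2 r \<Longrightarrow>
        (\<And>i. i < n1 \<Longrightarrow> (vnorm (row A i))\<^sup>2 \<le> b) \<Longrightarrow> (\<And>j. j < n2 \<Longrightarrow> (vnorm (row B j))\<^sup>2 \<le> b) \<Longrightarrow>
        (norm_F_on \<Omega> (A * B\<^sup>T))\<^sup>2 \<le> p * (8 * ((norm_F A)\<^sup>2 + (norm_F B)\<^sup>2)\<^sup>2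
           + \<sigma> / 10000 * ((norm_F A)\<^sup>2 + (norm_F B)\<^sup>2))"
    and P_row: "\<And>i. i < n1 \<Longrightarrow> (vnorm (row P i))\<^sup>2 \<le> m1" and W_row: "\<And>j. j < n2 \<Longrightarrow> (vnorm (row W j))\<^sup>2 \<le> m2"
    and m1: "12 * \<sigma>1 * m1 \<le> b" and m2: "12 * \<sigma>1 * m2 \<le> b"
begin

text \<open>The constraint \<open>B_mu\<close> in terms of squared row norms, with \<open>m1\<close>
  and \<open>m2\<close> as the incoherence bounds.\<close>

definition flat :: "real mat \<Rightarrow> real mat \<Rightarrow> bool" where
  "flat U V \<longleftrightarrow> U \<in> carrier_mat n1 r \<and> V \<in> carrier_mat n2 r
     \<and> (\<forall>i<n1. (vnorm (row U i))\<^sup>2 \<le> 3 * \<sigma>1 * m1) \<and> (\<forall>j<n2. (vnorm (row V j))\<^sup>2 \<le> 3 * \<sigma>1 * m2)"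

definition err :: "real mat \<Rightarrow> real mat \<Rightarrow> real" where
  "err U V = norm_F (U * V\<^sup>T - Xs)"

definition imb :: "real mat \<Rightarrow> real mat \<Rightarrow> real" where
  "imb U V = norm_F (U\<^sup>T * U - V\<^sup>T * V)"

lemma product_bound_flat:
  assumes "flat A B" "flat C D"
  defines "d \<equiv> (norm_F (A - C))\<^sup>2 + (norm_F (B - D))\<^sup>2"
  shows "(norm_F_on \<Omega> ((A - C) * (B - D)\<^sup>T))\<^sup>2 \<le> p * (8 * d\<^sup>2 + \<sigma> / 10000 * d)"
  unfolding d_def
proof (rule product_bound)
  have c: "A \<in> carrier_mat n1 r" "B \<in> carrier_mat n2 r" "C \<in> carrier_mat n1 r" "D \<in> carrier_mat n2 r"
    using assms(1,2) by (auto simp: flat_def)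
  show "A - C \<in> carrier_mat n1 r" "B - D \<in> carrier_mat n2 r" using c by (auto simp: minus_carrier_mat)
  show "(vnorm (row (A - C) i))\<^sup>2 \<le> b" if "i < n1" for i
    using vnorm_row_diff_le[OF c(1,3) that, of "3 * \<sigma>1 * m1"] assms(1,2) that m1 by (auto simp: flat_def)
  show "(vnorm (row (B - D) j))\<^sup>2 \<le> b" if "j < n2" for j
    using vnorm_row_diff_le[OF c(2,4) that, of "3 * \<sigma>1 * m2"] assms(1,2) that m2 by (auto simp: flat_def)
qed

text \<open>The quadratic term of the product bound gains \<open>(e / \<sigma>)\<^sup>2\<close>, at
  most \<open>(1 / 4000)\<^sup>2\<close>, and the linear term is small through its coefficient.
  \<open>K\<close> is the constant of the squared distance, \<open>8 / 3\<close> for the aligned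
  pair and 128 for the next iterate; \<open>g\<close> is the resulting factor.\<close>

lemma product_bound_near:
  assumes "flat A B" "flat C D" and d: "(norm_F (A - C))\<^sup>2 + (norm_F (B - D))\<^sup>2 \<le> K / \<sigma> * e\<^sup>2"
    and e: "0 \<le> e" "e \<le> \<sigma> / 4000" and K: "0 \<le> K" and g: "0 \<le> g" "K\<^sup>2 / 2000000 + K / 10000 \<le> g\<^sup>2"
  shows "norm_F_on \<Omega> ((A - C) * (B - D)\<^sup>T) \<le> g * (sqrt p * e)"
proof -
  let ?d = "(norm_F (A - C))\<^sup>2 + (norm_F (B - D))\<^sup>2"
  have "?d\<^sup>2 \<le> (K / \<sigma> * e\<^sup>2)\<^sup>2" using d by (rule power_mono) simp
  also have "\<dots> = K\<^sup>2 * (e / \<sigma>)\<^sup>2 * e\<^sup>2" by (simp add: power2_eq_square)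
  also have "\<dots> \<le> K\<^sup>2 * (1 / 4000)\<^sup>2 * e\<^sup>2"
    using e \<sigma> by (intro mult_right_mono mult_left_mono power_mono) (auto simp: field_simps)
  also have "\<dots> = K\<^sup>2 / 16000000 * e\<^sup>2" by (simp add: power_divide)
  finally have d2: "?d\<^sup>2 \<le> K\<^sup>2 / 16000000 * e\<^sup>2" .
  have "\<sigma> / 10000 * ?d \<le> \<sigma> / 10000 * (K / \<sigma> * e\<^sup>2)" using d \<sigma> by (intro mult_left_mono) auto
  also have "\<dots> = K / 10000 * e\<^sup>2" using \<sigma> by simp
  finally have d1: "\<sigma> / 10000 * ?d \<le> K / 10000 * e\<^sup>2" .
  have "(norm_F_on \<Omega> ((A - C) * (B - D)\<^sup>T))\<^sup>2 \<le> p * (8 * ?d\<^sup>2 + \<sigma> / 10000 * ?d)"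
    by (rule product_bound_flat[OF assms(1,2)])
  also have "\<dots> \<le> p * ((K\<^sup>2 / 2000000 + K / 10000) * e\<^sup>2)"
    using d1 d2 p by (intro mult_left_mono) (auto simp: distrib_right)
  also have "\<dots> \<le> p * (g\<^sup>2 * e\<^sup>2)" using g p by (intro mult_left_mono mult_right_mono) auto
  also have "\<dots> = (g * (sqrt p * e))\<^sup>2" using p by (simp add: power_mult_distrib)
  finally show ?thesis by (rule power2_le_imp_le) (use g e p in simp)
qed

text \<open>The error is a matrix \<open>Z\<close> tangent at the target plus the product of the two
  differences to the aligned pair; the isometry handles the former, the product bound the latter.
  The factors \<open>3 / 5\<close> and 4 are what remains of \<open>sqrt (1 / 2)\<close> and
  \<open>sqrt 8\<close> after allowing for the product.\<close>

lemma near_RIP: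
  assumes flat: "flat U V" and e: "err U V \<le> \<sigma> / 4000" and imb: "imb U V \<le> \<sigma> / 8"
  shows "3 / 5 * (sqrt p * err U V) \<le> norm_F_on \<Omega> (U * V\<^sup>T - Xs)" (is ?lower)
    and "norm_F_on \<Omega> (U * V\<^sup>T - Xs) \<le> 4 * (sqrt p * err U V)" (is ?upper)
    and "\<exists>A B. flat A B \<and> A * B\<^sup>T = Xs
       \<and> (norm_F (U - A))\<^sup>2 + (norm_F (V - B))\<^sup>2 \<le> 8 / (3 * \<sigma>) * (err U V)\<^sup>2
       \<and> norm_F_on \<Omega> ((U - A) * (V - B)\<^sup>T) \<le> 1 / 50 * (sqrt p * err U V)" (is ?approx)
proof -
  interpret near_target n1 n2 r P S W Xs \<sigma>1 \<sigma> U V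
    using flat e imb \<sigma> by unfold_locales (auto simp: flat_def err_def imb_def)
  let ?e = "err U V"
  have eE: "norm_F E = ?e" by (simp add: E_def err_def)
  have e0: "0 \<le> ?e" by (simp add: err_def)
  obtain Vs H where H: "H \<in> carrier_mat r r" and Vs: "Vs = W * H" and prod: "P * Q * Vs\<^sup>T = Xs"
    and dist: "(norm_F (U - P * Q))\<^sup>2 + (norm_F (V - Vs))\<^sup>2 \<le> 8 / (3 * \<sigma>) * ?e\<^sup>2"
    and ops: "op_le Q\<^sup>T (sqrt (3 * \<sigma>1))" "op_le H\<^sup>T (sqrt (3 * \<sigma>1))"
    using aligned unfolding eE by blast
  have Vs_c: "Vs \<in> carrier_mat n2 r" unfolding Vs by (rule mult_carrier_mat[OF W H])
  have flat': "flat (P * Q) Vs"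
    unfolding flat_def using PQ Vs_c \<sigma> vnorm_row_mult_le[OF P Q ops(1) _ _ P_row] vnorm_row_mult_le[OF W H ops(2) _ _ W_row]
    by (auto simp: Vs)
  let ?DU = "U - P * Q" and ?DV = "V - Vs"
  have DU: "?DU \<in> carrier_mat n1 r" and DV: "?DV \<in> carrier_mat n2 r"
    by (rule minus_carrier_mat[OF PQ], rule minus_carrier_mat[OF Vs_c])
  have DVT: "?DV\<^sup>T \<in> carrier_mat r n2" and VsT: "Vs\<^sup>T \<in> carrier_mat r n2" and HT: "H\<^sup>T \<in> carrier_mat r r"
    using DV Vs_c H by auto
  \<comment> \<open>The linear part of the expansion around the aligned pair, bracketed so that the
    outer factors \<open>P\<close> and \<open>W\<^sup>T\<close> show it to be tangent.\<close>
  define Z where "Z = P * (Q * ?DV\<^sup>T) + (?DU * H\<^sup>T) * W\<^sup>T"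
  have QD: "Q * ?DV\<^sup>T \<in> carrier_mat r n2" by (rule mult_carrier_mat[OF Q DVT])
  have DH: "?DU * H\<^sup>T \<in> carrier_mat n1 r" by (rule mult_carrier_mat[OF DU HT])
  have Z_c: "Z \<in> carrier_mat n1 n2" unfolding Z_def
    by (rule add_carrier_mat[OF mult_carrier_mat[OF DH WT]])
  have DD_c: "?DU * ?DV\<^sup>T \<in> carrier_mat n1 n2" by (rule mult_carrier_mat[OF DU DVT])
  have split: "U * V\<^sup>T - Xs = Z + ?DU * ?DV\<^sup>T"
  proof -
    have a: "P * (Q * ?DV\<^sup>T) = P * Q * V\<^sup>T - Xs"
    proof -
      have "P * (Q * ?DV\<^sup>T) = P * Q * ?DV\<^sup>T" by (rule assoc_mult_mat[symmetric, OF P Q DVT])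
      also have "\<dots> = P * Q * V\<^sup>T - P * Q * Vs\<^sup>T"
        unfolding transpose_minus[OF V Vs_c] by (rule mult_minus_distrib_mat[OF PQ VT VsT])
      finally show ?thesis by (simp only: prod)
    qed
    have b: "(?DU * H\<^sup>T) * W\<^sup>T = ?DU * Vs\<^sup>T"
      unfolding Vs transpose_mult[OF W H] by (rule assoc_mult_mat[OF DU HT WT])
    have c: "?DU * ?DV\<^sup>T = (U * V\<^sup>T - P * Q * V\<^sup>T) - ?DU * Vs\<^sup>T"
      unfolding transpose_minus[OF V Vs_c] mult_minus_distrib_mat[OF DU VT VsT]
        minus_mult_distrib_mat[OF U PQ VT] ..
    have gen: "X3 - X0 = (X1 - X0) + X2 + ((X3 - X1) - X2)"
      if "X0 \<in> carrier_mat n1 n2" "X1 \<in> carrier_mat n1 n2" "X2 \<in> carrier_mat n1 n2" "X3 \<in> carrier_mat n1 n2"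
      for X0 X1 X2 X3 :: "real mat"
      using that by (intro eq_matI) auto
    show ?thesis
      unfolding Z_def a b c
      by (rule gen[OF Xs_carrier mult_carrier_mat[OF PQ VT] mult_carrier_mat[OF DU VsT] UV_carrier])
  qed
  have DD: "norm_F_on \<Omega> (?DU * ?DV\<^sup>T) \<le> 1 / 50 * (sqrt p * ?e)"
  proof (rule product_bound_near[OF flat flat', where K = "8 / 3"])
    show "(norm_F ?DU)\<^sup>2 + (norm_F ?DV)\<^sup>2 \<le> 8 / 3 / \<sigma> * ?e\<^sup>2" using dist by simp
  qed (use e e0 in \<open>auto simp: power2_eq_square\<close>)
  have DD_F: "norm_F (?DU * ?DV\<^sup>T) \<le> 1 / 1000 * ?e"
  proof -
    have "norm_F (?DU * ?DV\<^sup>T) \<le> norm_F ?DU * norm_F ?DV"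
      using norm_F_mult_le_norm_F[OF DU DVT] by (simp add: norm_F_transpose)
    also have "\<dots> \<le> ((norm_F ?DU)\<^sup>2 + (norm_F ?DV)\<^sup>2) / 2"
      using sum_squares_bound[of "norm_F ?DU" "norm_F ?DV"] by simp
    also have "\<dots> \<le> 8 / (3 * \<sigma>) * ?e\<^sup>2 / 2" using dist by simp
    also have "\<dots> = 4 / 3 * (?e / \<sigma>) * ?e" by (simp add: power2_eq_square)
    also have "\<dots> \<le> 4 / 3 * (1 / 4000) * ?e" using e e0 \<sigma> by (intro mult_right_mono mult_left_mono) (auto simp: field_simps)
    also have "\<dots> \<le> 1 / 1000 * ?e" using e0 by simp
    finally show ?thesis .
  qed
  have Z_F: "999 / 1000 * ?e \<le> norm_F Z" "norm_F Z \<le> 1001 / 1000 * ?e"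
  proof -
    have "?e \<le> norm_F Z + norm_F (?DU * ?DV\<^sup>T)"
      unfolding err_def split by (rule norm_F_add_le[OF Z_c DD_c])
    then show "999 / 1000 * ?e \<le> norm_F Z" using DD_F by linarith
    have "Z = (Z + ?DU * ?DV\<^sup>T) - ?DU * ?DV\<^sup>T" using Z_c DD_c by (intro eq_matI) auto
    then have "norm_F Z \<le> norm_F (Z + ?DU * ?DV\<^sup>T) + norm_F (?DU * ?DV\<^sup>T)"
      using norm_F_diff_le[OF add_carrier_mat[OF DD_c] DD_c] by metis
    then show "norm_F Z \<le> 1001 / 1000 * ?e" using DD_F unfolding err_def split by linarith
  qed
  have "(norm_F_on \<Omega> Z)\<^sup>2 \<le> 8 * p * (norm_F Z)\<^sup>2" unfolding Z_def by (rule RIP_upper[OF QD DH])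
  also have "\<dots> \<le> 8 * p * (1001 / 1000 * ?e)\<^sup>2" using Z_F p by (intro mult_left_mono power_mono) auto
  also have "\<dots> \<le> 9 * (p * ?e\<^sup>2)"
    using p by (simp add: power_mult_distrib power_divide)
  also have "\<dots> = (3 * (sqrt p * ?e))\<^sup>2" using p by (simp add: power_mult_distrib)
  finally have Zu: "norm_F_on \<Omega> Z \<le> 3 * (sqrt p * ?e)" by (rule power2_le_imp_le) (use p e0 in simp)
  have "(7 / 10 * (sqrt p * norm_F Z))\<^sup>2 \<le> p / 2 * (norm_F Z)\<^sup>2" using p by (simp add: power_mult_distrib power2_eq_square)
  also have "\<dots> \<le> (norm_F_on \<Omega> Z)\<^sup>2" unfolding Z_def by (rule RIP_lower[OF QD DH])
  finally have "7 / 10 * (sqrt p * norm_F Z) \<le> norm_F_on \<Omega> Z" by (rule power2_le_imp_le) simp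
  moreover have "sqrt p * (999 / 1000 * ?e) \<le> sqrt p * norm_F Z" using Z_F p by (intro mult_left_mono) auto
  moreover have "0 \<le> sqrt p * ?e" using p e0 by simp
  ultimately have Zl: "69 / 100 * (sqrt p * ?e) \<le> norm_F_on \<Omega> Z" by linarith
  have "norm_F_on \<Omega> (U * V\<^sup>T - Xs) \<le> norm_F_on \<Omega> Z + norm_F_on \<Omega> (?DU * ?DV\<^sup>T)"
    unfolding split by (rule norm_F_on_add_le[OF Z_c DD_c \<Omega>])
  moreover have "0 \<le> sqrt p * ?e" using p e0 by simp
  ultimately show ?upper using Zu DD by linarith
  have "Z = (Z + ?DU * ?DV\<^sup>T) - ?DU * ?DV\<^sup>T" using Z_c DD_c by (intro eq_matI) auto
  then have "norm_F_on \<Omega> Z \<le> norm_F_on \<Omega> (Z + ?DU * ?DV\<^sup>T) + norm_F_on \<Omega> (?DU * ?DV\<^sup>T)"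
    using norm_F_on_diff_le[OF add_carrier_mat[OF DD_c] DD_c \<Omega>] by metis
  then show ?lower using Zl DD \<open>0 \<le> sqrt p * ?e\<close> unfolding split by linarith
  show ?approx using flat' prod dist DD by blast
qed

section \<open>Stability of the region near the target\<close>

definition cond_sqrt :: real where "cond_sqrt = sqrt (\<sigma>1 / \<sigma>)"

text \<open>The second bound is stable under iteration because the imbalance grows in a step by at most
  \<open>47 * cond_sqrt\<close> times the error, which is halved.\<close>

definition basin :: "real mat \<Rightarrow> real mat \<Rightarrow> bool" where
  "basin U V \<longleftrightarrow> flat U V \<and> cond_sqrt * err U V \<le> \<sigma> / 1000000
     \<and> imb U V + 94 * cond_sqrt * err U V \<le> \<sigma> / 8"

lemma cond_sqrt_ge_1: "1 \<le> cond_sqrt"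
  using \<sigma> by (simp add: cond_sqrt_def)

lemma err_nonneg: "0 \<le> err U V"
  by (simp add: err_def)

lemma basin_err_le:
  assumes "basin U V"
  shows "err U V \<le> \<sigma> / 1000000" "imb U V \<le> \<sigma> / 8"
proof -
  have "err U V \<le> cond_sqrt * err U V"
    using mult_right_mono[OF cond_sqrt_ge_1 err_nonneg] by simp
  then show "err U V \<le> \<sigma> / 1000000" using assms by (simp add: basin_def)
  have "0 \<le> 94 * cond_sqrt * err U V" using cond_sqrt_ge_1 err_nonneg[of U V] by simp
  then show "imb U V \<le> \<sigma> / 8" using assms by (simp add: basin_def)
qed

text \<open>The crude bound \<open>err'_le\<close> serves only to make \<open>near_RIP\<close>
  applicable to the new pair. The halving is then read off on \<open>\<Omega>\<close>:
  \<open>1 / 50\<close> from optimality and \<open>1 / 5\<close> from the second-order term, against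
  the lower isometry factor \<open>3 / 5\<close>.\<close>

lemma basin_step:
  assumes basin: "basin U V" and flat': "flat U' V'"
    and near: "(norm_F (U' - U))\<^sup>2 + (norm_F (V' - V))\<^sup>2 \<le> 8 / (p * \<sigma>) * (norm_F_on \<Omega> (U * V\<^sup>T - Xs))\<^sup>2"
    and min: "\<And>A B. flat A B \<Longrightarrow>
        (norm_F (A - U))\<^sup>2 + (norm_F (B - V))\<^sup>2 \<le> 8 / (p * \<sigma>) * (norm_F_on \<Omega> (U * V\<^sup>T - Xs))\<^sup>2 \<Longrightarrow>
        norm_F_on \<Omega> ((U * V'\<^sup>T + U' * V\<^sup>T - U * V\<^sup>T) - Xs) \<le> norm_F_on \<Omega> ((U * B\<^sup>T + A * V\<^sup>T - U * V\<^sup>T) - Xs)"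
  shows "err U' V' \<le> 1 / 2 * err U V" "basin U' V'"
proof -
  let ?e = "err U V" and ?k = "cond_sqrt"
  have e0: "0 \<le> ?e" by (rule err_nonneg)
  have flat: "flat U V" using basin by (simp add: basin_def)
  have e: "?e \<le> \<sigma> / 1000000" and imb: "imb U V \<le> \<sigma> / 8" using basin_err_le[OF basin] .
  have e': "?e \<le> \<sigma> / 4000" using e \<sigma> by simp
  have k: "1 \<le> ?k" by (rule cond_sqrt_ge_1)
  have ek: "?e \<le> ?k * ?e" using mult_right_mono[OF k e0] by simp
  interpret near_target n1 n2 r P S W Xs \<sigma>1 \<sigma> U V
    using flat e imb \<sigma> by unfold_locales (auto simp: flat_def err_def imb_def)
  have c': "U' \<in> carrier_mat n1 r" "V' \<in> carrier_mat n2 r" using flat' by (auto simp: flat_def)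
  have V'T: "V'\<^sup>T \<in> carrier_mat r n2" using c' by simp
  let ?DU = "U' - U" and ?DV = "V' - V"
  have DU: "?DU \<in> carrier_mat n1 r" and DV: "?DV \<in> carrier_mat n2 r"
    by (rule minus_carrier_mat[OF U], rule minus_carrier_mat[OF V])
  have DVT: "?DV\<^sup>T \<in> carrier_mat r n2" using DV by simp
  let ?d = "(norm_F ?DU)\<^sup>2 + (norm_F ?DV)\<^sup>2"
  have pos: "0 \<le> sqrt p * ?e" using p e0 by simp
  note RIP = near_RIP[OF flat e' imb]
  \<comment> \<open>\<open>128 = 8 * 4\<^sup>2\<close>, from the constraint and the upper isometry
    factor.\<close>
  have d: "?d \<le> 128 / \<sigma> * ?e\<^sup>2"
  proof -
    have "(norm_F_on \<Omega> (U * V\<^sup>T - Xs))\<^sup>2 \<le> (4 * (sqrt p * ?e))\<^sup>2" by (rule power_mono[OF RIP(2)]) simp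
    also have "\<dots> = 16 * (p * ?e\<^sup>2)" using p by (simp add: power_mult_distrib)
    finally have "8 / (p * \<sigma>) * (norm_F_on \<Omega> (U * V\<^sup>T - Xs))\<^sup>2 \<le> 8 / (p * \<sigma>) * (16 * (p * ?e\<^sup>2))"
      using p \<sigma> by (intro mult_left_mono) auto
    also have "\<dots> = 128 / \<sigma> * ?e\<^sup>2" using p by simp
    finally show ?thesis using near by linarith
  qed
  have d_le: "?d \<le> ?e"
  proof -
    have "128 / \<sigma> * ?e\<^sup>2 = 128 * (?e / \<sigma>) * ?e" by (simp add: power2_eq_square)
    also have "\<dots> \<le> 128 * (1 / 1000000) * ?e"
      using e e0 \<sigma> by (intro mult_right_mono mult_left_mono) (auto simp: field_simps)
    also have "\<dots> \<le> ?e" using e0 by simp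
    finally show ?thesis using d by linarith
  qed
  \<comment> \<open>The operator norm \<open>sqrt (2 * \<sigma>1)\<close> meets a step of order
    \<open>?e / sqrt \<sigma>\<close>, which produces \<open>cond_sqrt\<close>; 23 comes from
    \<open>2 * 256 \<le> 23\<^sup>2\<close>.\<close>
  have sum_le: "sqrt (2 * \<sigma>1) * (norm_F ?DU + norm_F ?DV) \<le> 23 * ?k * ?e"
  proof -
    have "(norm_F ?DU + norm_F ?DV)\<^sup>2 \<le> 2 * ?d"
      using sum_squares_bound[of "norm_F ?DU" "norm_F ?DV"] by (simp add: power2_sum)
    also have "\<dots> \<le> 256 / \<sigma> * ?e\<^sup>2" using d by simp
    finally have "2 * \<sigma>1 * (norm_F ?DU + norm_F ?DV)\<^sup>2 \<le> 2 * \<sigma>1 * (256 / \<sigma> * ?e\<^sup>2)"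
      using \<sigma> by (intro mult_left_mono) auto
    also have "\<dots> \<le> 529 * (\<sigma>1 / \<sigma>) * ?e\<^sup>2"
      using \<sigma> e0 by (simp add: field_simps)
    also have "\<dots> = (23 * ?k * ?e)\<^sup>2" using \<sigma> by (simp add: cond_sqrt_def power_mult_distrib)
    finally have "(sqrt (2 * \<sigma>1) * (norm_F ?DU + norm_F ?DV))\<^sup>2 \<le> (23 * ?k * ?e)\<^sup>2"
      using \<sigma> by (simp add: power_mult_distrib)
    then show ?thesis by (rule power2_le_imp_le) (use k e0 in simp)
  qed
  have s0: "0 \<le> sqrt (2 * \<sigma>1)" using \<sigma> by simp
  have U'_eq: "U' = U + ?DU" and V'_eq: "V' = V + ?DV"
    using U V c' by (auto intro!: eq_matI)
  have DD_c: "?DU * ?DV\<^sup>T \<in> carrier_mat n1 n2" by (rule mult_carrier_mat[OF DU DVT])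
  have X_c: "U * V'\<^sup>T \<in> carrier_mat n1 n2" "U' * V\<^sup>T \<in> carrier_mat n1 n2" "U' * V'\<^sup>T \<in> carrier_mat n1 n2"
    using mult_carrier_mat[OF U V'T] mult_carrier_mat[OF c'(1) VT] mult_carrier_mat[OF c'(1) V'T] .
  have lin_c: "(U * V'\<^sup>T + U' * V\<^sup>T - U * V\<^sup>T) - Xs \<in> carrier_mat n1 n2"
    by (rule minus_carrier_mat[OF Xs_carrier])
  have DD_eq: "?DU * ?DV\<^sup>T = (U' * V'\<^sup>T - U' * V\<^sup>T) - (U * V'\<^sup>T - U * V\<^sup>T)"
    by (rule diff_mult_transpose_diff[OF c' U V])
  have gen1: "X3 - X0 = (X1 + X2 - Y - X0) + ((X3 - X2) - (X1 - Y))"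
    if "X0 \<in> carrier_mat n1 n2" "X1 \<in> carrier_mat n1 n2" "X2 \<in> carrier_mat n1 n2" "X3 \<in> carrier_mat n1 n2"
      "Y \<in> carrier_mat n1 n2" for X0 X1 X2 X3 Y :: "real mat"
    using that by (intro eq_matI) auto
  have X'_eq: "U' * V'\<^sup>T - Xs = ((U * V'\<^sup>T + U' * V\<^sup>T - U * V\<^sup>T) - Xs) + ?DU * ?DV\<^sup>T"
    unfolding DD_eq by (rule gen1[OF Xs_carrier X_c UV_carrier])
  have err'_le: "err U' V' \<le> 25 * ?k * ?e"
  proof -
    have gen2: "(X1 + X2 - Y - X0) = (Y - X0) + ((X1 - Y) + (X2 - Y))"
      if "X0 \<in> carrier_mat n1 n2" "X1 \<in> carrier_mat n1 n2" "X2 \<in> carrier_mat n1 n2" "Y \<in> carrier_mat n1 n2"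
      for X0 X1 X2 Y :: "real mat"
      using that by (intro eq_matI) auto
    have a: "U * V'\<^sup>T - U * V\<^sup>T = U * ?DV\<^sup>T"
      unfolding transpose_minus[OF c'(2) V] by (rule mult_minus_distrib_mat[OF U V'T VT, symmetric])
    have b: "U' * V\<^sup>T - U * V\<^sup>T = ?DU * V\<^sup>T" by (rule minus_mult_distrib_mat[OF c'(1) U VT, symmetric])
    have ac: "U * ?DV\<^sup>T \<in> carrier_mat n1 n2" and bc: "?DU * V\<^sup>T \<in> carrier_mat n1 n2"
      by (rule mult_carrier_mat[OF U DVT], rule mult_carrier_mat[OF DU VT])
    have "(U * V'\<^sup>T + U' * V\<^sup>T - U * V\<^sup>T) - Xs = E + (U * ?DV\<^sup>T + ?DU * V\<^sup>T)"
      unfolding E_def a[symmetric] b[symmetric] by (rule gen2[OF Xs_carrier X_c(1,2) UV_carrier])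
    then have "err U' V' \<le> norm_F (E + (U * ?DV\<^sup>T + ?DU * V\<^sup>T)) + norm_F (?DU * ?DV\<^sup>T)"
      unfolding err_def X'_eq using norm_F_add_le[OF lin_c DD_c] by simp
    also have "\<dots> \<le> ?e + (norm_F (U * ?DV\<^sup>T) + norm_F (?DU * V\<^sup>T)) + norm_F (?DU * ?DV\<^sup>T)"
      using norm_F_add_le[OF E_carrier add_carrier_mat[OF bc], of "U * ?DV\<^sup>T"] norm_F_add_le[OF ac bc]
      by (simp add: err_def E_def)
    also have "norm_F (U * ?DV\<^sup>T) \<le> sqrt (2 * \<sigma>1) * norm_F ?DV"
      using norm_F_mult_le[OF op_le_U U DVT s0] by (simp only: norm_F_transpose)
    also have "norm_F (?DU * V\<^sup>T) \<le> sqrt (2 * \<sigma>1) * norm_F ?DU"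
      by (rule norm_F_mult_transpose_le[OF op_le_V V DU s0])
    also have "norm_F (?DU * ?DV\<^sup>T) \<le> ?d"
    proof -
      have "norm_F (?DU * ?DV\<^sup>T) \<le> norm_F ?DU * norm_F ?DV"
        using norm_F_mult_le_norm_F[OF DU DVT] by (simp only: norm_F_transpose)
      moreover have "0 \<le> norm_F ?DU * norm_F ?DV" by simp
      moreover have "2 * (norm_F ?DU * norm_F ?DV) \<le> ?d"
        using sum_squares_bound[of "norm_F ?DU" "norm_F ?DV"] by (simp add: mult.assoc)
      ultimately show ?thesis by linarith
    qed
    also have "?e + (sqrt (2 * \<sigma>1) * norm_F ?DV + sqrt (2 * \<sigma>1) * norm_F ?DU) + ?d \<le> 25 * ?k * ?e"
      using sum_le d_le ek by (simp add: distrib_left)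
    finally show ?thesis by simp
  qed
  \<comment> \<open>The first-order change of a Gram matrix consists of two equal terms, so
    \<open>47 = 2 * 23 + 1\<close>, where the 1 covers the squared step lengths.\<close>
  have imb'_le: "imb U' V' \<le> imb U V + 47 * ?k * ?e"
  proof -
    have GU: "U\<^sup>T * U \<in> carrier_mat r r" "V\<^sup>T * V \<in> carrier_mat r r" "U'\<^sup>T * U' \<in> carrier_mat r r" "V'\<^sup>T * V' \<in> carrier_mat r r"
      using U V c' by (auto intro: mult_carrier_mat)
    have gen3: "X - Y = (A - B) + ((X - A) - (Y - B))"
      if "X \<in> carrier_mat r r" "Y \<in> carrier_mat r r" "A \<in> carrier_mat r r" "B \<in> carrier_mat r r" for X Y A B :: "real mat"
      using that by (intro eq_matI) auto
    let ?A = "U'\<^sup>T * U' - U\<^sup>T * U" and ?B = "V'\<^sup>T * V' - V\<^sup>T * V"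
    have c: "?A \<in> carrier_mat r r" "?B \<in> carrier_mat r r"
      by (rule minus_carrier_mat[OF GU(1)], rule minus_carrier_mat[OF GU(2)])
    have "imb U' V' \<le> imb U V + norm_F (?A - ?B)"
      unfolding imb_def
      by (subst gen3[OF GU(3,4,1,2)]) (rule norm_F_add_le[OF minus_carrier_mat[OF GU(2)] minus_carrier_mat[OF c(2)]])
    also have "norm_F (?A - ?B) \<le> norm_F ?A + norm_F ?B" by (rule norm_F_diff_le[OF c])
    also have "norm_F ?A \<le> 2 * sqrt (2 * \<sigma>1) * norm_F ?DU + (norm_F ?DU)\<^sup>2"
      using norm_F_Gram_diff_le[OF U DU op_le_U s0] unfolding U'_eq[symmetric] .
    also have "norm_F ?B \<le> 2 * sqrt (2 * \<sigma>1) * norm_F ?DV + (norm_F ?DV)\<^sup>2"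
      using norm_F_Gram_diff_le[OF V DV op_le_V s0] unfolding V'_eq[symmetric] .
    finally show ?thesis using sum_le d_le ek by (simp add: distrib_left)
  qed
  have ke: "?k * ?e \<le> \<sigma> / 1000000" and imb2: "imb U V + 94 * ?k * ?e \<le> \<sigma> / 8"
    using basin by (auto simp: basin_def)
  have e'2: "err U' V' \<le> \<sigma> / 4000" using err'_le ke \<sigma> by simp
  have imb'2: "imb U' V' \<le> \<sigma> / 8" using imb'_le imb2 ek e0 by linarith
  note RIP' = near_RIP[OF flat' e'2 imb'2]
  obtain A B where AB: "flat A B" "A * B\<^sup>T = Xs"
    and AB_d: "(norm_F (U - A))\<^sup>2 + (norm_F (V - B))\<^sup>2 \<le> 8 / (3 * \<sigma>) * ?e\<^sup>2"
    and AB_O: "norm_F_on \<Omega> ((U - A) * (V - B)\<^sup>T) \<le> 1 / 50 * (sqrt p * ?e)"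
    using RIP(3) by blast
  have ABc: "A \<in> carrier_mat n1 r" "B \<in> carrier_mat n2 r" using AB by (auto simp: flat_def)
  have swap: "norm_F (A - U) = norm_F (U - A)" "norm_F (B - V) = norm_F (V - B)"
  proof -
    have "A - U = - (U - A)" "B - V = - (V - B)" using U V ABc by (auto intro!: eq_matI)
    then show "norm_F (A - U) = norm_F (U - A)" "norm_F (B - V) = norm_F (V - B)"
      using norm_F_on_uminus[OF minus_carrier_mat[OF ABc(1)] order_refl, of U]
        norm_F_on_uminus[OF minus_carrier_mat[OF ABc(2)] order_refl, of V] U V ABc
      by (simp_all add: norm_F_def)
  qed
  \<comment> \<open>Feasibility of the aligned pair: \<open>9 / 25 \<ge> 1 / 3\<close> makes the
    constraint radius at least the distance bound with constant
    \<open>8 / (3 * \<sigma>)\<close>.\<close>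
  have "(3 / 5 * (sqrt p * ?e))\<^sup>2 \<le> (norm_F_on \<Omega> (U * V\<^sup>T - Xs))\<^sup>2" by (rule power_mono[OF RIP(1)]) (use p e0 in simp)
  moreover have "(3 / 5 * (sqrt p * ?e))\<^sup>2 = 9 / 25 * (p * ?e\<^sup>2)"
    using p by (simp add: power_mult_distrib power_divide)
  moreover have "0 \<le> p * ?e\<^sup>2" using p by simp
  ultimately have "p * ?e\<^sup>2 / 3 \<le> (norm_F_on \<Omega> (U * V\<^sup>T - Xs))\<^sup>2" by linarith
  then have "8 / (p * \<sigma>) * (p * ?e\<^sup>2 / 3) \<le> 8 / (p * \<sigma>) * (norm_F_on \<Omega> (U * V\<^sup>T - Xs))\<^sup>2"
    using p \<sigma> by (intro mult_left_mono) auto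
  moreover have "8 / (p * \<sigma>) * (p * ?e\<^sup>2 / 3) = 8 / (3 * \<sigma>) * ?e\<^sup>2" using p by simp
  ultimately have "(norm_F (A - U))\<^sup>2 + (norm_F (B - V))\<^sup>2 \<le> 8 / (p * \<sigma>) * (norm_F_on \<Omega> (U * V\<^sup>T - Xs))\<^sup>2"
    unfolding swap using AB_d by linarith
  from min[OF AB(1) this]
  have opt: "norm_F_on \<Omega> ((U * V'\<^sup>T + U' * V\<^sup>T - U * V\<^sup>T) - Xs) \<le> norm_F_on \<Omega> ((U * B\<^sup>T + A * V\<^sup>T - U * V\<^sup>T) - Xs)" .
  \<comment> \<open>Since \<open>A * B\<^sup>T\<close> is the target, the linearized residual of the
    aligned pair is exactly a product of differences.\<close>
  have "(U * B\<^sup>T + A * V\<^sup>T - U * V\<^sup>T) - Xs = - ((U - A) * (V - B)\<^sup>T)"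
  proof -
    have BT: "B\<^sup>T \<in> carrier_mat r n2" using ABc by simp
    have gen4: "(X1 + X2 - Y - X0) = - ((Y - X1) - (X2 - X0))"
      if "X0 \<in> carrier_mat n1 n2" "X1 \<in> carrier_mat n1 n2" "X2 \<in> carrier_mat n1 n2" "Y \<in> carrier_mat n1 n2"
      for X0 X1 X2 Y :: "real mat"
      using that by (intro eq_matI) auto
    show ?thesis
      unfolding diff_mult_transpose_diff[OF U V ABc] AB(2)
      by (rule gen4[OF Xs_carrier mult_carrier_mat[OF U BT] mult_carrier_mat[OF ABc(1) VT] UV_carrier])
  qed
  then have opt2: "norm_F_on \<Omega> ((U * V'\<^sup>T + U' * V\<^sup>T - U * V\<^sup>T) - Xs) \<le> 1 / 50 * (sqrt p * ?e)"
    using opt AB_O norm_F_on_uminus[OF _ \<Omega>, of "(U - A) * (V - B)\<^sup>T"]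
      mult_carrier_mat[OF minus_carrier_mat[OF ABc(1)], of "(V - B)\<^sup>T" n2 U] minus_carrier_mat[OF ABc(2), of V]
    by simp
  have DD: "norm_F_on \<Omega> (?DU * ?DV\<^sup>T) \<le> 1 / 5 * (sqrt p * ?e)"
    by (rule product_bound_near[OF flat' flat d e0 e']) (auto simp: power2_eq_square)
  have "norm_F_on \<Omega> (U' * V'\<^sup>T - Xs) \<le> 1 / 50 * (sqrt p * ?e) + 1 / 5 * (sqrt p * ?e)"
    unfolding X'_eq using norm_F_on_add_le[OF lin_c DD_c \<Omega>] opt2 DD by linarith
  then have "3 / 5 * (sqrt p * err U' V') \<le> 3 / 5 * (sqrt p * (1 / 2 * ?e))" using RIP'(1) pos by linarith
  then show half: "err U' V' \<le> 1 / 2 * ?e" using p by (simp add: mult_le_cancel_left)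
  have khalf: "?k * err U' V' \<le> 1 / 2 * (?k * ?e)" using mult_left_mono[OF half, of ?k] k by simp
  have ke0: "0 \<le> ?k * ?e" using k e0 by simp
  have "?k * err U' V' \<le> \<sigma> / 1000000" using khalf ke ke0 by linarith
  moreover have "imb U' V' + 94 * ?k * err U' V' \<le> \<sigma> / 8" using khalf imb'_le imb2 by linarith
  ultimately show "basin U' V'" using flat' by (simp add: basin_def)
qed

end

section \<open>Singular values\<close>

lemma const_poly_sum: "[:sum f A:] = (\<Sum>a\<in>A. [:f a:])"
proof (induction A rule: infinite_finite_induct)
  case (insert x F)
  have "[:sum f (insert x F):] = [:f x:] + [:sum f F:]" using insert.hyps by simp
  then show ?case using insert by simp
qed simp_all

lemma map_mat_const_mult:
  fixes A B :: "'a :: comm_ring_1 mat"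
  assumes "A \<in> carrier_mat n k" "B \<in> carrier_mat k l"
  shows "map_mat (\<lambda>a. [:a:]) (A * B) = map_mat (\<lambda>a. [:a:]) A * map_mat (\<lambda>a. [:a:]) B"
  using assms by (intro eq_matI) (auto simp: scalar_prod_def const_poly_sum mult.commute)

text \<open>The two factors appear separately over the polynomial ring, as the block eliminations
  require.\<close>

lemma char_poly_matrix_mult:
  fixes A B :: "'a :: comm_ring_1 mat"
  assumes A: "A \<in> carrier_mat n k" and B: "B \<in> carrier_mat k n"
  shows "char_poly_matrix (A * B)
    = [:0, 1:] \<cdot>\<^sub>m 1\<^sub>m n - map_mat (\<lambda>a. [:a:]) A * map_mat (\<lambda>a. [:a:]) B"
  unfolding map_mat_const_mult[OF A B, symmetric] char_poly_matrix_def
  using A B by (intro eq_matI) (auto simp del: index_mult_mat simp: index_mult_mat(2,3))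

text \<open>Sylvester's identity, read off from the two block eliminations of the matrix with the blocks
  \<open>x I\<close>, \<open>A\<close>, \<open>B\<close>, \<open>I\<close>.\<close>

lemma char_poly_mult_commute:
  fixes A B :: "'a :: idom mat"
  assumes A: "A \<in> carrier_mat n k" and B: "B \<in> carrier_mat k n"
  shows "[:0, 1:] ^ k * char_poly (A * B) = [:0, 1:] ^ n * char_poly (B * A)"
proof -
  let ?x = "[:0, 1:] :: 'a poly"
  define A' where "A' = map_mat (\<lambda>a. [:a:]) A"
  define B' where "B' = map_mat (\<lambda>a. [:a:]) B"
  have A': "A' \<in> carrier_mat n k" and B': "B' \<in> carrier_mat k n" and mB': "- B' \<in> carrier_mat k n"
    using A B by (auto simp: A'_def B'_def)
  have c: "?x \<cdot>\<^sub>m 1\<^sub>m n \<in> carrier_mat n n" "?x \<cdot>\<^sub>m 1\<^sub>m k \<in> carrier_mat k k" by auto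
  have one: "1\<^sub>m n \<in> carrier_mat n n" "1\<^sub>m k \<in> carrier_mat k k" and zero: "0\<^sub>m n k \<in> carrier_mat n k" by auto
  define M where "M = four_block_mat (?x \<cdot>\<^sub>m 1\<^sub>m n) A' B' (1\<^sub>m k)"
  define R where "R = four_block_mat (1\<^sub>m n) (0\<^sub>m n k) (- B') (1\<^sub>m k :: 'a poly mat)"
  define L where "L = four_block_mat (1\<^sub>m n) (0\<^sub>m n k) (- B') (?x \<cdot>\<^sub>m 1\<^sub>m k)"
  have carr: "M \<in> carrier_mat (n + k) (n + k)" "R \<in> carrier_mat (n + k) (n + k)" "L \<in> carrier_mat (n + k) (n + k)"
    unfolding M_def R_def L_def using c one by auto
  have xB: "(?x \<cdot>\<^sub>m 1\<^sub>m k) * B' = ?x \<cdot>\<^sub>m B'" "B' * (?x \<cdot>\<^sub>m 1\<^sub>m n) = ?x \<cdot>\<^sub>m B'"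
    using B' mult_smult_assoc_mat[OF one(2) B'] mult_smult_distrib[OF B' one(1)] by auto
  have neg: "A' * (- B') = - (A' * B')" "(- B') * (?x \<cdot>\<^sub>m 1\<^sub>m n) = - (B' * (?x \<cdot>\<^sub>m 1\<^sub>m n))"
    "(- B') * A' = - (B' * A')"
    using A' B' by simp_all
  have neg_add: "- X + Y = Y - X" if "X \<in> carrier_mat k k" "Y \<in> carrier_mat k k" for X Y :: "'a poly mat"
    using that by (intro eq_matI) auto
  have AB: "A' * B' \<in> carrier_mat n n" and BA: "B' * A' \<in> carrier_mat k k"
    by (rule mult_carrier_mat[OF A' B'], rule mult_carrier_mat[OF B' A'])
  have "M * R = four_block_mat (?x \<cdot>\<^sub>m 1\<^sub>m n * 1\<^sub>m n + A' * (- B')) (?x \<cdot>\<^sub>m 1\<^sub>m n * 0\<^sub>m n k + A' * 1\<^sub>m k)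
      (B' * 1\<^sub>m n + 1\<^sub>m k * (- B')) (B' * 0\<^sub>m n k + 1\<^sub>m k * 1\<^sub>m k)"
    unfolding M_def R_def by (rule mult_four_block_mat[OF c(1) A' B' one(2) one(1) zero mB' one(2)])
  also have "?x \<cdot>\<^sub>m 1\<^sub>m n * 1\<^sub>m n + A' * (- B') = char_poly_matrix (A * B)"
    unfolding char_poly_matrix_mult[OF A B] A'_def[symmetric] B'_def[symmetric] neg
    using AB c(1) by (intro eq_matI) (auto simp del: index_mult_mat(1) simp: right_mult_one_mat[OF c(1)])
  also have "?x \<cdot>\<^sub>m 1\<^sub>m n * 0\<^sub>m n k + A' * 1\<^sub>m k = A'"
    using A' c(1) by (simp add: right_mult_one_mat[OF A'] right_mult_zero_mat[OF c(1)])
  also have "B' * 1\<^sub>m n + 1\<^sub>m k * (- B') = 0\<^sub>m k n"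
    unfolding right_mult_one_mat[OF B'] left_mult_one_mat[OF mB'] using B' by (intro eq_matI) auto
  also have "B' * 0\<^sub>m n k + 1\<^sub>m k * 1\<^sub>m k = 1\<^sub>m k"
    using B' by (simp add: right_mult_zero_mat[OF B'])
  finally have "det (M * R) = det (char_poly_matrix (A * B)) * det (1\<^sub>m k :: 'a poly mat)"
    using A B A' by (simp only:) (rule det_four_block_mat_lower_left_zero, auto)
  moreover have "det R = 1"
    unfolding R_def using det_four_block_mat_upper_right_zero[OF one(1) refl mB' one(2)] by simp
  ultimately have M1: "det M = char_poly (A * B)"
    using det_mult[OF carr(1,2)] by (simp add: char_poly_def)
  have "L * M = four_block_mat (1\<^sub>m n * (?x \<cdot>\<^sub>m 1\<^sub>m n) + 0\<^sub>m n k * B') (1\<^sub>m n * A' + 0\<^sub>m n k * 1\<^sub>m k)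
      (- B' * (?x \<cdot>\<^sub>m 1\<^sub>m n) + ?x \<cdot>\<^sub>m 1\<^sub>m k * B') (- B' * A' + ?x \<cdot>\<^sub>m 1\<^sub>m k * 1\<^sub>m k)"
    unfolding M_def L_def by (rule mult_four_block_mat[OF one(1) zero mB' c(2) c(1) A' B' one(2)])
  also have "1\<^sub>m n * (?x \<cdot>\<^sub>m 1\<^sub>m n) + 0\<^sub>m n k * B' = ?x \<cdot>\<^sub>m 1\<^sub>m n"
    using B' c(1) by (simp add: left_mult_one_mat[OF c(1)] left_mult_zero_mat[OF B'])
  also have "1\<^sub>m n * A' + 0\<^sub>m n k * 1\<^sub>m k = A'"
    using A' by (simp add: left_mult_one_mat[OF A'])
  also have "- B' * (?x \<cdot>\<^sub>m 1\<^sub>m n) + ?x \<cdot>\<^sub>m 1\<^sub>m k * B' = 0\<^sub>m k n"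
    unfolding neg xB using B' by (intro eq_matI) auto
  also have "- B' * A' + ?x \<cdot>\<^sub>m 1\<^sub>m k * 1\<^sub>m k = char_poly_matrix (B * A)"
    unfolding char_poly_matrix_mult[OF B A] A'_def[symmetric] B'_def[symmetric] neg right_mult_one_mat[OF c(2)]
    by (rule neg_add[OF BA c(2)])
  finally have "det (L * M) = det (?x \<cdot>\<^sub>m 1\<^sub>m n) * det (char_poly_matrix (B * A))"
    using A B A' by (simp only:) (rule det_four_block_mat_lower_left_zero, auto)
  moreover have "det L = ?x ^ k"
    unfolding L_def using det_four_block_mat_upper_right_zero[OF one(1) refl mB' c(2)] by simp
  ultimately have "?x ^ k * det M = ?x ^ n * char_poly (B * A)"
    using det_mult[OF carr(3,1)] by (simp add: char_poly_def)
  then show ?thesis unfolding M1 .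
qed

lemma proots_prod_linear:
  "proots (\<Prod>a\<leftarrow>as. [:- a, 1:]) = mset (as :: 'a :: idom list)"
proof (induction as)
  case (Cons a as)
  have "(\<Prod>a\<leftarrow>as. [:- a, 1:]) \<noteq> 0" by (simp only: prod_list_zero_iff) auto
  then have "proots ([:- a, 1:] * (\<Prod>a\<leftarrow>as. [:- a, 1:])) = proots [:- a, 1:] + proots (\<Prod>a\<leftarrow>as. [:- a, 1:])"
    by (intro proots_mult) auto
  then show ?case using Cons by simp
qed simp

text \<open>\<open>X\<^sup>T * X\<close> is \<open>W (D W\<^sup>T)\<close> with
  \<open>D = S\<^sup>T * S\<close>. Exchanging the two factors gives
  \<open>D W\<^sup>T W = D\<close>, whose characteristic polynomial is read off its diagonal; the
  powers of the variable account for zero eigenvalues.\<close>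

lemma singular_value_svd:
  assumes svd: "is_svd n1 n2 r X P S W" and i: "i < r"
  shows "singular_value (Suc i) X = S $$ (i, i)"
proof -
  have P: "P \<in> carrier_mat n1 r" and S: "S \<in> carrier_mat r r" and W: "W \<in> carrier_mat n2 r"
    and PP: "P\<^sup>T * P = 1\<^sub>m r" and WW: "W\<^sup>T * W = 1\<^sub>m r" and diag: "diagonal_mat S"
    and pos: "\<And>i. i < r \<Longrightarrow> 0 < S $$ (i, i)" and dec: "\<And>i j. i \<le> j \<Longrightarrow> j < r \<Longrightarrow> S $$ (j, j) \<le> S $$ (i, i)"
    and X: "X = P * S * W\<^sup>T"
    using svd by (auto simp: is_svd_def)
  let ?as = "map (\<lambda>i. (S $$ (i, i))\<^sup>2) [0..<r]"
  define D where "D = S\<^sup>T * S"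
  have T: "P\<^sup>T \<in> carrier_mat r n1" "S\<^sup>T \<in> carrier_mat r r" "W\<^sup>T \<in> carrier_mat r n2" using P S W by auto
  have D: "D \<in> carrier_mat r r" unfolding D_def by (rule mult_carrier_mat[OF T(2) S])
  have SWT: "S * W\<^sup>T \<in> carrier_mat r n2" by (rule mult_carrier_mat[OF S T(3)])
  have SWTT: "(S * W\<^sup>T)\<^sup>T \<in> carrier_mat n2 r" using SWT by simp
  have DWT: "D * W\<^sup>T \<in> carrier_mat r n2" by (rule mult_carrier_mat[OF D T(3)])
  have D_entry: "D $$ (i, j) = (if i = j then (S $$ (i, i))\<^sup>2 else 0)" if "i < r" "j < r" for i j
  proof -
    have "D $$ (i, j) = (\<Sum>k<r. S $$ (k, i) * S $$ (k, j))"
      using S that by (simp add: D_def scalar_prod_def atLeast0LessThan)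
    also have "\<dots> = (\<Sum>k<r. if k = i then S $$ (i, i) * S $$ (i, j) else 0)"
      using diag S that by (intro sum.cong) (auto simp: diagonal_mat_def)
    finally show ?thesis using diag S that by (auto simp: diagonal_mat_def power2_eq_square)
  qed
  have "X\<^sup>T * X = W * (D * W\<^sup>T)"
  proof -
    have "X = P * (S * W\<^sup>T)" unfolding X by (rule assoc_mult_mat[OF P S T(3)])
    then have "X\<^sup>T = (S * W\<^sup>T)\<^sup>T * P\<^sup>T" and "X = P * (S * W\<^sup>T)" using transpose_mult[OF P SWT] by simp_all
    then have "X\<^sup>T * X = (S * W\<^sup>T)\<^sup>T * (P\<^sup>T * (P * (S * W\<^sup>T)))"
      using assoc_mult_mat[OF SWTT T(1) mult_carrier_mat[OF P SWT]] by (simp only:)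
    also have "P\<^sup>T * (P * (S * W\<^sup>T)) = S * W\<^sup>T" by (rule orthonormal_cancel[OF P PP SWT])
    also have "(S * W\<^sup>T)\<^sup>T = W * S\<^sup>T" using transpose_mult[OF S T(3)] by simp
    also have "W * S\<^sup>T * (S * W\<^sup>T) = W * (S\<^sup>T * (S * W\<^sup>T))" by (rule assoc_mult_mat[OF W T(2) SWT])
    also have "S\<^sup>T * (S * W\<^sup>T) = D * W\<^sup>T" unfolding D_def by (rule assoc_mult_mat[symmetric, OF T(2) S T(3)])
    finally show ?thesis .
  qed
  moreover have "D * W\<^sup>T * W = D"
    using assoc_mult_mat[OF D T(3) W] D by (simp add: WW right_mult_one_mat[OF D])
  ultimately have cp: "[:0, 1:] ^ r * char_poly (X\<^sup>T * X) = [:0, 1:] ^ n2 * char_poly D"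
    using char_poly_mult_commute[OF W DWT] by simp
  have "upper_triangular D" using D D_entry by (auto simp: upper_triangular_def)
  moreover have "diag_mat D = ?as" using D D_entry by (auto simp: diag_mat_def)
  ultimately have cpD: "char_poly D = (\<Prod>a\<leftarrow>?as. [:- a, 1:])"
    using char_poly_upper_triangular[OF D] by (simp only:)
  have prD: "proots (char_poly D) = mset ?as" unfolding cpD by (rule proots_prod_linear)
  have "char_poly D \<noteq> 0" unfolding cpD prod_list_zero_iff by auto
  moreover from this have "[:0, 1:] ^ r * char_poly (X\<^sup>T * X) \<noteq> 0" unfolding cp by simp
  then have "char_poly (X\<^sup>T * X) \<noteq> 0" by auto
  ultimately have "repeat_mset r {#0#} + proots (char_poly (X\<^sup>T * X)) = repeat_mset n2 {#0#} + mset ?as"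
    using arg_cong[OF cp, of proots] proots_linear_factor[of "0 :: real"]
    by (simp add: proots_mult proots_power prD del: proots_linear_factor)
  then have eq: "replicate_mset r 0 + proots (char_poly (X\<^sup>T * X)) = replicate_mset n2 0 + mset ?as" by simp
  \<comment> \<open>The multiplicity of the eigenvalue 0. The diagonal entries of \<open>D\<close>
    are positive, so counting zeros on both sides gives \<open>r + c = n2\<close>, and the
    \<open>r\<close> extra zeros cancel.\<close>
  define c where "c = count (proots (char_poly (X\<^sup>T * X))) 0"
  have "0 \<notin> set ?as" using pos by force
  then have "count (mset ?as) 0 = 0" by (simp add: count_eq_zero_iff)
  then have "r + c = n2" using arg_cong[OF eq, of "\<lambda>M. count M 0"] by (simp add: c_def)
  then have "replicate_mset n2 (0 :: real) = replicate_mset r 0 + replicate_mset c 0"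
    by (intro multiset_eqI) auto
  then have "proots (char_poly (X\<^sup>T * X)) = replicate_mset c 0 + mset ?as"
    using eq by (simp only: add.assoc add_left_cancel)
  also have "\<dots> = mset (replicate c 0 @ rev ?as)" by simp
  finally have "sorted_list_of_multiset (proots (char_poly (X\<^sup>T * X))) = sort (replicate c 0 @ rev ?as)"
    by (simp only: sorted_list_of_multiset_mset)
  also have "\<dots> = replicate c 0 @ rev ?as"
  proof (rule sorted_sort_id)
    have "sorted (rev ?as)"
      unfolding sorted_iff_nth_mono
    proof (intro allI impI)
      fix i j assume ij: "i \<le> j" "j < length (rev ?as)"
      then have lt: "r - Suc j \<le> r - Suc i" "r - Suc i < r" "r - Suc j < r" by auto
      have "(S $$ (r - Suc i, r - Suc i))\<^sup>2 \<le> (S $$ (r - Suc j, r - Suc j))\<^sup>2"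
        using dec[OF lt(1,2)] pos[OF lt(2)] by (intro power_mono) auto
      then show "rev ?as ! i \<le> rev ?as ! j" using ij lt by (simp add: rev_nth)
    qed
    then show "sorted (replicate c 0 @ rev ?as)" by (auto simp: sorted_append)
  qed
  finally have "rev (sorted_list_of_multiset (proots (char_poly (X\<^sup>T * X)))) = ?as @ replicate c 0" by simp
  then have "singular_value (Suc i) X = sqrt ((S $$ (i, i))\<^sup>2)"
    using i by (simp add: singular_value_def nth_append)
  then show ?thesis using pos[OF i] by simp
qed

text \<open>For a diagonal core the operator bounds are its extreme diagonal entries, which are the
  first and the \<open>r\<close>-th singular value.\<close>

lemma svd_target:
  assumes svd: "is_svd n1 n2 r X P S W" and r: "1 \<le> r"
  shows "target n1 n2 r P S W X (singular_value 1 X) (singular_value r X)"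
proof -
  have P: "P \<in> carrier_mat n1 r" and S: "S \<in> carrier_mat r r" and W: "W \<in> carrier_mat n2 r"
    and diag: "diagonal_mat S"
    and pos: "\<And>i. i < r \<Longrightarrow> 0 < S $$ (i, i)" and dec: "\<And>i j. i \<le> j \<Longrightarrow> j < r \<Longrightarrow> S $$ (j, j) \<le> S $$ (i, i)"
    using svd by (auto simp: is_svd_def)
  have s1: "singular_value 1 X = S $$ (0, 0)" using singular_value_svd[OF svd, of 0] r by simp
  have sr: "singular_value r X = S $$ (r - 1, r - 1)" using singular_value_svd[OF svd, of "r - 1"] r by simp
  have norm: "(vnorm (S *\<^sub>v v))\<^sup>2 = (\<Sum>i<r. (S $$ (i, i))\<^sup>2 * (v $ i)\<^sup>2)" if v: "v \<in> carrier_vec r" for v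
  proof -
    have "(S *\<^sub>v v) $ i = S $$ (i, i) * v $ i" if i: "i < r" for i
    proof -
      have "(S *\<^sub>v v) $ i = (\<Sum>k<r. S $$ (i, k) * v $ k)"
        using S v i by (simp add: scalar_prod_def atLeast0LessThan)
      also have "\<dots> = (\<Sum>k<r. if k = i then S $$ (i, i) * v $ i else 0)"
        using diag S i by (intro sum.cong) (auto simp: diagonal_mat_def)
      finally show ?thesis using i by simp
    qed
    then show ?thesis using S by (simp add: vnorm_def L2_set_def sum_nonneg power_mult_distrib del: index_mult_mat_vec)
  qed
  have norm_v: "(vnorm v)\<^sup>2 = (\<Sum>i<r. (v $ i)\<^sup>2)" if "v \<in> carrier_vec r" for v
    using that by (simp add: vnorm_def L2_set_def sum_nonneg)
  have "op_le S (S $$ (0, 0))"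
  proof (rule op_leI[OF S])
    fix v :: "real vec" assume v: "v \<in> carrier_vec r"
    have "(vnorm (S *\<^sub>v v))\<^sup>2 \<le> (\<Sum>i<r. (S $$ (0, 0))\<^sup>2 * (v $ i)\<^sup>2)"
      unfolding norm[OF v] using pos dec by (intro sum_mono mult_right_mono power_mono) (auto intro: less_imp_le)
    also have "\<dots> = (S $$ (0, 0) * vnorm v)\<^sup>2"
      by (simp add: power_mult_distrib norm_v[OF v] sum_distrib_left)
    finally show "vnorm (S *\<^sub>v v) \<le> S $$ (0, 0) * vnorm v"
      by (rule power2_le_imp_le) (use pos[of 0] r in simp)
  qed
  moreover have "op_ge S (S $$ (r - 1, r - 1))"
  proof (rule op_geI[OF S])
    fix v :: "real vec" assume v: "v \<in> carrier_vec r"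
    have "(S $$ (r - 1, r - 1) * vnorm v)\<^sup>2 = (\<Sum>i<r. (S $$ (r - 1, r - 1))\<^sup>2 * (v $ i)\<^sup>2)"
      by (simp add: power_mult_distrib norm_v[OF v] sum_distrib_left)
    also have "\<dots> \<le> (vnorm (S *\<^sub>v v))\<^sup>2"
      unfolding norm[OF v] using pos[of "r - 1"] dec r by (intro sum_mono mult_right_mono power_mono) auto
    finally show "S $$ (r - 1, r - 1) * vnorm v \<le> vnorm (S *\<^sub>v v)" by (rule power2_le_imp_le) simp
  qed
  moreover have "S\<^sup>T = S" using S diag by (intro eq_matI) (auto simp: diagonal_mat_def, metis)
  ultimately show ?thesis
    using svd pos[of "r - 1"] dec[of 0 "r - 1"] r unfolding s1 sr target_def is_svd_def by simp
qed

section \<open>Probability of the favourable samples\<close>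

text \<open>Cauchy-Schwarz in each entry reduces the product to squared row norms, to which the
  rectangle bound extends. The factor 8 suffices because \<open>exp 2 \<le> 9\<close> and
  \<open>9 x y \<le> 8 (x + y)^2\<close>.\<close>

lemma product_bound_of_discrepancy:
  assumes disc: "discrepancy_bound n1 n2 p \<rho> \<Omega>" and \<Omega>: "\<Omega> \<subseteq> {..<n1} \<times> {..<n2}"
    and p: "0 \<le> p" and b: "0 < b" and \<theta>: "42 * \<rho> * b \<le> p * \<theta>"
    and A: "A \<in> carrier_mat n1 r" and B: "B \<in> carrier_mat n2 r"
    and Ab: "\<And>i. i < n1 \<Longrightarrow> (vnorm (row A i))\<^sup>2 \<le> b" and Bb: "\<And>j. j < n2 \<Longrightarrow> (vnorm (row B j))\<^sup>2 \<le> b"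
  shows "(norm_F_on \<Omega> (A * B\<^sup>T))\<^sup>2
    \<le> p * (8 * ((norm_F A)\<^sup>2 + (norm_F B)\<^sup>2)\<^sup>2 + \<theta> * ((norm_F A)\<^sup>2 + (norm_F B)\<^sup>2))"
proof -
  let ?x = "(norm_F A)\<^sup>2" and ?y = "(norm_F B)\<^sup>2"
  have "(norm_F_on \<Omega> (A * B\<^sup>T))\<^sup>2 = (\<Sum>ij\<in>\<Omega>. ((A * B\<^sup>T) $$ ij)\<^sup>2)"
    by (simp add: norm_F_on_def L2_set_def sum_nonneg)
  also have "\<dots> \<le> (\<Sum>(i, j)\<in>\<Omega>. (vnorm (row A i))\<^sup>2 * (vnorm (row B j))\<^sup>2)"
  proof (rule sum_mono, clarify)
    fix i j assume "(i, j) \<in> \<Omega>"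
    then have ij: "i < n1" "j < n2" using \<Omega> by auto
    have "(A * B\<^sup>T) $$ (i, j) = row A i \<bullet> row B j" using A B ij by simp
    moreover have "\<bar>row A i \<bullet> row B j\<bar> \<le> vnorm (row A i) * vnorm (row B j)"
      using A B ij by (intro abs_scalar_prod_le[of _ r]) auto
    ultimately have "\<bar>(A * B\<^sup>T) $$ (i, j)\<bar>\<^sup>2 \<le> (vnorm (row A i) * vnorm (row B j))\<^sup>2"
      by (intro power_mono) auto
    then show "((A * B\<^sup>T) $$ (i, j))\<^sup>2 \<le> (vnorm (row A i))\<^sup>2 * (vnorm (row B j))\<^sup>2"
      by (simp only: power_mult_distrib power2_abs)
  qed
  also have "\<dots> \<le> exp 2 * p * (\<Sum>i<n1. (vnorm (row A i))\<^sup>2) * (\<Sum>j<n2. (vnorm (row B j))\<^sup>2)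
     + 42 * \<rho> * b * ((\<Sum>i<n1. (vnorm (row A i))\<^sup>2) + (\<Sum>j<n2. (vnorm (row B j))\<^sup>2))"
    using Ab Bb by (intro discrepancy_bound_sum_le[OF disc \<Omega> _ _ b]) auto
  also have "\<dots> = exp 2 * p * ?x * ?y + 42 * \<rho> * b * (?x + ?y)"
    by (simp add: norm_F_square_rows[OF A] norm_F_square_rows[OF B])
  also have "exp 2 * p * ?x * ?y \<le> p * (8 * (?x + ?y)\<^sup>2)"
  proof -
    have "exp (2 :: real) = exp 1 ^ 2" by (simp flip: exp_of_nat_mult)
    also have "\<dots> \<le> 3 ^ 2" using exp_le by (intro power_mono) auto
    finally have "exp (2 :: real) \<le> 9" by simp
    then have "exp 2 * (?x * ?y) \<le> 9 * (?x * ?y)" by (rule mult_right_mono) simp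
    also have "\<dots> \<le> 8 * (?x + ?y)\<^sup>2"
    proof -
      have "0 \<le> ?x * ?y" "0 \<le> ?x * ?x" "0 \<le> ?y * ?y" by simp_all
      then show ?thesis by (simp only: power2_eq_square[of "_ + _"] distrib_left distrib_right mult.commute[of ?y ?x])
    qed
    finally have "p * (exp 2 * (?x * ?y)) \<le> p * (8 * (?x + ?y)\<^sup>2)" using p by (rule mult_left_mono)
    then show ?thesis by (simp add: mult_ac)
  qed
  also have "42 * \<rho> * b * (?x + ?y) \<le> p * \<theta> * (?x + ?y)" using \<theta> by (rule mult_right_mono) simp
  finally show ?thesis by (simp add: distrib_left mult.assoc)
qed

lemma orthonormal_cols_sum:
  assumes P: "P \<in> carrier_mat n r" and PP: "P\<^sup>T * P = 1\<^sub>m r" and ab: "a < r" "b < r"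
  shows "(\<Sum>i<n. P $$ (i, a) * P $$ (i, b)) = (if a = b then 1 else 0)"
proof -
  have "(\<Sum>i<n. P $$ (i, a) * P $$ (i, b)) = (P\<^sup>T * P) $$ (a, b)"
    using P ab by (simp add: scalar_prod_def atLeast0LessThan)
  then show ?thesis using ab by (simp add: PP)
qed

text \<open>Valid for every real \<open>c\<close>: if \<open>c\<close> is negative, then so is
  \<open>sqrt c\<close>, and both sides are false.\<close>

lemma norm_2_inf_le_sqrt_iff:
  assumes A: "A \<in> carrier_mat n k" and n: "0 < n"
  shows "norm_2_inf A \<le> sqrt c \<longleftrightarrow> (\<forall>i<n. (vnorm (row A i))\<^sup>2 \<le> c)"
proof -
  have "norm_2_inf A = (MAX i\<in>{..<n}. vnorm (row A i))"
    using A unfolding norm_2_inf_def vnorm_def by (intro arg_cong[where f = Max] image_cong) (auto intro!: L2_set_cong)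
  then have "norm_2_inf A \<le> sqrt c \<longleftrightarrow> (\<forall>i<n. vnorm (row A i) \<le> sqrt c)"
    using n by (simp only:, subst Max_le_iff) auto
  also have "\<dots> \<longleftrightarrow> (\<forall>i<n. (vnorm (row A i))\<^sup>2 \<le> c)"
    by (metis real_le_rsqrt real_sqrt_le_iff real_sqrt_unique vnorm_nonneg)
  finally show ?thesis .
qed

context target begin

sublocale space: tangent_space n1 n2 r "\<lambda>i a. P $$ (i, a)" "\<lambda>j a. W $$ (j, a)"
  by unfold_locales (simp_all add: orthonormal_cols_sum[OF P PP] orthonormal_cols_sum[OF W WW])

lemma tangent_mat:
  assumes A: "A \<in> carrier_mat r n2" and B: "B \<in> carrier_mat n1 r"
  shows "space.tangent (\<lambda>ij. (P * A + B * W\<^sup>T) $$ ij)"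
  unfolding space.tangent_def
proof (intro exI allI impI)
  fix i j assume "i < n1" "j < n2"
  then show "(P * A + B * W\<^sup>T) $$ (i, j)
      = (\<Sum>a<r. P $$ (i, a) * A $$ (a, j)) + (\<Sum>a<r. B $$ (i, a) * W $$ (j, a))"
    using A B P W by (simp add: scalar_prod_def atLeast0LessThan)
qed

lemma sampled_targetI:
  assumes \<Omega>: "\<Omega> \<subseteq> {..<n1} \<times> {..<n2}" and p: "0 < p" and b: "0 < b"
    and disc: "discrepancy_bound n1 n2 p \<rho> \<Omega>" and \<theta>: "42 * \<rho> * b \<le> p * (\<sigma> / 10000)"
    and upper: "\<forall>Z. space.tangent Z \<longrightarrow> (\<Sum>q\<in>\<Omega>. (Z q)\<^sup>2) \<le> 8 * p * (\<Sum>q\<in>{..<n1} \<times> {..<n2}. (Z q)\<^sup>2)"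
    and lower: "\<forall>Z. space.tangent Z \<longrightarrow> p / 2 * (\<Sum>q\<in>{..<n1} \<times> {..<n2}. (Z q)\<^sup>2) \<le> (\<Sum>q\<in>\<Omega>. (Z q)\<^sup>2)"
    and rows: "\<And>i. i < n1 \<Longrightarrow> (vnorm (row P i))\<^sup>2 \<le> m1" "\<And>j. j < n2 \<Longrightarrow> (vnorm (row W j))\<^sup>2 \<le> m2"
    and m: "12 * \<sigma>1 * m1 \<le> b" "12 * \<sigma>1 * m2 \<le> b"
  shows "sampled_target n1 n2 r P S W Xs \<sigma>1 \<sigma> \<Omega> p b m1 m2"
proof unfold_locales
  fix A B :: "real mat"
  assume AB: "A \<in> carrier_mat r n2" "B \<in> carrier_mat n1 r"
  have c: "P * A + B * W\<^sup>T \<in> carrier_mat n1 n2" using AB W by (auto intro!: add_carrier_mat mult_carrier_mat)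
  have on: "(norm_F_on S X)\<^sup>2 = (\<Sum>q\<in>S. (X $$ q)\<^sup>2)" for S X by (simp add: norm_F_on_def L2_set_def sum_nonneg)
  show "(norm_F_on \<Omega> (P * A + B * W\<^sup>T))\<^sup>2 \<le> 8 * p * (norm_F (P * A + B * W\<^sup>T))\<^sup>2"
    using upper tangent_mat[OF AB] unfolding norm_F_eq_on[OF c] on by blast
  show "p / 2 * (norm_F (P * A + B * W\<^sup>T))\<^sup>2 \<le> (norm_F_on \<Omega> (P * A + B * W\<^sup>T))\<^sup>2"
    using lower tangent_mat[OF AB] unfolding norm_F_eq_on[OF c] on by blast
next
  fix A B :: "real mat"
  assume "A \<in> carrier_mat n1 r" "B \<in> carrier_mat n2 r" "\<And>i. i < n1 \<Longrightarrow> (vnorm (row A i))\<^sup>2 \<le> b"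
    "\<And>j. j < n2 \<Longrightarrow> (vnorm (row B j))\<^sup>2 \<le> b"
  then show "(norm_F_on \<Omega> (A * B\<^sup>T))\<^sup>2 \<le> p * (8 * ((norm_F A)\<^sup>2 + (norm_F B)\<^sup>2)\<^sup>2
           + \<sigma> / 10000 * ((norm_F A)\<^sup>2 + (norm_F B)\<^sup>2))"
    using p by (intro product_bound_of_discrepancy[OF disc \<Omega> _ b \<theta>]) auto
qed (use \<Omega> p rows m in auto)

end

text \<open>Translates feasible sets and objective into the deterministic setting and iterates the
  step. At the start the bound \<open>1 / 16\<close> leaves half of the allowed
  \<open>\<sigma> / 8\<close> for the term \<open>94 * cond_sqrt * err\<close>.\<close>

lemma (in sampled_target) GNMR_error_halves:
  assumes \<sigma>_eq: "\<sigma>1 = singular_value 1 Xs" "\<sigma> = singular_value r Xs"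
    and n: "0 < n1" "0 < n2" and rate: "p = sampling_rate n1 n2 \<Omega>"
    and rows: "m1 = \<mu> * real r / real n1" "m2 = \<mu> * real r / real n2"
    and init: "(U 0, V 0) \<in> B_err n1 n2 r Xs (1 / (1000000 * sqrt (\<sigma>1 / \<sigma>))) \<inter> B_bln n1 n2 r Xs (1 / 16) \<inter> B_mu n1 n2 r Xs \<mu>"
    and run: "constrained_GNMR n1 n2 r \<mu> Xs \<Omega> U V"
  shows "norm_F (U (Suc t) * (V (Suc t))\<^sup>T - Xs) \<le> 1 / 2 * norm_F (U t * (V t)\<^sup>T - Xs)"
proof -
  have B_mu: "(A, B) \<in> B_mu n1 n2 r Xs \<mu> \<longleftrightarrow> flat A B" for A B
  proof (cases "A \<in> carrier_mat n1 r \<and> B \<in> carrier_mat n2 r")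
    case True
    have "3 * \<mu> * real r * \<sigma>1 / real n1 = 3 * \<sigma>1 * m1" "3 * \<mu> * real r * \<sigma>1 / real n2 = 3 * \<sigma>1 * m2"
      by (simp_all add: rows)
    then show ?thesis
      unfolding B_mu_def \<sigma>_eq(1)[symmetric] flat_def factor_mats_def
      using True norm_2_inf_le_sqrt_iff[of A n1 r] norm_2_inf_le_sqrt_iff[of B n2 r] n by simp
  qed (auto simp: B_mu_def flat_def factor_mats_def)
  have C_step: "(A, B) \<in> C_step n1 n2 r Xs \<Omega> C D \<longleftrightarrow>
      (norm_F (A - C))\<^sup>2 + (norm_F (B - D))\<^sup>2 \<le> 8 / (p * \<sigma>) * (norm_F_on \<Omega> (C * D\<^sup>T - Xs))\<^sup>2"
    if "flat A B" for A B C D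
  proof -
    have "A \<in> carrier_mat n1 r" "B \<in> carrier_mat n2 r" using that by (auto simp: flat_def)
    then show ?thesis
      unfolding C_step_def factor_mats_def rate[symmetric] \<sigma>_eq(2)[symmetric] by simp
  qed
  have obj: "GNMR_objective \<Omega> (sample_entries \<Omega> Xs) C D (A, B)
      = (norm_F_on \<Omega> ((C * B\<^sup>T + A * D\<^sup>T - C * D\<^sup>T) - Xs))\<^sup>2"
    if "A \<in> carrier_mat n1 r" "B \<in> carrier_mat n2 r" "C \<in> carrier_mat n1 r" "D \<in> carrier_mat n2 r" for A B C D
  proof -
    have c: "C * D\<^sup>T \<in> carrier_mat n1 n2" using that by (auto intro!: mult_carrier_mat)
    have "L2_set (\<lambda>ij. sample_entries \<Omega> (C * B\<^sup>T + A * D\<^sup>T - C * D\<^sup>T) ij - sample_entries \<Omega> Xs ij) \<Omega>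
        = L2_set (\<lambda>ij. ((C * B\<^sup>T + A * D\<^sup>T - C * D\<^sup>T) - Xs) $$ ij) \<Omega>"
    proof (rule L2_set_cong)
      fix q assume q: "q \<in> \<Omega>"
      then obtain i j where ij: "q = (i, j)" "i < n1" "j < n2" using \<Omega> by auto
      show "sample_entries \<Omega> (C * B\<^sup>T + A * D\<^sup>T - C * D\<^sup>T) q - sample_entries \<Omega> Xs q
          = ((C * B\<^sup>T + A * D\<^sup>T - C * D\<^sup>T) - Xs) $$ q"
        unfolding sample_entries_def ij(1) using q[unfolded ij(1)] ij(2,3) Xs_carrier
        by (simp only: restrict_apply' index_minus_mat(1) carrier_matD)
    qed simp
    then show ?thesis by (simp add: GNMR_objective_def norm_F_on_def)
  qed
  have step: "err (U (Suc t)) (V (Suc t)) \<le> 1 / 2 * err (U t) (V t)" "basin (U (Suc t)) (V (Suc t))"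
    if basin: "basin (U t) (V t)" for t
  proof -
    let ?f = "GNMR_objective \<Omega> (sample_entries \<Omega> Xs) (U t) (V t)"
    let ?P = "\<lambda>UV. UV \<in> B_mu n1 n2 r Xs \<mu> \<inter> C_step n1 n2 r Xs \<Omega> (U t) (V t)"
    have min: "is_arg_min ?f ?P (U (Suc t), V (Suc t))" using run by (simp add: constrained_GNMR_def)
    then have feasible: "?P (U (Suc t), V (Suc t))" by (simp only: is_arg_min_def)
    then have flat': "flat (U (Suc t)) (V (Suc t))" using B_mu by simp
    have carr: "U t \<in> carrier_mat n1 r" "V t \<in> carrier_mat n2 r"
      "U (Suc t) \<in> carrier_mat n1 r" "V (Suc t) \<in> carrier_mat n2 r"
      using basin flat' by (auto simp: basin_def flat_def)
    have near: "(norm_F (U (Suc t) - U t))\<^sup>2 + (norm_F (V (Suc t) - V t))\<^sup>2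
        \<le> 8 / (p * \<sigma>) * (norm_F_on \<Omega> (U t * (V t)\<^sup>T - Xs))\<^sup>2"
      using feasible C_step[OF flat'] by simp
    have opt: "norm_F_on \<Omega> ((U t * (V (Suc t))\<^sup>T + U (Suc t) * (V t)\<^sup>T - U t * (V t)\<^sup>T) - Xs)
        \<le> norm_F_on \<Omega> ((U t * B\<^sup>T + A * (V t)\<^sup>T - U t * (V t)\<^sup>T) - Xs)"
      if AB: "flat A B" and close: "(norm_F (A - U t))\<^sup>2 + (norm_F (B - V t))\<^sup>2
        \<le> 8 / (p * \<sigma>) * (norm_F_on \<Omega> (U t * (V t)\<^sup>T - Xs))\<^sup>2" for A B
    proof -
      have "?P (A, B)" using AB close B_mu C_step[OF AB] by simp
      then have "?f (U (Suc t), V (Suc t)) \<le> ?f (A, B)" using min unfolding is_arg_min_def not_less[symmetric] by blast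
      then show ?thesis
        unfolding obj[OF carr(3,4,1,2)] using AB obj[of A B "U t" "V t"] carr
        by (simp add: flat_def)
    qed
    from basin_step[OF basin flat' near opt]
    show "err (U (Suc t)) (V (Suc t)) \<le> 1 / 2 * err (U t) (V t)" "basin (U (Suc t)) (V (Suc t))" by blast+
  qed
  have "basin (U t) (V t)" for t
  proof (induction t)
    case 0
    have e: "err (U 0) (V 0) \<le> 1 / (1000000 * cond_sqrt) * \<sigma>" and i: "imb (U 0) (V 0) \<le> \<sigma> / 16"
      using init unfolding B_err_def B_bln_def \<sigma>_eq(2)[symmetric]
      by (auto simp: err_def imb_def cond_sqrt_def)
    have f: "flat (U 0) (V 0)" using init B_mu by blast
    have k: "1 \<le> cond_sqrt" by (rule cond_sqrt_ge_1)
    have "cond_sqrt * err (U 0) (V 0) \<le> cond_sqrt * (1 / (1000000 * cond_sqrt) * \<sigma>)" using e k by (intro mult_left_mono) auto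
    then have "cond_sqrt * err (U 0) (V 0) \<le> \<sigma> / 1000000" using k by simp
    then show ?case using i f \<sigma> by (simp add: basin_def)
  next
    case (Suc t)
    then show ?case by (rule step(2))
  qed
  from step(1)[OF this] show ?thesis by (simp add: err_def)
qed

lemma prob_GNMR_ge:
  fixes \<beta> :: real
  assumes \<beta>: "0 < \<beta>" "\<beta> \<le> 1" and n: "n = max n1 n2" and min: "\<beta> * real n \<le> real (min n1 n2)"
    and Xs: "Xs \<in> incoherent_mats n1 n2 r \<mu> \<kappa>" and m: "m \<le> n1 * n2" and p: "p = real m / (real n1 * real n2)"
    and rate: "(10000000 / \<beta>)\<^sup>2 * \<mu> * real r * max (ln (real n)) (\<mu> * real r * \<kappa>\<^sup>2) \<le> real n * p"
  defines "good \<equiv> {\<Omega>. \<forall>U V. (U 0, V 0) \<in> B_err n1 n2 r Xs (1 / (1000000 * sqrt \<kappa>))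
                        \<inter> B_bln n1 n2 r Xs (1 / 16) \<inter> B_mu n1 n2 r Xs \<mu> \<longrightarrow>
                     constrained_GNMR n1 n2 r \<mu> Xs \<Omega> U V \<longrightarrow>
                     (\<forall>t. norm_F (U (Suc t) * transpose_mat (V (Suc t)) - Xs)
                            \<le> 1 / 2 * norm_F (U t * transpose_mat (V t) - Xs))}"
  shows "1 - 3 / real n ^ 3 \<le> measure_pmf.prob (uniform_sample n1 n2 m) good"
proof -
  define \<sigma>1 where "\<sigma>1 = singular_value 1 Xs"
  define \<sigma> where "\<sigma> = singular_value r Xs"
  have r: "1 \<le> r" and inc: "incoherent n1 n2 r \<mu> Xs" and \<kappa>: "\<kappa> = \<sigma>1 / \<sigma>"
    using Xs by (auto simp: incoherent_mats_def \<sigma>1_def \<sigma>_def)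
  obtain P S W where svd: "is_svd n1 n2 r Xs P S W"
    and P_inf: "norm_2_inf P \<le> sqrt (\<mu> * real r / real n1)" and W_inf: "norm_2_inf W \<le> sqrt (\<mu> * real r / real n2)"
    using inc unfolding incoherent_def by blast
  interpret target n1 n2 r P S W Xs \<sigma>1 \<sigma>
    unfolding \<sigma>1_def \<sigma>_def by (rule svd_target[OF svd r])
  \<comment> \<open>Since \<open>1 \<le> r\<close> there is a column of norm 1, which rules out an
    empty dimension.\<close>
  have dims: "0 < k" if Q: "Q \<in> carrier_mat k r" "Q\<^sup>T * Q = 1\<^sub>m r" for Q :: "real mat" and k
    using orthonormal_cols_sum[OF Q, of 0 0] r by (cases k) auto
  have n0: "0 < n1" "0 < n2" using dims[OF P PP] dims[OF W WW] .
  have n1n: "real n1 \<le> real n" "real n2 \<le> real n" "0 < real n" using n n0 by auto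
  have \<beta>n: "\<beta> * real n \<le> real n1" "\<beta> * real n \<le> real n2" using min by auto
  have \<beta>n0: "0 < \<beta> * real n" using \<beta> n1n by simp
  define a where "a = \<mu> * real r"
  have P_row: "(vnorm (row P i))\<^sup>2 \<le> a / real n1" if "i < n1" for i
    using P_inf norm_2_inf_le_sqrt_iff[OF P n0(1)] that by (simp add: a_def)
  have W_row: "(vnorm (row W j))\<^sup>2 \<le> a / real n2" if "j < n2" for j
    using W_inf norm_2_inf_le_sqrt_iff[OF W n0(2)] that by (simp add: a_def)
  \<comment> \<open>Incoherence forces \<open>\<mu>\<close> to be at least 1: the squared entries of
    \<open>P\<close> sum to \<open>r\<close>, and each of the \<open>n1\<close> rows contributes at
    most \<open>a / n1\<close>.\<close>
  have a: "1 \<le> a"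
  proof -
    have "real r = (\<Sum>j<r. \<Sum>i<n1. (P $$ (i, j))\<^sup>2)"
      using orthonormal_cols_sum[OF P PP] by (simp add: power2_eq_square)
    also have "\<dots> = (norm_F P)\<^sup>2" unfolding norm_F_square[OF P] by (rule sum.swap)
    also have "\<dots> \<le> (\<Sum>i<n1. a / real n1)" unfolding norm_F_square_rows[OF P] by (intro sum_mono P_row) simp
    also have "\<dots> = a" using n0 by simp
    finally show ?thesis using r by linarith
  qed
  have k1: "1 \<le> \<kappa>" using \<sigma> by (simp add: \<kappa>)
  define C where "C = (10000000 / \<beta>)\<^sup>2"
  have C0: "0 \<le> C * a" using a by (simp add: C_def)
  have "1 / \<beta> * 1 \<le> 1 / \<beta> * (1 / \<beta>)" using \<beta> by (intro mult_left_mono) auto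
  then have C\<beta>: "100000000000000 / \<beta> \<le> C" by (simp add: C_def power2_eq_square)
  have "100000000000000 \<le> 100000000000000 / \<beta>" using \<beta> by (simp add: field_simps)
  with C\<beta> have C1: "100000000000000 \<le> C" by linarith
  have Ca: "C * a * max (ln (real n)) (a * \<kappa>\<^sup>2) \<le> real n * p" using rate by (simp add: C_def a_def mult.assoc)
  have rate1: "C * a * ln (real n) \<le> real n * p"
    using mult_left_mono[OF max.cobounded1 C0] Ca by (rule order_trans)
  have rate2: "C * a * (a * \<kappa>\<^sup>2) \<le> real n * p"
    using mult_left_mono[OF max.cobounded2 C0] Ca by (rule order_trans)
  have "1 \<le> a * \<kappa>\<^sup>2" "1 \<le> a * (a * \<kappa>\<^sup>2)"
  proof -
    have "1 \<le> \<kappa>\<^sup>2" using k1 by (simp add: one_le_power)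
    then show *: "1 \<le> a * \<kappa>\<^sup>2" using a mult_mono[of 1 a 1 "\<kappa>\<^sup>2"] by simp
    show "1 \<le> a * (a * \<kappa>\<^sup>2)" using a * mult_mono[of 1 a 1 "a * \<kappa>\<^sup>2"] by simp
  qed
  then have "C * 1 \<le> C * (a * (a * \<kappa>\<^sup>2))" using C1 by (intro mult_left_mono) auto
  then have np: "C \<le> real n * p" using rate2 by (simp add: mult.assoc)
  then have "0 < real n * p" using C1 by linarith
  then have p0: "0 < p" using n1n by (simp add: zero_less_mult_iff)
  have p1: "p \<le> 1"
    unfolding p using m n0 by (simp add: field_simps flip: of_nat_mult)
  have "real n * p \<le> real n * 1" using p1 by (intro mult_left_mono) auto
  then have n2: "2 \<le> real n" using np C1 by linarith
  then have ln0: "0 < ln (real n)" by simp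
  define \<rho> where "\<rho> = sqrt (real n * p)"
  have \<rho>: "real n * p = \<rho>\<^sup>2" "1 \<le> \<rho>" using np C1 by (auto simp: \<rho>_def)
  \<comment> \<open>\<open>a / (\<beta> * real n)\<close> dominates both \<open>a / n1\<close> and
    \<open>a / n2\<close>; this is how \<open>\<beta>\<close> gets into the constants.\<close>
  define b where "b = 12 * a * \<sigma>1 / (\<beta> * real n)"
  have \<sigma>1: "0 < \<sigma>1" using \<sigma> by linarith
  have b: "0 < b" using a \<sigma>1 \<beta>n0 by (simp add: b_def)
  have \<rho>_ge: "10000000 * a * \<kappa> / \<beta> \<le> \<rho>"
    unfolding \<rho>_def
  proof (rule real_le_rsqrt)
    have "(10000000 * a * \<kappa> / \<beta>)\<^sup>2 = C * a * (a * \<kappa>\<^sup>2)" by (simp add: C_def power2_eq_square)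
    then show "(10000000 * a * \<kappa> / \<beta>)\<^sup>2 \<le> real n * p" using rate2 by simp
  qed
  \<comment> \<open>Here the second term of the sampling rate is spent: with
    \<open>504 = 42 * 12\<close> the claim asks for \<open>\<rho>\<close> to be at least
    \<open>5040000 * a * \<kappa> / \<beta>\<close>, and \<open>\<rho>_ge\<close> provides 10000000
    in place of 5040000.\<close>
  have \<theta>: "42 * \<rho> * b \<le> p * (\<sigma> / 10000)"
  proof -
    have s: "\<sigma>1 = \<kappa> * \<sigma>" using \<sigma> by (simp add: \<kappa>)
    have "504 * (a * \<kappa> / \<beta>) \<le> \<rho> / 10000"
    proof -
      have "0 \<le> a * \<kappa> / \<beta>" using a k1 \<beta> by simp
      moreover have "10000000 * (a * \<kappa> / \<beta>) \<le> \<rho>" using \<rho>_ge by simp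
      moreover have "504 * c \<le> \<rho> / 10000" if "0 \<le> c" "10000000 * c \<le> \<rho>" for c
        using that by linarith
      ultimately show ?thesis by blast
    qed
    then have "\<rho> * \<sigma> * (504 * (a * \<kappa> / \<beta>)) \<le> \<rho> * \<sigma> * (\<rho> / 10000)"
      using \<rho>(2) \<sigma> by (intro mult_left_mono) auto
    also have "\<dots> = p * (\<sigma> / 10000) * real n"
      using \<rho>(1) by (simp add: power2_eq_square mult_ac)
    finally have "\<rho> * \<sigma> * (504 * (a * \<kappa> / \<beta>)) / real n \<le> p * (\<sigma> / 10000)"
      unfolding pos_divide_le_eq[OF n1n(3)] .
    moreover have "42 * \<rho> * b = \<rho> * \<sigma> * (504 * (a * \<kappa> / \<beta>)) / real n" by (simp add: b_def s)
    ultimately show ?thesis by simp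
  qed
  have div_le: "a / real n1 \<le> a / (\<beta> * real n)" "a / real n2 \<le> a / (\<beta> * real n)"
    using \<beta>n \<beta>n0 a by (auto intro!: divide_left_mono)
  have bm: "12 * \<sigma>1 * (a / real n1) \<le> b" "12 * \<sigma>1 * (a / real n2) \<le> b"
    using mult_left_mono[OF div_le(1), of "12 * \<sigma>1"] mult_left_mono[OF div_le(2), of "12 * \<sigma>1"] \<sigma>1
    by (simp_all add: b_def mult_ac)
  \<comment> \<open>Twice the common row bound: the column factor and the row factor each contribute
    one half.\<close>
  define \<nu> where "\<nu> = 2 * (a / (\<beta> * real n))"
  have \<nu>0: "0 \<le> \<nu>" using a \<beta>n0 by (simp add: \<nu>_def)
  have row_sum: "(vnorm (row Q i))\<^sup>2 = (\<Sum>c<r. (Q $$ (i, c))\<^sup>2)" if "Q \<in> carrier_mat k r" "i < k" for Q i k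
    using that by (simp add: vnorm_def L2_set_def sum_nonneg)
  have \<nu>P: "(\<Sum>c<r. (P $$ (i, c))\<^sup>2) \<le> \<nu> / 2" if "i < n1" for i
    using P_row[OF that] div_le unfolding row_sum[OF P that] by (simp add: \<nu>_def)
  have \<nu>W: "(\<Sum>c<r. (W $$ (j, c))\<^sup>2) \<le> \<nu> / 2" if "j < n2" for j
    using W_row[OF that] div_le unfolding row_sum[OF W that] by (simp add: \<nu>_def)
  have \<nu>_rate: "46 * \<nu> * ln (real n) \<le> p"
  proof -
    have "92 / \<beta> \<le> 100000000000000 / \<beta>" using \<beta> by (intro divide_right_mono) auto
    then have "92 / \<beta> * (a * ln (real n)) \<le> C * (a * ln (real n))"
      using C\<beta> a ln0 by (intro mult_right_mono) auto
    also have "\<dots> \<le> p * real n" using rate1 by (simp add: mult.assoc mult.commute[of p])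
    finally have "92 / \<beta> * (a * ln (real n)) / real n \<le> p"
      unfolding pos_divide_le_eq[OF n1n(3)] .
    then show ?thesis by (simp add: \<nu>_def)
  qed
  have nn: "real n \<le> real n1 * real n2" "real n1 * real n2 \<le> (real n)\<^sup>2"
  proof -
    have "n \<le> n1 * n2" using n n0 by (auto simp: max_def)
    then show "real n \<le> real n1 * real n2" by (simp flip: of_nat_mult)
    show "real n1 * real n2 \<le> (real n)\<^sup>2" unfolding power2_eq_square using n1n by (intro mult_mono) auto
  qed
  have mm: "8 * ln (real n) \<le> real m"
  proof -
    have "8 * 1 \<le> C * a" using C1 a by (intro mult_mono) auto
    then have "8 * ln (real n) \<le> C * a * ln (real n)" using ln0 by (intro mult_right_mono) auto
    also have "\<dots> \<le> real n * p" by (rule rate1)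
    also have "\<dots> \<le> real n1 * real n2 * p" using nn p0 by (intro mult_right_mono) auto
    also have "\<dots> = real m" using n0 by (simp add: p)
    finally show ?thesis .
  qed
  let ?prob = "measure_pmf.prob (uniform_sample n1 n2 m)"
  \<comment> \<open>Sets outside the support of the sample, of probability 0; with them the bad sets
    and \<open>good\<close> cover everything.\<close>
  define A0 where "A0 = {\<Omega>. \<not> (\<Omega> \<subseteq> {..<n1} \<times> {..<n2} \<and> card \<Omega> = m)}"
  define A1 where "A1 = {\<Omega>. \<not> (\<forall>Z. space.tangent Z \<longrightarrow>
      (\<Sum>q\<in>\<Omega>. (Z q)\<^sup>2) \<le> 8 * p * (\<Sum>q\<in>{..<n1} \<times> {..<n2}. (Z q)\<^sup>2))}"
  define A2 where "A2 = {\<Omega>. \<not> (\<forall>Z. space.tangent Z \<longrightarrow>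
      p / 2 * (\<Sum>q\<in>{..<n1} \<times> {..<n2}. (Z q)\<^sup>2) \<le> (\<Sum>q\<in>\<Omega>. (Z q)\<^sup>2))}"
  define A3 where "A3 = {\<Omega>. \<not> discrepancy_bound n1 n2 p \<rho> \<Omega>}"
  have prob0: "?prob A0 = 0"
  proof -
    have "{\<Omega>. \<Omega> \<subseteq> {..<n1} \<times> {..<n2} \<and> card \<Omega> = m} \<inter> A0 = {}" by (auto simp: A0_def)
    then show ?thesis unfolding prob_uniform_sample[OF m] by (simp only: card.empty of_nat_0 div_0)
  qed
  have prob1: "?prob A1 \<le> 1 / real n ^ 3" unfolding A1_def
    by (rule space.prob_tangent_RIP(1)[OF n2 nn(2) \<nu>P \<nu>W \<nu>0 m mm p \<nu>_rate])
  have prob2: "?prob A2 \<le> 1 / real n ^ 3" unfolding A2_def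
    by (rule space.prob_tangent_RIP(2)[OF n2 nn(2) \<nu>P \<nu>W \<nu>0 m mm p \<nu>_rate])
  have prob3: "?prob A3 \<le> 1 / real n ^ 3" unfolding A3_def
    by (rule prob_discrepancy_bound[OF n1n(1,2) _ \<rho> m p]) (use n2 in simp)
  have "\<Omega> \<in> good" if "\<Omega> \<notin> A0" "\<Omega> \<notin> A1" "\<Omega> \<notin> A2" "\<Omega> \<notin> A3" for \<Omega>
  proof -
    have sub: "\<Omega> \<subseteq> {..<n1} \<times> {..<n2}" and card: "card \<Omega> = m" using that(1) by (auto simp: A0_def)
    have rate_eq: "p = sampling_rate n1 n2 \<Omega>" by (simp add: sampling_rate_def card p)
    have "sampled_target n1 n2 r P S W Xs \<sigma>1 \<sigma> \<Omega> p b (a / real n1) (a / real n2)"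
      using that(2,3,4) by (intro sampled_targetI[OF sub p0 b _ \<theta> _ _ P_row W_row bm]) (auto simp: A1_def A2_def A3_def)
    then interpret sampled_target n1 n2 r P S W Xs \<sigma>1 \<sigma> \<Omega> p b "a / real n1" "a / real n2" .
    from GNMR_error_halves[OF \<sigma>1_def \<sigma>_def n0 rate_eq, of \<mu>] show ?thesis
      unfolding good_def \<kappa> by (auto simp: a_def)
  qed
  then have "UNIV \<subseteq> good \<union> (A0 \<union> (A1 \<union> (A2 \<union> A3)))" by blast
  then have "1 \<le> ?prob (good \<union> (A0 \<union> (A1 \<union> (A2 \<union> A3))))"
    by (metis UNIV_eq_I measure_pmf.prob_space space_measure_pmf subsetD order_refl UNIV_I)
  also have "\<dots> \<le> ?prob good + ?prob (A0 \<union> (A1 \<union> (A2 \<union> A3)))" by (rule measure_Un_le) auto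
  also have "?prob (A0 \<union> (A1 \<union> (A2 \<union> A3))) \<le> ?prob A0 + ?prob (A1 \<union> (A2 \<union> A3))"
    by (rule measure_Un_le) auto
  also have "?prob (A1 \<union> (A2 \<union> A3)) \<le> ?prob A1 + ?prob (A2 \<union> A3)"
    by (rule measure_Un_le) auto
  also have "?prob (A2 \<union> A3) \<le> ?prob A2 + ?prob A3" by (rule measure_Un_le) auto
  finally show ?thesis using prob0 prob1 prob2 prob3 by simp
qed

theorem theorem3p5:
  fixes \<beta> :: real
  assumes "0 < \<beta>" "\<beta> \<le> 1"
  shows "\<exists>C c\<^sub>e c\<^sub>l :: real. 0 < C \<and> 0 < c\<^sub>e \<and> 0 < c\<^sub>l \<and>
    (\<forall>(n1::nat) (n2::nat) (n::nat) (r::nat) (m::nat) (p::real) (\<mu>::real) (\<kappa>::real) (Xs::real mat).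
       n = max n1 n2 \<longrightarrow>
       \<beta> * real n \<le> real (min n1 n2) \<longrightarrow>
       Xs \<in> incoherent_mats n1 n2 r \<mu> \<kappa> \<longrightarrow>
       m \<le> n1 * n2 \<longrightarrow>
       p = real m / (real n1 * real n2) \<longrightarrow>
       C * \<mu> * real r * max (ln (real n)) (\<mu> * real r * \<kappa>\<^sup>2) \<le> real n * p \<longrightarrow>
       1 - 3 / real n ^ 3 \<le>
         measure_pmf.prob (uniform_sample n1 n2 m)
           {\<Omega>. \<forall>U V. (U 0, V 0) \<in> B_err n1 n2 r Xs (1 / (c\<^sub>e * sqrt \<kappa>))
                        \<inter> B_bln n1 n2 r Xs (1 / c\<^sub>l) \<inter> B_mu n1 n2 r Xs \<mu> \<longrightarrow>
                     constrained_GNMR n1 n2 r \<mu> Xs \<Omega> U V \<longrightarrow>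
                     (\<forall>t. norm_F (U (Suc t) * transpose_mat (V (Suc t)) - Xs)
                            \<le> 1 / 2 * norm_F (U t * transpose_mat (V t) - Xs))})"
proof (intro exI conjI allI impI)
  \<comment> \<open>Only the first witness depends on \<open>\<beta>\<close>; 1000000 and 16 are
    absolute.\<close>
  show "0 < (10000000 / \<beta>)\<^sup>2" "(0::real) < 1000000" "(0::real) < 16" using assms by simp_all
qed (rule prob_GNMR_ge[OF assms])

end
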